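(* Let $(L,\triangleright,[\cdot,\cdot])$ be a post-Lie algebra and let $(L,\blacktriangleright,[\cdot,\cdot]^{\mathrm d})$ be a $\diamond$-geometric post-Lie deformation of it, where $\blacktriangleright:=\triangleright+\diamond$ and $[\cdot,\cdot]^{\mathrm d}:=[\cdot,\cdot]-[\cdot,\cdot]_\diamond$. Let $[\![\cdot,\cdot]\!]:=[\cdot,\cdot]_\triangleright+[\cdot,\cdot]$. Then there is an isomorphism of Hopf algebras $$\Phi_{\blacktriangleright}:\left(\mathcal{U}_{[\![\cdot,\cdot]\!]}(L),\mathsf{conc},\Delta_\ast\right)\xrightarrow{\ \sim\ }\left(\mathcal{U}_{[\cdot,\cdot]^{\mathrm d}}(L),\star_{\blacktriangleright},\Delta_\ast\right),\qquad x_1\cdots x_n\longmapsto x_1\star_{\blacktriangleright}\cdots\star_{\blacktriangleright}x_n\quad(x_i\in L).$$ As a result, by composition, there is an isomorphism of Hopf algebras $$\Phi_{\blacktriangleright}\circ\Phi_{\triangleright}^{-1}:\left(\mathcal{U}_{[\cdot,\cdot]}(L),\star_{\triangleright},\Delta_\ast\right)\xrightarrow{\ \sim\ }\left(\mathcal{U}_{[\cdot,\cdot]^{\mathrm d}}(L),\star_{\blacktriangleright},\Delta_\ast\right),\qquad x_1\star_{\triangleright}\cdots\star_{\triangleright}x_n\longmapsto x_1\star_{\blacktriangleright}\cdots\star_{\blacktriangleright}x_n\quad(x_i\in L),$$ where $\Phi_{\triangleright}:(\mathcal{U}_{[\![\cdot,\cdot]\!]}(L),\mathsf{conc},\Delta_\ast)\to(\mathcal{U}_{[\cdot,\cdot]}(L),\star_\triangleright,\Delta_\ast)$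 is the Hopf algebra isomorphism $x_1\cdots x_n\mapsto x_1\star_\triangleright\cdots\star_\triangleright x_n$.
   Context: Vector spaces are over $\mathbb{R}$. For a bilinear operation $\ast$ on $L$: $[x,y]_\ast:=x\ast y-y\ast x$ and $\mathsf{a}_\ast(x,y,z):=x\ast(y\ast z)-(x\ast y)\ast z$. A (left) post-Lie algebra $(L,\triangleright,[\cdot,\cdot])$ is a vector space with bilinear operations such that $[\cdot,\cdot]$ is a Lie bracket, $x\triangleright[y,z]=[x\triangleright y,z]+[y,x\triangleright z]$ and $[x,y]\triangleright z=\mathsf{a}_\triangleright(x,y,z)-\mathsf{a}_\triangleright(y,x,z)$. Then $[\![\cdot,\cdot]\!]:=[\cdot,\cdot]_\triangleright+[\cdot,\cdot]$ is known to be a Lie bracket on $L$. Geometric post-Lie deformation. A bilinear operation $\diamond$ on $L$ is assumed to satisfy: (i) null curvature: $x\diamond(y\diamond z)-y\diamond(x\diamond z)-[x,y]\diamond z=0$; (ii) constant torsion: with $\mathbf{T}(x,y):=[x,y]_\diamond-[x,y]$, $x\diamond\mathbf{T}(y,z)=\mathbf{T}(x\diamond y,z)+\mathbf{T}(y,x\diamond z)$; (iii) $x\triangleright(y\diamond z)=(x\triangleright y)\diamond z+y\diamond(x\triangleright z)$; for all $x,y,z\in L$. Then $(L,\triangleright+\diamond,[\cdot,\cdot]-[\cdot,\cdot]_\diamond)$ is a post-Lie algebra, called the $\diamond$-geometric post-Lie deformation of $(L,\triangleright,[\cdot,\cdot])$. Enveloping algebras. For a Lie bracket $[\cdot,\cdot]$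 on $L$, $\mathcal{U}_{[\cdot,\cdot]}(L)$ is the universal enveloping algebra (the tensor algebra modulo the two-sided ideal generated by $x\otimes y-y\otimes x-[x,y]$), with concatenation product $\mathsf{conc}$ (written by juxtaposition), unit $\mathbb{1}$, counit $\varepsilon$ and coshuffle coproduct $\Delta_\ast$, the algebra morphism for concatenation for which every $x\in L$ is primitive; write $\Delta_\ast(u)=\sum u^{(1)}\otimes u^{(2)}$. For a post-Lie algebra $(L,\triangleright,[\cdot,\cdot])$, $\triangleright$ extends uniquely to $\mathcal{U}_{[\cdot,\cdot]}(L)$ by: $\mathbb{1}\triangleright u=u$, $u\triangleright\mathbb{1}=\varepsilon(u)\mathbb{1}$; $(xv)\triangleright w=x\triangleright(v\triangleright w)-(x\triangleright v)\triangleright w$; $u\triangleright(vw)=\sum(u^{(1)}\triangleright v)(u^{(2)}\triangleright w)$, for $x\in L$, $u,v,w\in\mathcal{U}_{[\cdot,\cdot]}(L)$. The product $u\star_\triangleright v:=\sum u^{(1)}(u^{(2)}\triangleright v)$ is associative and $(\mathcal{U}_{[\cdot,\cdot]}(L),\star_\triangleright,\Delta_\ast,\mathbb{1},\varepsilon)$ is a Hopf algebra. The product $\star_\blacktriangleright$ on $\mathcal{U}_{[\cdot,\cdot]^{\mathrm d}}(L)$ is defined in the same way from the post-Lie algebra $(L,\blacktriangleright,[\cdot,\cdot]^{\mathrm d})$. *)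

theory Defs
  imports
    "HOL-Analysis.Linear_Algebra"
    "HOL-Analysis.Finite_Function_Topology"
    "HOL-Algebra.QuotRing"
    "HOL-Algebra.Module"
begin

section \<open>Post-Lie algebras and their geometric deformations\<close>

definition commutator :: "('a::real_vector \<Rightarrow> 'a \<Rightarrow> 'a) \<Rightarrow> 'a \<Rightarrow> 'a \<Rightarrow> 'a" where
  "commutator p x y = p x y - p y x"

definition associator :: "('a::real_vector \<Rightarrow> 'a \<Rightarrow> 'a) \<Rightarrow> 'a \<Rightarrow> 'a \<Rightarrow> 'a \<Rightarrow> 'a" where
  "associator p x y z = p x (p y z) - p (p x y) z"

definition lie_bracket :: "('a::real_vector \<Rightarrow> 'a \<Rightarrow> 'a) \<Rightarrow> bool" where
  "lie_bracket br \<longleftrightarrow> bilinear br \<and> (\<forall>x. br x x = 0) \<and>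
     (\<forall>x y z. br x (br y z) + br y (br z x) + br z (br x y) = 0)"

definition post_lie_algebra ::
    "('a::real_vector \<Rightarrow> 'a \<Rightarrow> 'a) \<Rightarrow> ('a \<Rightarrow> 'a \<Rightarrow> 'a) \<Rightarrow> bool" where
  "post_lie_algebra tr br \<longleftrightarrow> bilinear tr \<and> lie_bracket br \<and>
     (\<forall>x y z. tr x (br y z) = br (tr x y) z + br y (tr x z)) \<and>
     (\<forall>x y z. tr (br x y) z = associator tr x y z - associator tr y x z)"

definition torsion ::
    "('a::real_vector \<Rightarrow> 'a \<Rightarrow> 'a) \<Rightarrow> ('a \<Rightarrow> 'a \<Rightarrow> 'a) \<Rightarrow> 'a \<Rightarrow> 'a \<Rightarrow> 'a" where
  "torsion dia br x y = commutator dia x y - br x y"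

definition geometric_deformation ::
    "('a::real_vector \<Rightarrow> 'a \<Rightarrow> 'a) \<Rightarrow> ('a \<Rightarrow> 'a \<Rightarrow> 'a) \<Rightarrow> ('a \<Rightarrow> 'a \<Rightarrow> 'a) \<Rightarrow> bool" where
  "geometric_deformation tr br dia \<longleftrightarrow> bilinear dia \<and>
     (\<forall>x y z. dia x (dia y z) - dia y (dia x z) - dia (br x y) z = 0) \<and>
     (\<forall>x y z. dia x (torsion dia br y z) =
        torsion dia br (dia x y) z + torsion dia br y (dia x z)) \<and>
     (\<forall>x y z. tr x (dia y z) = dia (tr x y) z + dia y (tr x z))"


section \<open>Real algebras with explicit carriers\<close>

text \<open>Enveloping algebras depend on the bracket, so they have to be algebras on carrier sets. We use
  the \<open>module\<close> record of HOL-Algebra, which has all the operations of an algebra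
  over the reals.\<close>

definition type_algebra :: "(real, 'a::real_algebra_1) module" where
  "type_algebra = \<lparr>carrier = UNIV, mult = (*), one = 1, zero = 0, add = (+), smult = scaleR\<rparr>"

definition unital_algebra :: "(real, 'u, 'm) module_scheme \<Rightarrow> bool" where
  "unital_algebra A \<longleftrightarrow> ring A \<and> Module.module (type_algebra :: (real, real) module) A \<and>
     (\<forall>c. \<forall>u \<in> carrier A. \<forall>v \<in> carrier A.
        c \<odot>\<^bsub>A\<^esub> (u \<otimes>\<^bsub>A\<^esub> v) = (c \<odot>\<^bsub>A\<^esub> u) \<otimes>\<^bsub>A\<^esub> v \<and>
        c \<odot>\<^bsub>A\<^esub> (u \<otimes>\<^bsub>A\<^esub> v) = u \<otimes>\<^bsub>A\<^esub> (c \<odot>\<^bsub>A\<^esub> v))"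

definition linear_map ::
    "(real, 'u, 'm) module_scheme \<Rightarrow> (real, 'v, 'n) module_scheme \<Rightarrow> ('u \<Rightarrow> 'v) \<Rightarrow> bool" where
  "linear_map A B f \<longleftrightarrow> f \<in> carrier A \<rightarrow> carrier B \<and>
     (\<forall>u \<in> carrier A. \<forall>v \<in> carrier A. f (u \<oplus>\<^bsub>A\<^esub> v) = f u \<oplus>\<^bsub>B\<^esub> f v) \<and>
     (\<forall>c. \<forall>u \<in> carrier A. f (c \<odot>\<^bsub>A\<^esub> u) = c \<odot>\<^bsub>B\<^esub> f u)"

definition algebra_hom ::
    "(real, 'u, 'm) module_scheme \<Rightarrow> (real, 'v, 'n) module_scheme \<Rightarrow> ('u \<Rightarrow> 'v) \<Rightarrow> bool" where
  "algebra_hom A B f \<longleftrightarrow> linear_map A B f \<and> f \<in> ring_hom A B"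

definition quotient_algebra ::
    "(real, 'u, 'm) module_scheme \<Rightarrow> 'u set \<Rightarrow> (real, 'u set) module" where
  "quotient_algebra A I =
     \<lparr>carrier = carrier (A Quot I), mult = mult (A Quot I), one = one (A Quot I),
      zero = zero (A Quot I), add = add (A Quot I),
      smult = (\<lambda>c C. \<Union>u\<in>C. I +>\<^bsub>A\<^esub> (c \<odot>\<^bsub>A\<^esub> u))\<rparr>"


section \<open>Tensor products\<close>

text \<open>The tensor product of \<open>A\<close> and \<open>B\<close> is the free vector space on
  \<open>carrier A \<times> carrier B\<close> (inside the finitely supported functions on the
  product type) modulo the span of the bilinearity relations.\<close>

type_synonym ('u, 'v) tens = "('u \<times> 'v \<Rightarrow>\<^sub>0 real) set"

abbreviation basis :: "'k \<Rightarrow> ('k \<Rightarrow>\<^sub>0 real)" where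
  "basis k \<equiv> Poly_Mapping.single k 1"

definition tens_relations ::
    "(real, 'u, 'm) module_scheme \<Rightarrow> (real, 'v, 'n) module_scheme \<Rightarrow> ('u \<times> 'v \<Rightarrow>\<^sub>0 real) set" where
  "tens_relations A B = span
     ({basis (u \<oplus>\<^bsub>A\<^esub> u', v) - basis (u, v) - basis (u', v) | u u' v.
         u \<in> carrier A \<and> u' \<in> carrier A \<and> v \<in> carrier B} \<union>
      {basis (u, v \<oplus>\<^bsub>B\<^esub> v') - basis (u, v) - basis (u, v') | u v v'.
         u \<in> carrier A \<and> v \<in> carrier B \<and> v' \<in> carrier B} \<union>
      {basis (c \<odot>\<^bsub>A\<^esub> u, v) - c *\<^sub>R basis (u, v) | c u v. u \<in> carrier A \<and> v \<in> carrier B} \<union>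
      {basis (u, c \<odot>\<^bsub>B\<^esub> v) - c *\<^sub>R basis (u, v) | c u v. u \<in> carrier A \<and> v \<in> carrier B})"

definition tens_class ::
    "(real, 'u, 'm) module_scheme \<Rightarrow> (real, 'v, 'n) module_scheme \<Rightarrow>
     ('u \<times> 'v \<Rightarrow>\<^sub>0 real) \<Rightarrow> ('u, 'v) tens" where
  "tens_class A B f = {g. g - f \<in> tens_relations A B}"

definition pure_tens ::
    "(real, 'u, 'm) module_scheme \<Rightarrow> (real, 'v, 'n) module_scheme \<Rightarrow> 'u \<Rightarrow> 'v \<Rightarrow> ('u, 'v) tens" where
  "pure_tens A B u v = tens_class A B (basis (u, v))"

definition tensor_product ::
    "(real, 'u, 'm) module_scheme \<Rightarrow> (real, 'v, 'n) module_scheme \<Rightarrow>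
     (real, ('u, 'v) tens) module" where
  "tensor_product A B =
     \<lparr>carrier = tens_class A B ` {f. Poly_Mapping.keys f \<subseteq> carrier A \<times> carrier B},
      mult = (\<lambda>s t. \<Union>f\<in>s. \<Union>g\<in>t. tens_class A B
        (\<Sum>(u, v) \<in> Poly_Mapping.keys f. \<Sum>(u', v') \<in> Poly_Mapping.keys g.
          (Poly_Mapping.lookup f (u, v) * Poly_Mapping.lookup g (u', v')) *\<^sub>R
            basis (u \<otimes>\<^bsub>A\<^esub> u', v \<otimes>\<^bsub>B\<^esub> v'))),
      one = pure_tens A B \<one>\<^bsub>A\<^esub> \<one>\<^bsub>B\<^esub>,
      zero = tens_class A B 0,
      add = (\<lambda>s t. \<Union>f\<in>s. \<Union>g\<in>t. tens_class A B (f + g)),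
      smult = (\<lambda>c s. \<Union>f\<in>s. tens_class A B (c *\<^sub>R f))\<rparr>"

text \<open>The linear map into \<open>P\<close> induced by \<open>b\<close>. The chosen representative is
  irrelevant as long as \<open>b\<close> is bilinear on the carriers, which is the case
  wherever it is used below; for a Sweedler sum, \<open>tens_lift P b (comult H u)\<close> is the sum
  of \<open>b u\<^sup>(\<^sup>1\<^sup>) u\<^sup>(\<^sup>2\<^sup>)\<close>.\<close>

definition tens_lift ::
    "(real, 'w, 'k) module_scheme \<Rightarrow> ('u \<Rightarrow> 'v \<Rightarrow> 'w) \<Rightarrow> ('u, 'v) tens \<Rightarrow> 'w" where
  "tens_lift P b t =
     (let f = (SOME f. f \<in> t)
      in finsum P (\<lambda>(u, v). Poly_Mapping.lookup f (u, v) \<odot>\<^bsub>P\<^esub> b u v) (Poly_Mapping.keys f))"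


section \<open>Hopf algebras\<close>

record 'u hopf = "(real, 'u) module" +
  counit :: "'u \<Rightarrow> real"
  comult :: "'u \<Rightarrow> ('u, 'u) tens"

definition coalgebra :: "'u hopf \<Rightarrow> bool" where
  "coalgebra H \<longleftrightarrow>
     (let HH = tensor_product H H; H_HH = tensor_product H HH; HH_H = tensor_product HH H;
          assoc = tens_lift H_HH (\<lambda>s w. tens_lift H_HH
                    (\<lambda>u v. pure_tens H HH u (pure_tens H H v w)) s)
      in linear_map H HH (comult H) \<and>
         linear_map H (type_algebra :: (real, real) module) (counit H) \<and>
         (\<forall>u \<in> carrier H.
            assoc (tens_lift HH_H (\<lambda>v w. pure_tens HH H (comult H v) w) (comult H u)) =
            tens_lift H_HH (\<lambda>v w. pure_tens H HH v (comult H w)) (comult H u)) \<and>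
         (\<forall>u \<in> carrier H.
            tens_lift H (\<lambda>v w. counit H v \<odot>\<^bsub>H\<^esub> w) (comult H u) = u \<and>
            tens_lift H (\<lambda>v w. counit H w \<odot>\<^bsub>H\<^esub> v) (comult H u) = u))"

definition antipode :: "'u hopf \<Rightarrow> ('u \<Rightarrow> 'u) \<Rightarrow> bool" where
  "antipode H S \<longleftrightarrow> linear_map H H S \<and>
     (\<forall>u \<in> carrier H.
        tens_lift H (\<lambda>v w. S v \<otimes>\<^bsub>H\<^esub> w) (comult H u) = counit H u \<odot>\<^bsub>H\<^esub> \<one>\<^bsub>H\<^esub> \<and>
        tens_lift H (\<lambda>v w. v \<otimes>\<^bsub>H\<^esub> S w) (comult H u) = counit H u \<odot>\<^bsub>H\<^esub> \<one>\<^bsub>H\<^esub>)"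

definition hopf_algebra :: "'u hopf \<Rightarrow> bool" where
  "hopf_algebra H \<longleftrightarrow> unital_algebra H \<and> coalgebra H \<and>
     algebra_hom H (tensor_product H H) (comult H) \<and>
     algebra_hom H (type_algebra :: (real, real) module) (counit H) \<and>
     (\<exists>S. antipode H S)"

text \<open>A morphism of bialgebras between Hopf algebras automatically commutes with the antipodes.\<close>

definition hopf_hom :: "'u hopf \<Rightarrow> 'v hopf \<Rightarrow> ('u \<Rightarrow> 'v) \<Rightarrow> bool" where
  "hopf_hom H K \<phi> \<longleftrightarrow> hopf_algebra H \<and> hopf_algebra K \<and> algebra_hom H K \<phi> \<and>
     (\<forall>u \<in> carrier H. counit K (\<phi> u) = counit H u \<and>
        comult K (\<phi> u) =
          tens_lift (tensor_product K K) (\<lambda>v w. pure_tens K K (\<phi> v) (\<phi> w)) (comult H u))"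

definition hopf_iso :: "'u hopf \<Rightarrow> 'v hopf \<Rightarrow> ('u \<Rightarrow> 'v) \<Rightarrow> bool" where
  "hopf_iso H K \<phi> \<longleftrightarrow> hopf_hom H K \<phi> \<and> bij_betw \<phi> (carrier H) (carrier K)"


section \<open>The tensor algebra\<close>

text \<open>The free monoid; a type of its own because the monoid class instance on lists should be
  concatenation.\<close>

datatype 'a word = Word "'a list"

instantiation word :: (type) monoid_add
begin

definition zero_word :: "'a word" where "zero_word = Word []"

fun plus_word :: "'a word \<Rightarrow> 'a word \<Rightarrow> 'a word" where
  "plus_word (Word xs) (Word ys) = Word (xs @ ys)"

instance
proof
  fix a b c :: "'a word"
  show "a + b + c = a + (b + c)" by (cases a; cases b; cases c) simp
  show "0 + a = a" by (cases a) (simp add: zero_word_def)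
  show "a + 0 = a" by (cases a) (simp add: zero_word_def)
qed

end

text \<open>The direct sum of the tensor powers of \<open>'a\<close>: finitely supported functions on words
  modulo multilinearity in each letter. The convolution product is concatenation.\<close>

definition multilinear_relations :: "('a::real_vector word \<Rightarrow>\<^sub>0 real) set" where
  "multilinear_relations =
     {basis (a + Word [x + y] + b) - basis (a + Word [x] + b) - basis (a + Word [y] + b) | a b x y.
        True} \<union>
     {basis (a + Word [c *\<^sub>R x] + b) - c *\<^sub>R basis (a + Word [x] + b) | a b c x. True}"

lemma lookup_scaleR [simp]:
  fixes f :: "'k \<Rightarrow>\<^sub>0 real"
  shows "Poly_Mapping.lookup (c *\<^sub>R f) k = c * Poly_Mapping.lookup f k"
proof -
  have "finite {i. c *\<^sub>R Poly_Mapping.lookup f i \<noteq> 0}"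
    by (rule finite_subset[OF _ finite_keys[of f]]) (auto simp: in_keys_iff)
  then show ?thesis by (simp add: scaleR_poly_mapping_def)
qed

lemma scaleR_single [simp]: "c *\<^sub>R Poly_Mapping.single k d = Poly_Mapping.single k (c * d :: real)"
  by (rule poly_mapping_eqI) (simp add: lookup_single when_def)

lemma single_sum_keys:
  fixes f :: "'k \<Rightarrow>\<^sub>0 real"
  shows "f = (\<Sum>k\<in>Poly_Mapping.keys f. Poly_Mapping.single k (Poly_Mapping.lookup f k))"
  by (rule poly_mapping_eqI)
    (auto simp: lookup_sum lookup_single when_def in_keys_iff)

lemma scaleR_mult_left:
  fixes f g :: "'k::monoid_add \<Rightarrow>\<^sub>0 real"
  shows "(c *\<^sub>R f) * g = c *\<^sub>R (f * g)"
proof -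
  have "(c *\<^sub>R f) * g = (\<Sum>k\<in>Poly_Mapping.keys f. \<Sum>l\<in>Poly_Mapping.keys g.
      Poly_Mapping.single (k + l) (c * (Poly_Mapping.lookup f k * Poly_Mapping.lookup g l)))"
    by (subst single_sum_keys[of f], subst single_sum_keys[of g])
      (simp add: scaleR_sum_right sum_product mult_single mult.assoc)
  moreover have "c *\<^sub>R (f * g) = (\<Sum>k\<in>Poly_Mapping.keys f. \<Sum>l\<in>Poly_Mapping.keys g.
      Poly_Mapping.single (k + l) (c * (Poly_Mapping.lookup f k * Poly_Mapping.lookup g l)))"
    by (subst single_sum_keys[of f], subst single_sum_keys[of g])
      (simp add: scaleR_sum_right sum_product mult_single)
  ultimately show ?thesis by simp
qed

lemma scaleR_mult_right:
  fixes f g :: "'k::monoid_add \<Rightarrow>\<^sub>0 real"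
  shows "f * (c *\<^sub>R g) = c *\<^sub>R (f * g)"
proof -
  have "f * (c *\<^sub>R g) = (\<Sum>k\<in>Poly_Mapping.keys f. \<Sum>l\<in>Poly_Mapping.keys g.
      Poly_Mapping.single (k + l) (c * (Poly_Mapping.lookup f k * Poly_Mapping.lookup g l)))"
    by (subst single_sum_keys[of f], subst single_sum_keys[of g])
      (simp add: scaleR_sum_right sum_product mult_single mult.left_commute)
  moreover have "c *\<^sub>R (f * g) = (\<Sum>k\<in>Poly_Mapping.keys f. \<Sum>l\<in>Poly_Mapping.keys g.
      Poly_Mapping.single (k + l) (c * (Poly_Mapping.lookup f k * Poly_Mapping.lookup g l)))"
    by (subst single_sum_keys[of f], subst single_sum_keys[of g])
      (simp add: scaleR_sum_right sum_product mult_single)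
  ultimately show ?thesis by simp
qed

lemma multilinear_relations_mult_basis:
  assumes "r \<in> multilinear_relations"
  shows "basis w * r \<in> multilinear_relations" "r * basis w \<in> multilinear_relations"
proof -
  consider (add) a b x y where
      "r = basis (a + Word [x + y] + b) - basis (a + Word [x] + b) - basis (a + Word [y] + b)"
    | (scale) a b c x where
      "r = basis (a + Word [c *\<^sub>R x] + b) - c *\<^sub>R basis (a + Word [x] + b)"
    using assms unfolding multilinear_relations_def by blast
  note cs = this
  show "basis w * r \<in> multilinear_relations"
  proof (cases rule: cs)
    case add
    have "basis w * r = basis ((w + a) + Word [x + y] + b) - basis ((w + a) + Word [x] + b)
        - basis ((w + a) + Word [y] + b)"
      by (simp add: add right_diff_distrib mult_single add.assoc)
    then show ?thesis unfolding multilinear_relations_def by blast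
  next
    case scale
    have "basis w * r = basis ((w + a) + Word [c *\<^sub>R x] + b) - c *\<^sub>R basis ((w + a) + Word [x] + b)"
      by (simp add: scale right_diff_distrib mult_single add.assoc)
    then show ?thesis unfolding multilinear_relations_def by blast
  qed
  show "r * basis w \<in> multilinear_relations"
  proof (cases rule: cs)
    case add
    have "r * basis w = basis (a + Word [x + y] + (b + w)) - basis (a + Word [x] + (b + w))
        - basis (a + Word [y] + (b + w))"
      by (simp add: add left_diff_distrib mult_single add.assoc)
    then show ?thesis unfolding multilinear_relations_def by blast
  next
    case scale
    have "r * basis w = basis (a + Word [c *\<^sub>R x] + (b + w)) - c *\<^sub>R basis (a + Word [x] + (b + w))"
      by (simp add: scale left_diff_distrib mult_single add.assoc)
    then show ?thesis unfolding multilinear_relations_def by blast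
  qed
qed

lemma basis_sum_keys:
  fixes f :: "'k \<Rightarrow>\<^sub>0 real"
  shows "f = (\<Sum>k\<in>Poly_Mapping.keys f. Poly_Mapping.lookup f k *\<^sub>R basis k)"
  by (subst single_sum_keys) simp

lemma multilinear_span_mult:
  assumes "r \<in> span multilinear_relations"
  shows "f * r \<in> span multilinear_relations" "r * f \<in> span multilinear_relations"
proof -
  have L: "basis w * r \<in> span multilinear_relations" for w
    using assms
    by (induction rule: span_induct_alt)
      (simp_all add: distrib_left scaleR_mult_right span_zero span_add span_scale span_base
        multilinear_relations_mult_basis)
  have R: "r * basis w \<in> span multilinear_relations" for w
    using assms
    by (induction rule: span_induct_alt)
      (simp_all add: distrib_right scaleR_mult_left span_zero span_add span_scale span_base
        multilinear_relations_mult_basis)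
  have "f * r = (\<Sum>k\<in>Poly_Mapping.keys f. Poly_Mapping.lookup f k *\<^sub>R (basis k * r))"
    by (subst basis_sum_keys[of f]) (simp only: sum_distrib_right scaleR_mult_left)
  also have "\<dots> \<in> span multilinear_relations" by (intro span_sum span_scale L)
  finally show "f * r \<in> span multilinear_relations" .
  have "r * f = (\<Sum>k\<in>Poly_Mapping.keys f. Poly_Mapping.lookup f k *\<^sub>R (r * basis k))"
    by (subst basis_sum_keys[of f]) (simp only: sum_distrib_left scaleR_mult_right)
  also have "\<dots> \<in> span multilinear_relations" by (intro span_sum span_scale R)
  finally show "r * f \<in> span multilinear_relations" .
qed

definition multilinear_eq ::
    "('a::real_vector word \<Rightarrow>\<^sub>0 real) \<Rightarrow> ('a word \<Rightarrow>\<^sub>0 real) \<Rightarrow> bool" where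
  "multilinear_eq f g \<longleftrightarrow> f - g \<in> span multilinear_relations"

lemma multilinear_eq_trans:
  assumes "multilinear_eq f g" "multilinear_eq g h"
  shows "multilinear_eq f h"
proof -
  have "(f - g) + (g - h) \<in> span multilinear_relations"
    using assms unfolding multilinear_eq_def by (rule span_add)
  then show ?thesis by (simp add: multilinear_eq_def)
qed

lemma multilinear_eq_equivp: "equivp multilinear_eq"
proof (rule equivpI)
  show "reflp multilinear_eq" by (rule reflpI) (simp add: multilinear_eq_def span_zero)
  show "symp multilinear_eq"
    by (rule sympI) (metis multilinear_eq_def minus_diff_eq span_neg)
  show "transp multilinear_eq"
    by (rule transpI) (rule multilinear_eq_trans)
qed

quotient_type (overloaded) 'a tensor_algebra = "'a::real_vector word \<Rightarrow>\<^sub>0 real" / multilinear_eq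
  by (rule multilinear_eq_equivp)

instantiation tensor_algebra :: (real_vector) real_algebra_1
begin

lift_definition zero_tensor_algebra :: "'a tensor_algebra" is 0 .
lift_definition one_tensor_algebra :: "'a tensor_algebra" is 1 .

lift_definition plus_tensor_algebra ::
    "'a tensor_algebra \<Rightarrow> 'a tensor_algebra \<Rightarrow> 'a tensor_algebra" is "(+)"
  unfolding multilinear_eq_def by (metis add_diff_add span_add)

lift_definition minus_tensor_algebra ::
    "'a tensor_algebra \<Rightarrow> 'a tensor_algebra \<Rightarrow> 'a tensor_algebra" is "(-)"
proof -
  fix f f' g g' :: "'a word \<Rightarrow>\<^sub>0 real"
  assume "multilinear_eq f f'" "multilinear_eq g g'"
  then have "(f - f') - (g - g') \<in> span multilinear_relations"
    unfolding multilinear_eq_def by (rule span_diff)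
  then show "multilinear_eq (f - g) (f' - g')"
    by (simp add: multilinear_eq_def algebra_simps)
qed

lift_definition uminus_tensor_algebra :: "'a tensor_algebra \<Rightarrow> 'a tensor_algebra" is uminus
  unfolding multilinear_eq_def by (metis minus_diff_minus span_neg)

lift_definition times_tensor_algebra ::
    "'a tensor_algebra \<Rightarrow> 'a tensor_algebra \<Rightarrow> 'a tensor_algebra" is "(*)"
proof -
  fix f f' g g' :: "'a word \<Rightarrow>\<^sub>0 real"
  assume "multilinear_eq f f'" "multilinear_eq g g'"
  then have "(f - f') * g + f' * (g - g') \<in> span multilinear_relations"
    unfolding multilinear_eq_def by (intro span_add multilinear_span_mult)
  then show "multilinear_eq (f * g) (f' * g')"
    by (simp add: multilinear_eq_def algebra_simps)
qed

lift_definition scaleR_tensor_algebra :: "real \<Rightarrow> 'a tensor_algebra \<Rightarrow> 'a tensor_algebra"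
  is scaleR
  unfolding multilinear_eq_def by (metis scaleR_diff_right span_scale)

text \<open>The algebra is nontrivial because the coefficient of the empty word survives.\<close>

lemma lookup_zero_multilinear_span:
  assumes "r \<in> span (multilinear_relations :: ('a word \<Rightarrow>\<^sub>0 real) set)"
  shows "Poly_Mapping.lookup r 0 = 0"
  using assms
proof (induction rule: span_induct_alt)
  case (step c r s)
  have ne: "a + Word [x] + b \<noteq> 0" "0 \<noteq> a + Word [x] + b" for a b :: "'a word" and x
    by (cases a; cases b; simp add: zero_word_def)+
  have "Poly_Mapping.lookup r 0 = 0"
    using step(1) unfolding multilinear_relations_def
    by (auto simp: lookup_minus lookup_single when_def ne simp del: scaleR_single)
  then show ?case using step(2) by (simp add: lookup_add)
qed simp

instance
proof
  fix a b c :: "'a tensor_algebra" and r s :: real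
  note eq = multilinear_eq_def span_zero
  show "a + b + c = a + (b + c)" by transfer (simp add: eq add.assoc)
  show "a + b = b + a" by transfer (simp add: eq add.commute)
  show "0 + a = a" by transfer (simp add: eq)
  show "- a + a = 0" by transfer (simp add: eq)
  show "a - b = a + - b" by transfer (simp add: eq)
  show "a * b * c = a * (b * c)" by transfer (simp add: eq mult.assoc)
  show "1 * a = a" by transfer (simp add: eq)
  show "a * 1 = a" by transfer (simp add: eq)
  show "(a + b) * c = a * c + b * c" by transfer (simp add: eq distrib_right)
  show "a * (b + c) = a * b + a * c" by transfer (simp add: eq distrib_left)
  show "r *\<^sub>R (a + b) = r *\<^sub>R a + r *\<^sub>R b" by transfer (simp add: eq scaleR_add_right)
  show "(r + s) *\<^sub>R a = r *\<^sub>R a + s *\<^sub>R a" by transfer (simp add: eq scaleR_add_left)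
  show "r *\<^sub>R s *\<^sub>R a = (r * s) *\<^sub>R a" by transfer (simp add: eq)
  show "1 *\<^sub>R a = a" by transfer (simp add: eq)
  show "r *\<^sub>R a * b = r *\<^sub>R (a * b)" by transfer (simp add: eq scaleR_mult_left)
  show "a * r *\<^sub>R b = r *\<^sub>R (a * b)" by transfer (simp add: eq scaleR_mult_right)
  show "(0 :: 'a tensor_algebra) \<noteq> 1"
  proof transfer
    show "\<not> multilinear_eq (0 :: 'a word \<Rightarrow>\<^sub>0 real) 1"
      using lookup_zero_multilinear_span[of "- 1 :: 'a word \<Rightarrow>\<^sub>0 real"]
      by (auto simp: multilinear_eq_def lookup_one)
  qed
qed

end

lift_definition tensor_in :: "'a::real_vector \<Rightarrow> 'a tensor_algebra" is "\<lambda>x. basis (Word [x])" .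


section \<open>Universal enveloping algebras\<close>

text \<open>\<open>Idl\<close> in HOL-Algebra is the generated two-sided ideal.\<close>

definition uea_ideal :: "('a::real_vector \<Rightarrow> 'a \<Rightarrow> 'a) \<Rightarrow> 'a tensor_algebra set" where
  "uea_ideal br = Idl\<^bsub>type_algebra\<^esub>
     {tensor_in x * tensor_in y - tensor_in y * tensor_in x - tensor_in (br x y) | x y. True}"

definition uea_algebra ::
    "('a::real_vector \<Rightarrow> 'a \<Rightarrow> 'a) \<Rightarrow> (real, 'a tensor_algebra set) module" where
  "uea_algebra br = quotient_algebra type_algebra (uea_ideal br)"

definition uea_in :: "('a::real_vector \<Rightarrow> 'a \<Rightarrow> 'a) \<Rightarrow> 'a \<Rightarrow> 'a tensor_algebra set" where
  "uea_in br x = uea_ideal br +>\<^bsub>type_algebra\<^esub> tensor_in x"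

text \<open>\<open>extensional\<close> fixes the values outside the carrier, so that the description is
  unique.\<close>

definition uea_counit :: "('a::real_vector \<Rightarrow> 'a \<Rightarrow> 'a) \<Rightarrow> 'a tensor_algebra set \<Rightarrow> real" where
  "uea_counit br = (THE e. e \<in> extensional (carrier (uea_algebra br)) \<and>
     algebra_hom (uea_algebra br) type_algebra e \<and> (\<forall>x. e (uea_in br x) = 0))"

definition uea_coshuffle :: "('a::real_vector \<Rightarrow> 'a \<Rightarrow> 'a) \<Rightarrow>
    'a tensor_algebra set \<Rightarrow> ('a tensor_algebra set, 'a tensor_algebra set) tens" where
  "uea_coshuffle br =
     (let U = uea_algebra br; UU = tensor_product U U
      in THE d. d \<in> extensional (carrier U) \<and> algebra_hom U UU d \<and>
           (\<forall>x. d (uea_in br x) =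
              pure_tens U U (uea_in br x) \<one>\<^bsub>U\<^esub> \<oplus>\<^bsub>UU\<^esub> pure_tens U U \<one>\<^bsub>U\<^esub> (uea_in br x)))"

definition uea_conc :: "('a::real_vector \<Rightarrow> 'a \<Rightarrow> 'a) \<Rightarrow> 'a tensor_algebra set hopf" where
  "uea_conc br =
     (let U = uea_algebra br
      in \<lparr>carrier = carrier U, mult = mult U, one = one U, zero = zero U, add = add U,
          smult = smult U, counit = uea_counit br, comult = uea_coshuffle br\<rparr>)"

definition post_lie_extension ::
    "('a::real_vector \<Rightarrow> 'a \<Rightarrow> 'a) \<Rightarrow> ('a \<Rightarrow> 'a \<Rightarrow> 'a) \<Rightarrow>
     ('a tensor_algebra set \<Rightarrow> 'a tensor_algebra set \<Rightarrow> 'a tensor_algebra set) \<Rightarrow> bool" where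
  "post_lie_extension tr br E \<longleftrightarrow>
     (let U = uea_conc br; \<iota> = uea_in br
      in (\<forall>u v. u \<notin> carrier U \<or> v \<notin> carrier U \<longrightarrow> E u v = undefined) \<and>
         (\<forall>u \<in> carrier U. linear_map U U (\<lambda>v. E u v)) \<and>
         (\<forall>v \<in> carrier U. linear_map U U (\<lambda>u. E u v)) \<and>
         (\<forall>x y. E (\<iota> x) (\<iota> y) = \<iota> (tr x y)) \<and>
         (\<forall>u \<in> carrier U. E \<one>\<^bsub>U\<^esub> u = u \<and> E u \<one>\<^bsub>U\<^esub> = counit U u \<odot>\<^bsub>U\<^esub> \<one>\<^bsub>U\<^esub>) \<and>
         (\<forall>x. \<forall>v \<in> carrier U. \<forall>w \<in> carrier U.
            E (\<iota> x \<otimes>\<^bsub>U\<^esub> v) w = E (\<iota> x) (E v w) \<ominus>\<^bsub>U\<^esub> E (E (\<iota> x) v) w) \<and>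
         (\<forall>u \<in> carrier U. \<forall>v \<in> carrier U. \<forall>w \<in> carrier U.
            E u (v \<otimes>\<^bsub>U\<^esub> w) = tens_lift U (\<lambda>u1 u2. E u1 v \<otimes>\<^bsub>U\<^esub> E u2 w) (comult U u)))"

definition uea_action ::
    "('a::real_vector \<Rightarrow> 'a \<Rightarrow> 'a) \<Rightarrow> ('a \<Rightarrow> 'a \<Rightarrow> 'a) \<Rightarrow>
     'a tensor_algebra set \<Rightarrow> 'a tensor_algebra set \<Rightarrow> 'a tensor_algebra set" where
  "uea_action tr br = (THE E. post_lie_extension tr br E)"

definition uea_star ::
    "('a::real_vector \<Rightarrow> 'a \<Rightarrow> 'a) \<Rightarrow> ('a \<Rightarrow> 'a \<Rightarrow> 'a) \<Rightarrow> 'a tensor_algebra set hopf" where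
  "uea_star tr br =
     (let U = uea_conc br
      in U\<lparr>mult := (\<lambda>u v. tens_lift U (\<lambda>u1 u2. u1 \<otimes>\<^bsub>U\<^esub> uea_action tr br u2 v) (comult U u))\<rparr>)"

text \<open>Products of lists are bracketed to the right; the empty product is the unit.\<close>

definition mult_list :: "('u, 'm) monoid_scheme \<Rightarrow> 'u list \<Rightarrow> 'u" where
  "mult_list M us = foldr (mult M) us \<one>\<^bsub>M\<^esub>"

end

(* Everything is done on the tensor algebra T of L, where no relation has to be respected. For an
   arbitrary bilinear operation tr on L let D_x be the derivation of T that extends tr x, and let
   phi : T -> T be given by phi 1 = 1 and phi (x u) = x (phi u) + D_x (phi u). Its inverse psi satisfies
   psi (x u) = x (psi u) - psi (D_x u), a recursion on the length of words. Letting T act on itself by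
   rho (x a) = D_x o rho a, the extension of tr is u > w = rho (psi u) w and the star product is
   u * v = phi (psi u . psi v); so phi is an isomorphism from the concatenation to the star Hopf
   structure by construction, and the recursive description of * follows from
   phi (a b) = sum of phi a1 . rho a2 (phi b).

   Write r[x,y] = xy - yx - [x,y] for a bracket. The post-Lie axioms say that D_x is compatible with the
   relators of the bracket br and that D is a representation of (L, dbl); hence
   phi (r_dbl[x,y] a) = r_br[x,y] (phi a) holds exactly in T. So phi and psi exchange the two defining
   ideals and descend to the enveloping algebras; neither the Poincare-Birkhoff-Witt theorem nor the
   Jacobi identity is needed. A geometric deformation has the same bracket dbl, and the second
   isomorphism is the composition. *)

theory Submission
  imports Defs
begin

section \<open>Free vector spaces\<close>

text \<open>The obstacle is that \<open>\<Phi>\<close> and \<open>\<Psi>\<close> are not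
  multiplicative for concatenation, so respecting the ideals cannot be checked on relators alone.
  Each ideal is therefore described by the spanning elements word * relator * word. The exact
  identity covers a relator at the left end; the prefix is then peeled off letter by letter. For
  \<open>\<Phi>\<close> this uses that the ideal of the bracket is stable under \<open>D x\<close>.
  For \<open>\<Psi>\<close> it is an induction on the length of the prefix, since \<open>D x\<close>
  replaces letters but keeps the length.

  Two encodings carry the rest. The coproduct is kept on T as a formal sum of pairs that is only
  ever paired with bilinear maps, so coalgebra statements become identities of Sweedler sums.
  Enveloping algebras and tensor products are carrier sets of classes; projections embed them
  linearly into vector space types, where those identities apply. Counit, coproduct and extended
  action are given by unique descriptions, so each needs existence and uniqueness before it can be
  identified with the operation induced from T.\<close>

definition free_lift :: "('k \<Rightarrow> 'v::real_vector) \<Rightarrow> ('k \<Rightarrow>\<^sub>0 real) \<Rightarrow> 'v" where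
  "free_lift g f = (\<Sum>k\<in>Poly_Mapping.keys f. Poly_Mapping.lookup f k *\<^sub>R g k)"

lemma free_lift_superset:
  assumes "finite A" "Poly_Mapping.keys f \<subseteq> A"
  shows "free_lift g f = (\<Sum>k\<in>A. Poly_Mapping.lookup f k *\<^sub>R g k)"
  unfolding free_lift_def using assms by (intro sum.mono_neutral_left) (auto simp: in_keys_iff)

lemma linear_free_lift: "linear (free_lift g)"
proof (rule linearI)
  fix f h :: "'a \<Rightarrow>\<^sub>0 real"
  let ?A = "Poly_Mapping.keys f \<union> Poly_Mapping.keys h"
  have "free_lift g (f + h) = (\<Sum>k\<in>?A. Poly_Mapping.lookup (f + h) k *\<^sub>R g k)"
    using keys_add[of f h] by (intro free_lift_superset) auto
  also have "\<dots> = free_lift g f + free_lift g h"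
    by (simp add: free_lift_superset[of ?A] lookup_add scaleR_left_distrib sum.distrib)
  finally show "free_lift g (f + h) = free_lift g f + free_lift g h" .
next
  fix c :: real and f :: "'a \<Rightarrow>\<^sub>0 real"
  have "free_lift g (c *\<^sub>R f) = (\<Sum>k\<in>Poly_Mapping.keys f. Poly_Mapping.lookup (c *\<^sub>R f) k *\<^sub>R g k)"
    by (intro free_lift_superset) (auto simp: in_keys_iff)
  then show "free_lift g (c *\<^sub>R f) = c *\<^sub>R free_lift g f"
    by (simp add: free_lift_def scaleR_sum_right)
qed

lemmas free_lift_add = linear_add[OF linear_free_lift]
  and free_lift_diff = linear_diff[OF linear_free_lift]
  and free_lift_scale = linear_scale[OF linear_free_lift]

lemma free_lift_basis [simp]: "free_lift g (basis k) = g k"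
  by (simp add: free_lift_def)

lemma linear_free_lift_comp: "linear h \<Longrightarrow> h (free_lift g f) = free_lift (\<lambda>k. h (g k)) f"
  by (simp add: free_lift_def linear_sum linear_scale)

lemma free_lift_id: "free_lift basis f = f"
  unfolding free_lift_def by (rule basis_sum_keys[symmetric])

lemma free_lift_cong: "(\<And>k. k \<in> Poly_Mapping.keys f \<Longrightarrow> g k = h k) \<Longrightarrow> free_lift g f = free_lift h f"
  by (simp add: free_lift_def)

lemma free_lift_fun_add: "free_lift (\<lambda>k. g k + h k) f = free_lift g f + free_lift h f"
  by (simp add: free_lift_def scaleR_add_right sum.distrib)

lemma free_lift_fun_scale: "free_lift (\<lambda>k. c *\<^sub>R g k) f = c *\<^sub>R free_lift g f"
  by (simp add: free_lift_def scaleR_sum_right mult.commute)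

lemma free_lift_in_subspace:
  assumes "subspace V" "\<And>k. k \<in> Poly_Mapping.keys f \<Longrightarrow> g k \<in> V"
  shows "free_lift g f \<in> V"
  unfolding free_lift_def using assms by (intro subspace_sum subspace_scale) auto

lemma subspace_keys: "subspace {f :: 'k \<Rightarrow>\<^sub>0 real. Poly_Mapping.keys f \<subseteq> C}"
proof (rule subspaceI)
  fix f h :: "'k \<Rightarrow>\<^sub>0 real"
  assume "f \<in> {h. Poly_Mapping.keys h \<subseteq> C}" "h \<in> {h. Poly_Mapping.keys h \<subseteq> C}"
  then show "f + h \<in> {h. Poly_Mapping.keys h \<subseteq> C}" using keys_add[of f h] by blast
qed (auto simp: in_keys_iff subset_iff)

lemma keys_free_lift:
  fixes g :: "'k \<Rightarrow> ('l \<Rightarrow>\<^sub>0 real)"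
  assumes "\<And>k. k \<in> Poly_Mapping.keys f \<Longrightarrow> Poly_Mapping.keys (g k) \<subseteq> C"
  shows "Poly_Mapping.keys (free_lift g f) \<subseteq> C"
proof -
  have "free_lift g f \<in> {h. Poly_Mapping.keys h \<subseteq> C}"
    using assms by (intro free_lift_in_subspace subspace_keys) auto
  then show ?thesis by (rule CollectD)
qed

lemma free_lift_vanishes:
  assumes "r \<in> span R" "\<And>s. s \<in> R \<Longrightarrow> free_lift g s = 0"
  shows "free_lift g r = 0"
  using linear_eq_0_on_span[OF linear_free_lift assms(2) assms(1)] .


section \<open>Projections along subspaces\<close>

text \<open>A projection with kernel \<open>R\<close> realises the quotient by \<open>R\<close> inside the ambient type.\<close>

definition proj_along :: "'v::real_vector set \<Rightarrow> 'v \<Rightarrow> 'v" where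
  "proj_along R = (SOME p. linear p \<and> (\<forall>v. p v = 0 \<longleftrightarrow> v \<in> R) \<and> (\<forall>v. p (p v) = p v))"

text \<open>A basis of \<open>R\<close> is extended to a basis of the whole space. The linear map
  that kills the former and fixes the added vectors has kernel exactly \<open>R\<close>, because the
  added vectors span a complement.\<close>

lemma proj_along_exists:
  assumes "subspace (R :: 'v::real_vector set)"
  shows "\<exists>p. linear p \<and> (\<forall>v. p v = 0 \<longleftrightarrow> v \<in> R) \<and> (\<forall>v :: 'v. p (p v) = p v)"
proof -
  obtain B where B: "B \<subseteq> R" "independent B" "R \<subseteq> span B"
    by (rule maximal_independent_subset)
  define B' where "B' = extend_basis B"
  have B': "B \<subseteq> B'" "independent B'" "span B' = UNIV"
    unfolding B'_def using B(2)
    by (rule extend_basis_superset independent_extend_basis span_extend_basis)+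
  obtain p :: "'v \<Rightarrow> 'v" where p: "linear p" "\<forall>x\<in>B'. p x = (if x \<in> B then 0 else x)"
    using linear_independent_extend[OF B'(2), of "\<lambda>x. if x \<in> B then 0 else x"] by auto
  have R: "span B = R"
    using B by (intro subset_antisym span_minimal assms)
  have p0: "p v = 0" if "v \<in> R" for v
  proof (rule linear_eq_0_on_span[OF p(1)])
    show "v \<in> span B" using that R by simp
    show "p x = 0" if "x \<in> B" for x using that p(2) B'(1) by auto
  qed
  have pid: "p v = v" if "v \<in> span (B' - B)" for v
    using p(2) by (intro linear_eq_on_span[OF p(1) linear_ident _ that]) auto
  have dec: "\<exists>r y. v = r + y \<and> r \<in> R \<and> y \<in> span (B' - B)" for v
  proof -
    have "v \<in> span (B \<union> (B' - B))" using B' by (auto simp: Un_absorb1)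
    then show ?thesis unfolding span_Un R by blast
  qed
  have "p v = 0 \<longleftrightarrow> v \<in> R" "p (p v) = p v" for v
  proof -
    obtain r y where v: "v = r + y" "r \<in> R" "y \<in> span (B' - B)" using dec by blast
    then have "p v = y" by (simp add: linear_add[OF p(1)] p0 pid)
    then show "p v = 0 \<longleftrightarrow> v \<in> R" "p (p v) = p v" using v p0 pid by auto
  qed
  then show ?thesis using p(1) by blast
qed

lemma
  assumes "subspace R"
  shows linear_proj_along: "linear (proj_along R)"
    and proj_along_eq_0_iff: "proj_along R v = 0 \<longleftrightarrow> v \<in> R"
    and proj_along_idem: "proj_along R (proj_along R v) = proj_along R v"
  using someI_ex[OF proj_along_exists[OF assms]] unfolding proj_along_def by blast+

lemma proj_along_eq_iff:
  assumes "subspace R"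
  shows "proj_along R v = proj_along R w \<longleftrightarrow> v - w \<in> R"
  using linear_diff[OF linear_proj_along[OF assms], of v w] proj_along_eq_0_iff[OF assms, of "v - w"]
  by auto


section \<open>Linear maps on the tensor algebra\<close>

definition word_prod :: "'a::real_vector list \<Rightarrow> 'a tensor_algebra" where
  "word_prod xs = prod_list (map tensor_in xs)"

lemma word_prod_simps [simp]:
  "word_prod [] = 1" "word_prod (x # xs) = tensor_in x * word_prod xs"
  by (simp_all add: word_prod_def)

lemma word_prod_append: "word_prod (xs @ ys) = word_prod xs * word_prod ys"
  by (simp add: word_prod_def)

lemma abs_tensor_mult:
  "abs_tensor_algebra f * abs_tensor_algebra g = abs_tensor_algebra (f * g)"
  "abs_tensor_algebra f + abs_tensor_algebra g = abs_tensor_algebra (f + g)"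
  "c *\<^sub>R abs_tensor_algebra f = abs_tensor_algebra (c *\<^sub>R f)"
  by (simp_all add: times_tensor_algebra.abs_eq plus_tensor_algebra.abs_eq
      scaleR_tensor_algebra.abs_eq)

lemma abs_tensor_basis: "abs_tensor_algebra (basis (Word xs)) = word_prod xs"
proof (induction xs)
  case Nil
  show ?case unfolding word_prod_simps one_tensor_algebra_def single_one[symmetric] zero_word_def ..
next
  case (Cons x xs)
  have "basis (Word (x # xs)) = basis (Word [x]) * basis (Word xs)"
    by (simp add: mult_single)
  then show ?case by (simp add: Cons tensor_in.abs_eq flip: abs_tensor_mult)
qed

lemma abs_rep_tensor: "abs_tensor_algebra (rep_tensor_algebra t) = t"
  by (rule Quotient_abs_rep[OF Quotient_tensor_algebra])

lemma tensor_eq_free_lift: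
  "t = free_lift (case_word word_prod) (rep_tensor_algebra t)"
proof -
  have lin: "linear (abs_tensor_algebra :: _ \<Rightarrow> 'a tensor_algebra)"
    by (rule linearI) (simp_all add: abs_tensor_mult)
  have "t = abs_tensor_algebra (free_lift basis (rep_tensor_algebra t))"
    by (simp add: free_lift_id abs_rep_tensor)
  also have "\<dots> = free_lift (\<lambda>w. abs_tensor_algebra (basis w)) (rep_tensor_algebra t)"
    by (rule linear_free_lift_comp[OF lin])
  also have "(\<lambda>w. abs_tensor_algebra (basis w)) = (case_word word_prod :: 'a word \<Rightarrow> _)"
    by (auto simp: fun_eq_iff abs_tensor_basis split: word.split)
  finally show ?thesis .
qed

lemma span_word_prod: "span (range word_prod) = UNIV"
proof -
  have "t \<in> span (range word_prod)" for t :: "'a tensor_algebra"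
    by (subst tensor_eq_free_lift, rule free_lift_in_subspace[OF subspace_span])
      (auto intro: span_base split: word.split)
  then show ?thesis by auto
qed

lemma tensor_subspace_eq_UNIV:
  assumes "subspace V" "\<And>xs. word_prod xs \<in> V"
  shows "t \<in> V"
proof -
  have "span (range word_prod) \<subseteq> V" using assms by (intro span_minimal) auto
  then show ?thesis by (auto simp: span_word_prod)
qed

lemma tensor_word_induct [case_names word add scale]:
  assumes "\<And>xs. P (word_prod xs)" "\<And>u v. P u \<Longrightarrow> P v \<Longrightarrow> P (u + v)" "\<And>c u. P u \<Longrightarrow> P (c *\<^sub>R u)"
  shows "P t"
proof -
  \<comment> \<open>Zero needs no case of its own: it is the zero multiple of the empty
    word.\<close>
  have "P (0 *\<^sub>R word_prod [])" by (intro assms)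
  then have "subspace {t. P t}" by (intro subspaceI) (auto intro: assms)
  from tensor_subspace_eq_UNIV[OF this, of t] show ?thesis using assms(1) by simp
qed

text \<open>The workhorse of most identities below: maps given by \<open>tensor_rec\<close> are
  known exactly on \<open>1\<close> and on \<open>tensor_in x * u\<close>.\<close>

lemma tensor_algebra_induct [case_names one mult add scale]:
  assumes "P 1" "\<And>x u. P u \<Longrightarrow> P (tensor_in x * u)"
    "\<And>u v. P u \<Longrightarrow> P v \<Longrightarrow> P (u + v)" "\<And>c u. P u \<Longrightarrow> P (c *\<^sub>R u)"
  shows "P t"
proof -
  have "P (word_prod xs)" for xs by (induction xs) (auto intro: assms)
  then show ?thesis by (induction t rule: tensor_word_induct) (auto intro: assms)
qed

lemma linear_tensor_eqI:
  assumes "linear f" "linear g" "f 1 = g 1" "\<And>x u. f u = g u \<Longrightarrow> f (tensor_in x * u) = g (tensor_in x * u)"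
  shows "f t = g t"
  by (induction t rule: tensor_algebra_induct) (use assms in \<open>auto simp: linear_add linear_scale\<close>)

section \<open>Linear maps from multilinear functions on words\<close>

lemma multilinear_relations_intros:
  "basis (a + Word [x + y] + b) - basis (a + Word [x] + b) - basis (a + Word [y] + b)
     \<in> multilinear_relations"
  "basis (a + Word [c *\<^sub>R x] + b) - c *\<^sub>R basis (a + Word [x] + b) \<in> multilinear_relations"
  unfolding multilinear_relations_def by blast+

lemma linear_tensor_in: "linear tensor_in"
proof (rule linearI)
  fix x y :: 'a and c :: real
  have "multilinear_eq (basis (Word [x + y])) (basis (Word [x]) + basis (Word [y]))"
    using span_base[OF multilinear_relations_intros(1)[of 0 x y 0]]
    by (simp only: multilinear_eq_def add_0_left add_0_right diff_diff_eq)
  then show "tensor_in (x + y) = tensor_in x + tensor_in y"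
    by (simp only: tensor_in.abs_eq abs_tensor_mult tensor_algebra.abs_eq_iff)
  have "multilinear_eq (basis (Word [c *\<^sub>R x])) (c *\<^sub>R basis (Word [x]))"
    using span_base[OF multilinear_relations_intros(2)[of 0 c x 0]]
    by (simp only: multilinear_eq_def add_0_left add_0_right)
  then show "tensor_in (c *\<^sub>R x) = c *\<^sub>R tensor_in x"
    by (simp only: tensor_in.abs_eq abs_tensor_mult tensor_algebra.abs_eq_iff)
qed

lemmas tensor_in_add = linear_add[OF linear_tensor_in]
  and tensor_in_diff = linear_diff[OF linear_tensor_in]
  and tensor_in_scale = linear_scale[OF linear_tensor_in]

text \<open>List updates, rather than a prefix, a letter and a suffix, suit inductions on lists and
  the sum over positions in \<open>word_psi\<close>.\<close>

definition multilinear_word :: "('a::real_vector list \<Rightarrow> 'v::real_vector) \<Rightarrow> bool" where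
  "multilinear_word g \<longleftrightarrow>
     (\<forall>xs i a b. i < length xs \<longrightarrow> g (xs[i := a + b]) = g (xs[i := a]) + g (xs[i := b])) \<and>
     (\<forall>xs i c a. i < length xs \<longrightarrow> g (xs[i := c *\<^sub>R a]) = c *\<^sub>R g (xs[i := a]))"

lemma multilinear_wordD:
  assumes "multilinear_word g" "i < length xs"
  shows "g (xs[i := a + b]) = g (xs[i := a]) + g (xs[i := b])" "g (xs[i := c *\<^sub>R a]) = c *\<^sub>R g (xs[i := a])"
  using assms by (auto simp: multilinear_word_def)

lemma multilinear_word_prod: "multilinear_word word_prod"
proof -
  have "word_prod (xs[i := a + b]) = word_prod (xs[i := a]) + word_prod (xs[i := b]) \<and>
      word_prod (xs[i := c *\<^sub>R a]) = c *\<^sub>R word_prod (xs[i := a])"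
    if "i < length xs" for xs :: "'a list" and i a b c
    using that
  proof (induction xs arbitrary: i)
    case (Cons x xs)
    then show ?case
      by (cases i) (simp_all add: tensor_in_add tensor_in_scale distrib_left distrib_right)
  qed simp
  then show ?thesis unfolding multilinear_word_def by blast
qed

definition tensor_lift :: "('a::real_vector list \<Rightarrow> 'v::real_vector) \<Rightarrow> 'a tensor_algebra \<Rightarrow> 'v" where
  "tensor_lift g t = free_lift (case_word g) (rep_tensor_algebra t)"

lemma free_lift_multilinear:
  assumes "multilinear_word g" "multilinear_eq f h"
  shows "free_lift (case_word g) f = free_lift (case_word g) h"
proof -
  have 0: "free_lift (case_word g) r = 0" if "r \<in> multilinear_relations" for r
  proof -
    \<comment> \<open>A relator with prefix \<open>xs\<close> varies the letter at position
      \<open>length xs\<close>; \<open>z\<close> is a placeholder that the update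
      overwrites.\<close>
    have eq: "a + Word [x] + b = Word ((xs @ z # ys)[length xs := x])"
      if "a = Word xs" "b = Word ys" for a b :: "'a word" and x z xs ys
      using that by simp
    show ?thesis
      using that unfolding multilinear_relations_def
    proof (elim UnE CollectE exE conjE)
      fix a b :: "'a word" and x y
      assume r: "r = basis (a + Word [x + y] + b) - basis (a + Word [x] + b) - basis (a + Word [y] + b)"
      obtain xs ys where "a = Word xs" "b = Word ys" by (metis word.exhaust)
      note eq' = eq[OF this, of _ x]
      show ?thesis
        unfolding r eq' by (simp add: free_lift_diff multilinear_wordD[OF assms(1)]
            del: list_update_length)
    next
      fix a b :: "'a word" and c x
      assume r: "r = basis (a + Word [c *\<^sub>R x] + b) - c *\<^sub>R basis (a + Word [x] + b)"
      obtain xs ys where "a = Word xs" "b = Word ys" by (metis word.exhaust)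
      note eq' = eq[OF this, of _ x]
      show ?thesis
        unfolding r eq' by (simp add: free_lift_diff free_lift_scale multilinear_wordD[OF assms(1)]
            del: list_update_length scaleR_single)
    qed
  qed
  have "free_lift (case_word g) (f - h) = 0"
    by (rule free_lift_vanishes[OF _ 0]) (use assms(2) in \<open>simp only: multilinear_eq_def\<close>)
  then show ?thesis by (simp add: free_lift_diff)
qed

lemma multilinear_eq_rep_abs: "multilinear_eq (rep_tensor_algebra (abs_tensor_algebra f)) f"
  by (metis Quotient_rep_abs Quotient_tensor_algebra multilinear_eq_equivp equivp_reflp)

lemma tensor_lift_abs:
  assumes "multilinear_word g"
  shows "tensor_lift g (abs_tensor_algebra f) = free_lift (case_word g) f"
  unfolding tensor_lift_def by (rule free_lift_multilinear[OF assms multilinear_eq_rep_abs])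

lemma linear_tensor_lift:
  assumes "multilinear_word g"
  shows "linear (tensor_lift g)"
proof (rule linearI)
  fix s t :: "'a tensor_algebra" and c
  have "tensor_lift g (s + t) = tensor_lift g (abs_tensor_algebra (rep_tensor_algebra s + rep_tensor_algebra t))"
    by (simp add: abs_rep_tensor flip: abs_tensor_mult)
  then show "tensor_lift g (s + t) = tensor_lift g s + tensor_lift g t"
    by (simp only: tensor_lift_abs[OF assms] free_lift_add) (simp add: tensor_lift_def)
  have "tensor_lift g (c *\<^sub>R s) = tensor_lift g (abs_tensor_algebra (c *\<^sub>R rep_tensor_algebra s))"
    by (simp add: abs_rep_tensor flip: abs_tensor_mult)
  then show "tensor_lift g (c *\<^sub>R s) = c *\<^sub>R tensor_lift g s"
    by (simp only: tensor_lift_abs[OF assms] free_lift_scale) (simp add: tensor_lift_def)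
qed

lemma tensor_lift_word [simp]:
  assumes "multilinear_word g"
  shows "tensor_lift g (word_prod xs) = g xs"
  by (simp add: tensor_lift_abs[OF assms] flip: abs_tensor_basis)

section \<open>Linear maps defined by recursion on the first letter\<close>

primrec word_rec ::
    "('a::real_vector \<Rightarrow> 'a tensor_algebra \<Rightarrow> 'v \<Rightarrow> 'v) \<Rightarrow> 'v \<Rightarrow> 'a list \<Rightarrow> 'v::real_vector" where
  "word_rec J z [] = z"
| "word_rec J z (x # xs) = J x (word_prod xs) (word_rec J z xs)"

definition tensor_rec ::
    "('a::real_vector \<Rightarrow> 'a tensor_algebra \<Rightarrow> 'v \<Rightarrow> 'v) \<Rightarrow> 'v \<Rightarrow> 'a tensor_algebra \<Rightarrow> 'v::real_vector" where
  "tensor_rec J z = tensor_lift (word_rec J z)"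

text \<open>The tail \<open>u\<close> and the recursive value \<open>v\<close> vary together, so
  \<open>J x\<close> has to be linear in the pair of them jointly, not in each argument separately.
  A step such as \<open>a * u + b * v\<close> is of this kind.\<close>

definition rec_step :: "('a::real_vector \<Rightarrow> 'a tensor_algebra \<Rightarrow> 'v \<Rightarrow> 'v::real_vector) \<Rightarrow> bool" where
  "rec_step J \<longleftrightarrow> (\<forall>u v. linear (\<lambda>x. J x u v)) \<and>
     (\<forall>x u u' v v'. J x (u + u') (v + v') = J x u v + J x u' v') \<and>
     (\<forall>x c u v. J x (c *\<^sub>R u) (c *\<^sub>R v) = c *\<^sub>R J x u v)"

lemma multilinear_word_rec:
  assumes "rec_step J"
  shows "multilinear_word (word_rec J z)"
proof -
  have "word_rec J z (xs[i := a + b]) = word_rec J z (xs[i := a]) + word_rec J z (xs[i := b]) \<and>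
      word_rec J z (xs[i := c *\<^sub>R a]) = c *\<^sub>R word_rec J z (xs[i := a])"
    if "i < length xs" for xs i a b c
    using that
  proof (induction xs arbitrary: i)
    case (Cons x xs)
    show ?case
    proof (cases i)
      case 0
      have lin: "linear (\<lambda>x. J x u v)" for u v using assms by (simp add: rec_step_def)
      show ?thesis by (simp add: 0 linear_add[OF lin] linear_scale[OF lin])
    next
      case (Suc j)
      then show ?thesis using assms Cons
        by (simp add: rec_step_def multilinear_wordD[OF multilinear_word_prod])
    qed
  qed simp
  then show ?thesis unfolding multilinear_word_def by blast
qed

lemma
  assumes "rec_step J"
  shows linear_tensor_rec: "linear (tensor_rec J z)"
    and tensor_rec_1: "tensor_rec J z 1 = z"
    and tensor_rec_mult: "tensor_rec J z (tensor_in x * u) = J x u (tensor_rec J z u)"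
proof -
  note ml = multilinear_word_rec[OF assms, of z]
  show lin: "linear (tensor_rec J z)"
    unfolding tensor_rec_def by (rule linear_tensor_lift[OF ml])
  show "tensor_rec J z 1 = z"
    using tensor_lift_word[OF ml, of "[]"] by (simp add: tensor_rec_def)
  show "tensor_rec J z (tensor_in x * u) = J x u (tensor_rec J z u)"
  proof (induction u rule: tensor_word_induct)
    case (word xs)
    show ?case
      using tensor_lift_word[OF ml, of "x # xs"] tensor_lift_word[OF ml, of xs]
      by (simp add: tensor_rec_def)
  next
    case (add u v)
    then show ?case using assms by (simp add: distrib_left linear_add[OF lin] rec_step_def)
  next
    case (scale c u)
    then show ?case using assms by (simp add: linear_scale[OF lin] rec_step_def)
  qed
qed

section \<open>Sweedler sums on the tensor algebra\<close>

lemma bilinearI: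
  assumes "\<And>x. linear (b x)" "\<And>y. linear (\<lambda>x. b x y)"
  shows "bilinear b"
  using assms by (simp add: bilinear_def)

lemma linear_bilinear_right: "bilinear b \<Longrightarrow> linear f \<Longrightarrow> linear (\<lambda>x. b a (f x))"
  unfolding bilinear_def by (blast intro: linear_compose[unfolded o_def])

lemma linear_bilinear_left: "bilinear b \<Longrightarrow> linear f \<Longrightarrow> linear (\<lambda>x. b (f x) a)"
  unfolding bilinear_def by (blast intro: linear_compose[of f "\<lambda>x. b x a", unfolded o_def])

lemma bilinear_times: "bilinear ((*) :: 'v::real_algebra \<Rightarrow> 'v \<Rightarrow> 'v)"
  by (rule bilinearI; rule linearI) (simp_all add: algebra_simps)

lemma linear_comp: "linear g \<Longrightarrow> linear f \<Longrightarrow> linear (\<lambda>x. g (f x))"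
  using linear_compose[of f g] by (simp add: o_def)

lemmas linear_times_right = linear_bilinear_right[OF bilinear_times]
  and linear_times_left = linear_bilinear_left[OF bilinear_times]
  and linear_tensor_in_comp = linear_comp[OF linear_tensor_in]

lemma linear_minus: "linear f \<Longrightarrow> linear (\<lambda>x. - f x :: 'v::real_vector)"
  by (rule linear_compose_neg)

lemma linear_scaleR_left_fun: "linear f \<Longrightarrow> linear (\<lambda>x. f x *\<^sub>R (a :: 'v::real_vector))"
  by (rule linearI) (simp_all add: linear_add linear_scale scaleR_left_distrib)

lemmas linear_intros = linear_ident linear_times_right linear_times_left linear_tensor_in_comp
  linear_minus linear_compose_add linear_compose_sub linear_scaleR_left_fun linear_compose_scale_right
  linear_zero

text \<open>Each letter goes to the left or to the right factor. The values are formal sums of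
  pairs, not tensors, so that any function of two arguments can be summed over them.\<close>

primrec word_cop :: "'a::real_vector list \<Rightarrow> ('a tensor_algebra \<times> 'a tensor_algebra \<Rightarrow>\<^sub>0 real)" where
  "word_cop [] = basis (1, 1)"
| "word_cop (x # xs) = free_lift (\<lambda>(u, v). basis (tensor_in x * u, v)) (word_cop xs) +
     free_lift (\<lambda>(u, v). basis (u, tensor_in x * v)) (word_cop xs)"

text \<open>A representative of the coshuffle coproduct; \<open>sweedler b u\<close> is the sum of
  \<open>b u\<^sup>(\<^sup>1\<^sup>) u\<^sup>(\<^sup>2\<^sup>)\<close>.\<close>

definition tensor_cop :: "'a::real_vector tensor_algebra \<Rightarrow> ('a tensor_algebra \<times> 'a tensor_algebra \<Rightarrow>\<^sub>0 real)" where
  "tensor_cop u = free_lift (case_word word_cop) (rep_tensor_algebra u)"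

definition sweedler :: "('a::real_vector tensor_algebra \<Rightarrow> 'a tensor_algebra \<Rightarrow> 'v::real_vector) \<Rightarrow>
    'a tensor_algebra \<Rightarrow> 'v" where
  "sweedler b u = free_lift (\<lambda>(u, v). b u v) (tensor_cop u)"

lemma free_lift_word_cop_Cons:
  "free_lift (\<lambda>(u, v). b u v) (word_cop (x # xs)) =
     free_lift (\<lambda>(u, v). b (tensor_in x * u) v) (word_cop xs) +
     free_lift (\<lambda>(u, v). b u (tensor_in x * v)) (word_cop xs)"
  by (simp add: free_lift_add linear_free_lift_comp[OF linear_free_lift] case_prod_unfold)

lemma free_lift_prod_add:
  "free_lift (\<lambda>(u, v). g u v + h u v) f = free_lift (\<lambda>(u, v). g u v) f + free_lift (\<lambda>(u, v). h u v) f"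
  using free_lift_fun_add[of "\<lambda>(u, v). g u v" "\<lambda>(u, v). h u v" f] by (simp add: case_prod_unfold)

lemma free_lift_prod_scale:
  "free_lift (\<lambda>(u, v). c *\<^sub>R g u v) f = c *\<^sub>R free_lift (\<lambda>(u, v). g u v) f"
  using free_lift_fun_scale[of c "\<lambda>(u, v). g u v" f] by (simp add: case_prod_unfold)

lemma bilinear_comp:
  assumes "bilinear b" "linear f" "linear g"
  shows "bilinear (\<lambda>u v. b (f u) (g v))"
  by (intro bilinearI linear_bilinear_left[OF assms(1)] linear_bilinear_right[OF assms(1)] assms(2,3))

lemma bilinear_comp_left: "bilinear b \<Longrightarrow> linear f \<Longrightarrow> bilinear (\<lambda>u v. b (f u) v)"
  and bilinear_comp_right: "bilinear b \<Longrightarrow> linear f \<Longrightarrow> bilinear (\<lambda>u v. b u (f v))"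
  by (rule bilinear_comp; simp add: linear_ident)+

text \<open>\<open>word_cop\<close> lives in a free vector space and is not itself multilinear; its
  pairing with a bilinear \<open>b\<close> is. The induction lets \<open>b\<close> vary because the
  head letter is absorbed into it.\<close>

lemma multilinear_sweedler:
  assumes "bilinear b"
  shows "multilinear_word (\<lambda>xs. free_lift (\<lambda>(u, v). b u v) (word_cop xs))"
proof -
  have "free_lift (\<lambda>(u, v). b u v) (word_cop (xs[i := y + z])) =
        free_lift (\<lambda>(u, v). b u v) (word_cop (xs[i := y])) + free_lift (\<lambda>(u, v). b u v) (word_cop (xs[i := z])) \<and>
      free_lift (\<lambda>(u, v). b u v) (word_cop (xs[i := c *\<^sub>R y])) =
        c *\<^sub>R free_lift (\<lambda>(u, v). b u v) (word_cop (xs[i := y]))"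
    if "i < length xs" for xs i y z c
    using that assms
  proof (induction xs arbitrary: i b)
    case (Cons x xs)
    show ?case
    proof (cases i)
      case 0
      show ?thesis
        using Cons.prems(2)
        by (simp add: 0 free_lift_word_cop_Cons tensor_in_add tensor_in_scale distrib_right bilinear_ladd
            bilinear_radd bilinear_lmul bilinear_rmul free_lift_prod_add free_lift_prod_scale
            scaleR_add_right del: word_cop.simps)
    next
      case (Suc j)
      have 1: "bilinear (\<lambda>u v. b (tensor_in x * u) v)" "bilinear (\<lambda>u v. b u (tensor_in x * v))"
        by (rule bilinear_comp_left bilinear_comp_right, rule Cons.prems, intro linear_intros)+
      have "j < length xs" using Cons.prems Suc by simp
      then show ?thesis
        using Cons.IH[OF _ 1(1), of j] Cons.IH[OF _ 1(2), of j]
        by (simp only: Suc list_update_code(3) free_lift_word_cop_Cons)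
          (simp add: scaleR_add_right)
    qed
  qed simp
  then show ?thesis unfolding multilinear_word_def by blast
qed

lemma sweedler_eq_tensor_lift:
  "sweedler b = tensor_lift (\<lambda>xs. free_lift (\<lambda>(u, v). b u v) (word_cop xs))"
proof
  fix u
  have "free_lift (\<lambda>(u, v). b u v) (case w of Word xs \<Rightarrow> word_cop xs) =
      (case w of Word xs \<Rightarrow> free_lift (\<lambda>(u, v). b u v) (word_cop xs))" for w
    by (cases w) simp
  then show "sweedler b u = tensor_lift (\<lambda>xs. free_lift (\<lambda>(u, v). b u v) (word_cop xs)) u"
    by (simp add: sweedler_def tensor_cop_def tensor_lift_def linear_free_lift_comp[OF linear_free_lift])
qed

lemma linear_sweedler: "bilinear b \<Longrightarrow> linear (sweedler b)"
  unfolding sweedler_eq_tensor_lift by (intro linear_tensor_lift multilinear_sweedler)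

lemma sweedler_1 [simp]: "bilinear b \<Longrightarrow> sweedler b 1 = b 1 1"
  using tensor_lift_word[OF multilinear_sweedler, of b "[]"] by (simp add: sweedler_eq_tensor_lift)

lemma sweedler_comp: "linear h \<Longrightarrow> h (sweedler b u) = sweedler (\<lambda>x y. h (b x y)) u"
  by (simp add: sweedler_def linear_free_lift_comp case_prod_unfold)

lemma sweedler_fun_add: "sweedler (\<lambda>x y. b x y + c x y) u = sweedler b u + sweedler c u"
  by (simp add: sweedler_def case_prod_unfold free_lift_fun_add)

lemma sweedler_fun_scale: "sweedler (\<lambda>x y. r *\<^sub>R b x y) u = r *\<^sub>R sweedler b u"
  by (simp add: sweedler_def case_prod_unfold free_lift_fun_scale)

lemma sweedler_fun_minus: "sweedler (\<lambda>x y. - b x y) u = - sweedler b u"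
  using sweedler_fun_scale[of "-1" b u] by simp

lemma linear_sweedler_fun:
  assumes "\<And>u v. linear (\<lambda>x. b x u v)"
  shows "linear (\<lambda>x. sweedler (b x) a)"
proof (rule linearI)
  fix x y and c :: real
  have "b (x + y) = (\<lambda>u v. b x u v + b y u v)" by (intro ext) (rule linear_add[OF assms])
  then show "sweedler (b (x + y)) a = sweedler (b x) a + sweedler (b y) a"
    by (simp add: sweedler_fun_add)
  have "b (c *\<^sub>R x) = (\<lambda>u v. c *\<^sub>R b x u v)" by (intro ext) (rule linear_scale[OF assms])
  then show "sweedler (b (c *\<^sub>R x)) a = c *\<^sub>R sweedler (b x) a"
    by (simp add: sweedler_fun_scale)
qed

text \<open>Primitivity of letters, Delta(x u) = (x 1 + 1 x) Delta(u), in paired form. It is the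
  rule by which the Sweedler identities below recurse.\<close>

lemma sweedler_mult_in:
  assumes "bilinear b"
  shows "sweedler b (tensor_in x * u) =
    sweedler (\<lambda>v w. b (tensor_in x * v) w) u + sweedler (\<lambda>v w. b v (tensor_in x * w)) u"
proof (induction u rule: tensor_word_induct)
  case (word xs)
  have 1: "bilinear (\<lambda>u v. b (tensor_in x * u) v)" "bilinear (\<lambda>u v. b u (tensor_in x * v))"
    by (rule bilinear_comp_left bilinear_comp_right, rule assms, intro linear_intros)+
  show ?case
    using tensor_lift_word[OF multilinear_sweedler[OF assms], of "x # xs"]
      tensor_lift_word[OF multilinear_sweedler[OF 1(1)], of xs]
      tensor_lift_word[OF multilinear_sweedler[OF 1(2)], of xs]
    by (simp only: sweedler_eq_tensor_lift word_prod_simps free_lift_word_cop_Cons)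
next
  case (add u v)
  have 1: "bilinear (\<lambda>u v. b (tensor_in x * u) v)" "bilinear (\<lambda>u v. b u (tensor_in x * v))"
    by (rule bilinear_comp_left bilinear_comp_right, rule assms, intro linear_intros)+
  show ?case using add
    by (simp add: distrib_left linear_add[OF linear_sweedler] assms 1)
next
  case (scale c u)
  have 1: "bilinear (\<lambda>u v. b (tensor_in x * u) v)" "bilinear (\<lambda>u v. b u (tensor_in x * v))"
    by (rule bilinear_comp_left bilinear_comp_right, rule assms, intro linear_intros)+
  show ?case using scale
    by (simp add: linear_scale[OF linear_sweedler] assms 1 scaleR_add_right)
qed

lemma sweedler_in: "bilinear b \<Longrightarrow> sweedler b (tensor_in x) = b (tensor_in x) 1 + b 1 (tensor_in x)"
  using sweedler_mult_in[of b x 1]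
  by (simp add: bilinear_comp_left bilinear_comp_right linear_intros)

definition trilinear :: "('u::real_vector \<Rightarrow> 'v::real_vector \<Rightarrow> 'w::real_vector \<Rightarrow> 'x::real_vector) \<Rightarrow> bool" where
  "trilinear c \<longleftrightarrow> (\<forall>v w. linear (\<lambda>u. c u v w)) \<and> (\<forall>u w. linear (\<lambda>v. c u v w)) \<and> (\<forall>u v. linear (c u v))"

lemma trilinear_comp:
  assumes "trilinear c" "linear f" "linear g" "linear h"
  shows "trilinear (\<lambda>u v w. c (f u) (g v) (h w))"
  using assms unfolding trilinear_def
  by (auto intro: linear_comp[of "\<lambda>u. c u _ _"] linear_comp[of "\<lambda>v. c _ v _"] linear_comp[of "c _ _"])

lemma trilinear_sweedler:
  assumes "trilinear c"
  shows "bilinear (\<lambda>s w. sweedler (\<lambda>u v. c u v w) s)" "bilinear (\<lambda>v w. sweedler (\<lambda>w1 w2. c v w1 w2) w)"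
    "bilinear (\<lambda>u v. c u v w)" "bilinear (\<lambda>v w. c u v w)"
  using assms unfolding trilinear_def
  by (auto intro!: bilinearI linear_sweedler linear_sweedler_fun)

text \<open>On either side a new letter lands once in each of the three slots. Absorbing it into
  \<open>c\<close> reduces the claim to the shorter tensor, whence the induction over all
  \<open>c\<close>.\<close>

lemma sweedler_coassoc:
  assumes "trilinear c"
  shows "sweedler (\<lambda>s w. sweedler (\<lambda>u v. c u v w) s) u = sweedler (\<lambda>v w. sweedler (\<lambda>w1 w2. c v w1 w2) w) u"
  using assms
proof (induction u arbitrary: c rule: tensor_algebra_induct)
  case one
  then show ?case by (simp add: trilinear_sweedler)
next
  case (mult x u)
  let ?x = "\<lambda>u. tensor_in x * u" and ?id = "\<lambda>u :: 'a tensor_algebra. u"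
  have 1: "trilinear (\<lambda>u v w. c (?x u) v w)" "trilinear (\<lambda>u v w. c u (?x v) w)" "trilinear (\<lambda>u v w. c u v (?x w))"
    using trilinear_comp[OF mult.prems, of ?x ?id ?id] trilinear_comp[OF mult.prems, of ?id ?x ?id]
      trilinear_comp[OF mult.prems, of ?id ?id ?x]
    by (simp_all add: linear_intros)
  note t = trilinear_sweedler[OF mult.prems] trilinear_sweedler[OF 1(1)] trilinear_sweedler[OF 1(2)] trilinear_sweedler[OF 1(3)]
  show ?case
    by (simp add: sweedler_mult_in t sweedler_fun_add mult.IH[OF 1(1)] mult.IH[OF 1(2)] mult.IH[OF 1(3)])
next
  case (add u v)
  then show ?case by (simp add: linear_add[OF linear_sweedler] trilinear_sweedler)
next
  case (scale r u)
  then show ?case by (simp add: linear_scale[OF linear_sweedler] trilinear_sweedler)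
qed

lemma bilinear_sweedler_mult:
  assumes "bilinear b"
  shows "bilinear (\<lambda>u1 u2. sweedler (\<lambda>v1 v2. b (u1 * v1) (u2 * v2)) v)"
    "bilinear (\<lambda>v1 v2. b (u1 * v1) (u2 * v2))"
  by (intro bilinearI linear_sweedler_fun linear_bilinear_left[OF assms] linear_bilinear_right[OF assms] linear_intros)+

text \<open>Induction on the left factor: its first letter is primitive, so it multiplies one of the
  two slots and can be absorbed into \<open>b\<close>.\<close>

lemma sweedler_mult:
  assumes "bilinear b"
  shows "sweedler b (u * v) = sweedler (\<lambda>u1 u2. sweedler (\<lambda>v1 v2. b (u1 * v1) (u2 * v2)) v) u"
  using assms
proof (induction u arbitrary: b rule: tensor_algebra_induct)
  case one
  then show ?case by (simp add: bilinear_sweedler_mult)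
next
  case (mult x u)
  have 1: "bilinear (\<lambda>u v. b (tensor_in x * u) v)" "bilinear (\<lambda>u v. b u (tensor_in x * v))"
    by (rule bilinear_comp_left bilinear_comp_right, rule mult.prems, intro linear_intros)+
  show ?case
    using mult.IH[OF 1(1)] mult.IH[OF 1(2)] sweedler_mult_in[OF mult.prems, of x "u * v"]
      sweedler_mult_in[OF bilinear_sweedler_mult(1)[OF mult.prems, of v], of x u]
    by (simp add: mult.assoc)
next
  case (add u w)
  then show ?case by (simp add: distrib_right linear_add[OF linear_sweedler] bilinear_sweedler_mult)
next
  case (scale r u)
  then show ?case by (simp add: linear_scale[OF linear_sweedler] bilinear_sweedler_mult)
qed

section \<open>Counit and antipode of T\<close>

definition tensor_counit :: "'a::real_vector tensor_algebra \<Rightarrow> real" where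
  "tensor_counit = tensor_rec (\<lambda>x u v. 0) 1"

definition tensor_antipode :: "'a::real_vector tensor_algebra \<Rightarrow> 'a tensor_algebra" where
  "tensor_antipode = tensor_rec (\<lambda>x u v. - (v * tensor_in x)) 1"

lemma rec_step_counit: "rec_step (\<lambda>x u v. 0 :: real)"
  by (simp add: rec_step_def linear_zero)

lemma linear_tensor_counit: "linear tensor_counit"
  and tensor_counit_1 [simp]: "tensor_counit 1 = 1"
  and tensor_counit_mult_in [simp]: "tensor_counit (tensor_in x * u) = 0"
  unfolding tensor_counit_def
  by (simp_all add: linear_tensor_rec[OF rec_step_counit] tensor_rec_1[OF rec_step_counit]
      tensor_rec_mult[OF rec_step_counit])

lemma rec_step_antipode: "rec_step (\<lambda>x u v. - (v * tensor_in x))"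
  by (simp add: rec_step_def linear_intros distrib_right)

lemma linear_tensor_antipode: "linear tensor_antipode"
  and tensor_antipode_1 [simp]: "tensor_antipode 1 = 1"
  and tensor_antipode_mult_in [simp]: "tensor_antipode (tensor_in x * u) = - (tensor_antipode u * tensor_in x)"
  unfolding tensor_antipode_def
  by (simp_all add: linear_tensor_rec[OF rec_step_antipode] tensor_rec_1[OF rec_step_antipode]
      tensor_rec_mult[OF rec_step_antipode])

lemma tensor_counit_in [simp]: "tensor_counit (tensor_in x) = 0"
  using tensor_counit_mult_in[of x 1] by simp

lemma tensor_counit_mult: "tensor_counit (u * v) = tensor_counit u * tensor_counit v"
  by (induction u rule: tensor_algebra_induct)
    (simp_all add: mult.assoc distrib_right linear_add[OF linear_tensor_counit] linear_scale[OF linear_tensor_counit])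

lemmas linear_counit_comp = linear_comp[OF linear_tensor_counit]
  and linear_antipode_comp = linear_comp[OF linear_tensor_antipode]

lemma tensor_antipode_mult: "tensor_antipode (u * v) = tensor_antipode v * tensor_antipode u"
  by (induction u rule: tensor_algebra_induct)
    (simp_all add: mult.assoc distrib_right distrib_left linear_add[OF linear_tensor_antipode] linear_scale[OF linear_tensor_antipode])

lemma bilinear_counit:
  "bilinear (\<lambda>v w. tensor_counit v *\<^sub>R w)" "bilinear (\<lambda>v w. tensor_counit w *\<^sub>R v)"
  by (intro bilinearI linear_intros linear_counit_comp)+

lemma sweedler_counit:
  "sweedler (\<lambda>v w. tensor_counit v *\<^sub>R w) u = u" "sweedler (\<lambda>v w. tensor_counit w *\<^sub>R v) u = u"
proof -
  have l: "linear (\<lambda>v. tensor_in x * v)" for x :: 'a by (intro linear_intros)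
  have z: "sweedler (\<lambda>v w. 0 :: 'a tensor_algebra) u = 0" for u :: "'a tensor_algebra"
    using sweedler_fun_scale[of 0 "\<lambda>v w. 0" u] by simp
  have 1: "sweedler (\<lambda>v w. tensor_counit v *\<^sub>R (tensor_in x * w)) u =
      tensor_in x * sweedler (\<lambda>v w. tensor_counit v *\<^sub>R w) u" for x :: 'a and u
    by (simp add: sweedler_comp[OF l])
  show "sweedler (\<lambda>v w. tensor_counit v *\<^sub>R w) u = u"
    by (rule linear_tensor_eqI[OF linear_sweedler linear_ident])
      (simp_all add: bilinear_counit sweedler_mult_in z 1)
  have 2: "sweedler (\<lambda>v w. tensor_counit w *\<^sub>R (tensor_in x * v)) u =
      tensor_in x * sweedler (\<lambda>v w. tensor_counit w *\<^sub>R v) u" for x :: 'a and u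
    by (simp add: sweedler_comp[OF l])
  show "sweedler (\<lambda>v w. tensor_counit w *\<^sub>R v) u = u"
    by (rule linear_tensor_eqI[OF linear_sweedler linear_ident])
      (simp_all add: bilinear_counit sweedler_mult_in z 2)
qed

lemma bilinear_antipode:
  "bilinear (\<lambda>v w. tensor_antipode v * w)" "bilinear (\<lambda>v w. v * tensor_antipode w)"
  by (intro bilinearI linear_intros linear_antipode_comp)+

text \<open>For a new letter the two terms of the first sum cancel inside the sum. In the second sum
  the letter appears at opposite outer ends, and the terms cancel only because the remaining sum is,
  by induction, a multiple of \<open>1\<close>.\<close>

lemma sweedler_antipode:
  "sweedler (\<lambda>v w. tensor_antipode v * w) u = tensor_counit u *\<^sub>R 1"
  "sweedler (\<lambda>v w. v * tensor_antipode w) u = tensor_counit u *\<^sub>R 1"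
proof -
  have l: "linear (\<lambda>u :: 'a tensor_algebra. tensor_counit u *\<^sub>R (1 :: 'a tensor_algebra))"
    by (intro linear_intros linear_tensor_counit)
  have l': "linear (\<lambda>v. tensor_in x * v)" "linear (\<lambda>v. v * tensor_in x)" for x :: 'a
    by (intro linear_intros)+
  show "sweedler (\<lambda>v w. tensor_antipode v * w) u = tensor_counit u *\<^sub>R 1"
    by (rule linear_tensor_eqI[OF linear_sweedler l])
      (simp_all add: bilinear_antipode sweedler_mult_in sweedler_fun_minus mult.assoc)
  have 1: "sweedler (\<lambda>v w. tensor_in x * v * tensor_antipode w) u =
      tensor_in x * sweedler (\<lambda>v w. v * tensor_antipode w) u"
    "sweedler (\<lambda>v w. v * (tensor_antipode w * tensor_in x)) u =
      sweedler (\<lambda>v w. v * tensor_antipode w) u * tensor_in x" for x :: 'a and u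
    by (simp_all add: sweedler_comp[OF l'(1)] sweedler_comp[OF l'(2)] mult.assoc)
  show "sweedler (\<lambda>v w. v * tensor_antipode w) u = tensor_counit u *\<^sub>R 1"
    by (rule linear_tensor_eqI[OF linear_sweedler l])
      (simp_all add: bilinear_antipode sweedler_mult_in sweedler_fun_minus 1)
qed

section \<open>The Guin--Oudom construction on the tensor algebra\<close>

definition tensor_der :: "('a::real_vector \<Rightarrow> 'a \<Rightarrow> 'a) \<Rightarrow> 'a \<Rightarrow> 'a tensor_algebra \<Rightarrow> 'a tensor_algebra" where
  "tensor_der tr x = tensor_rec (\<lambda>y u v. tensor_in (tr x y) * u + tensor_in y * v) 0"

definition tensor_phi :: "('a::real_vector \<Rightarrow> 'a \<Rightarrow> 'a) \<Rightarrow> 'a tensor_algebra \<Rightarrow> 'a tensor_algebra" where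
  "tensor_phi tr = tensor_rec (\<lambda>x u v. tensor_in x * v + tensor_der tr x v) 1"

definition tensor_act ::
    "('a::real_vector \<Rightarrow> 'a \<Rightarrow> 'a) \<Rightarrow> 'a tensor_algebra \<Rightarrow> 'a tensor_algebra \<Rightarrow> 'a tensor_algebra" where
  "tensor_act tr a w = tensor_rec (\<lambda>x u v. tensor_der tr x v) w a"

text \<open>The inverse of \<open>tensor_phi\<close>.\<close>

fun word_psi :: "('a::real_vector \<Rightarrow> 'a \<Rightarrow> 'a) \<Rightarrow> 'a list \<Rightarrow> 'a tensor_algebra" where
  "word_psi tr [] = 1"
| "word_psi tr (x # xs) = tensor_in x * word_psi tr xs - (\<Sum>i<length xs. word_psi tr (xs[i := tr x (xs ! i)]))"

definition tensor_psi :: "('a::real_vector \<Rightarrow> 'a \<Rightarrow> 'a) \<Rightarrow> 'a tensor_algebra \<Rightarrow> 'a tensor_algebra" where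
  "tensor_psi tr = tensor_lift (word_psi tr)"

definition tensor_ext ::
    "('a::real_vector \<Rightarrow> 'a \<Rightarrow> 'a) \<Rightarrow> 'a tensor_algebra \<Rightarrow> 'a tensor_algebra \<Rightarrow> 'a tensor_algebra" where
  "tensor_ext tr u w = tensor_act tr (tensor_psi tr u) w"

definition tensor_star ::
    "('a::real_vector \<Rightarrow> 'a \<Rightarrow> 'a) \<Rightarrow> 'a tensor_algebra \<Rightarrow> 'a tensor_algebra \<Rightarrow> 'a tensor_algebra" where
  "tensor_star tr u v = tensor_phi tr (tensor_psi tr u * tensor_psi tr v)"

locale bilinear_operation =
  fixes tr :: "'a::real_vector \<Rightarrow> 'a \<Rightarrow> 'a"
  assumes bilinear_tr: "bilinear tr"
begin

abbreviation "D \<equiv> tensor_der tr"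
abbreviation "\<Phi> \<equiv> tensor_phi tr"
abbreviation "\<Psi> \<equiv> tensor_psi tr"
abbreviation "\<rho> \<equiv> tensor_act tr"

lemmas linear_tr_right = linear_bilinear_right[OF bilinear_tr]

lemma rec_step_der: "rec_step (\<lambda>y u v. tensor_in (tr x y) * u + tensor_in y * v)"
proof -
  have "linear (\<lambda>y. tensor_in (tr x y) * u + tensor_in y * v)" for u v
    by (intro linear_intros linear_tr_right)
  then show ?thesis by (simp add: rec_step_def algebra_simps)
qed

lemma linear_der: "linear (D x)"
  and der_1 [simp]: "D x 1 = 0"
  and der_mult_in: "D x (tensor_in y * u) = tensor_in (tr x y) * u + tensor_in y * D x u"
  unfolding tensor_der_def
  by (simp_all add: linear_tensor_rec[OF rec_step_der] tensor_rec_1[OF rec_step_der]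
      tensor_rec_mult[OF rec_step_der])

lemmas der_add = linear_add[OF linear_der]
  and der_diff = linear_diff[OF linear_der]
  and der_scale = linear_scale[OF linear_der]

lemma der_in [simp]: "D x (tensor_in y) = tensor_in (tr x y)"
  using der_mult_in[of x y 1] by simp

lemma der_mult: "D x (u * v) = D x u * v + u * D x v"
  by (induction u rule: tensor_algebra_induct)
    (simp_all add: der_mult_in der_add der_scale algebra_simps)

lemma linear_der_left: "linear (\<lambda>x. D x u)"
proof (rule linearI)
  show "D (x + y) u = D x u + D y u" for x y
    by (induction u rule: tensor_algebra_induct)
      (simp_all add: der_mult_in der_add der_scale bilinear_ladd[OF bilinear_tr] tensor_in_add algebra_simps)
  show "D (c *\<^sub>R x) u = c *\<^sub>R D x u" for c x
    by (induction u rule: tensor_algebra_induct)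
      (simp_all add: der_mult_in der_add der_scale bilinear_lmul[OF bilinear_tr] tensor_in_scale
        scaleR_add_right)
qed

text \<open>This matches the sum in \<open>word_psi\<close>. It also shows that \<open>D x\<close>
  sends a word to a combination of words of the same length, on which the inductions on length
  rest.\<close>

lemma der_word: "D x (word_prod xs) = (\<Sum>i<length xs. word_prod (xs[i := tr x (xs ! i)]))"
proof (induction xs)
  case (Cons y xs)
  then show ?case
    by (simp add: der_mult_in sum.lessThan_Suc_shift sum_distrib_left del: sum.lessThan_Suc)
qed simp

text \<open>\<open>D x\<close> is a coderivation: it sends letters to letters, which are primitive,
  and it obeys the Leibniz rule.\<close>

lemma sweedler_der:
  assumes "bilinear b"
  shows "sweedler b (D x u) = sweedler (\<lambda>v w. b (D x v) w) u + sweedler (\<lambda>v w. b v (D x w)) u"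
  using assms
proof (induction u arbitrary: b rule: tensor_algebra_induct)
  case one
  have "bilinear (\<lambda>v w. b (D x v) w)" "bilinear (\<lambda>v w. b v (D x w))"
    by (rule bilinear_comp_left bilinear_comp_right, rule one, rule linear_der)+
  then show ?case using one
    by (simp add: linear_0[OF linear_sweedler] bilinear_lzero bilinear_rzero)
next
  case (mult y u)
  have 1: "bilinear (\<lambda>u v. b (tensor_in z * u) v)" "bilinear (\<lambda>u v. b u (tensor_in z * v))" for z
    by (rule bilinear_comp_left bilinear_comp_right, rule mult.prems, intro linear_intros)+
  have 2: "bilinear (\<lambda>v w. b (D x v) w)" "bilinear (\<lambda>v w. b v (D x w))"
    by (rule bilinear_comp_left bilinear_comp_right, rule mult.prems, rule linear_der)+
  show ?case
    using mult.IH[OF 1(1)[of y]] mult.IH[OF 1(2)[of y]] mult.prems 1 2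
    by (simp add: der_mult_in linear_add[OF linear_sweedler] sweedler_mult_in
        bilinear_ladd[OF mult.prems] bilinear_radd[OF mult.prems] sweedler_fun_add)
next
  case (add u v)
  have 2: "bilinear (\<lambda>v w. b (D x v) w)" "bilinear (\<lambda>v w. b v (D x w))"
    by (rule bilinear_comp_left bilinear_comp_right, rule add.prems, rule linear_der)+
  show ?case using add 2 by (simp add: der_add linear_add[OF linear_sweedler])
next
  case (scale r u)
  have 2: "bilinear (\<lambda>v w. b (D x v) w)" "bilinear (\<lambda>v w. b v (D x w))"
    by (rule bilinear_comp_left bilinear_comp_right, rule scale.prems, rule linear_der)+
  show ?case using scale 2 by (simp add: der_scale linear_scale[OF linear_sweedler] scaleR_add_right)
qed

lemma counit_der [simp]: "tensor_counit (D x u) = 0"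
  by (induction u rule: tensor_algebra_induct)
    (simp_all add: der_mult_in der_add der_scale linear_0[OF linear_tensor_counit]
      linear_add[OF linear_tensor_counit] linear_scale[OF linear_tensor_counit])

section \<open>The coalgebra map \<open>\<Phi>\<close>\<close>

lemma rec_step_phi: "rec_step (\<lambda>x u v. tensor_in x * v + D x v)"
proof -
  have "linear (\<lambda>x. tensor_in x * v + D x v)" for v
    by (intro linear_intros linear_der_left)
  then show ?thesis by (simp add: rec_step_def algebra_simps der_add der_scale)
qed

lemma linear_phi: "linear \<Phi>"
  and phi_1 [simp]: "\<Phi> 1 = 1"
  and phi_mult_in: "\<Phi> (tensor_in x * u) = tensor_in x * \<Phi> u + D x (\<Phi> u)"
  unfolding tensor_phi_def
  by (simp_all add: linear_tensor_rec[OF rec_step_phi] tensor_rec_1[OF rec_step_phi]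
      tensor_rec_mult[OF rec_step_phi])

lemma phi_in [simp]: "\<Phi> (tensor_in x) = tensor_in x"
  using phi_mult_in[of x 1] by simp

lemmas linear_phi_comp = linear_comp[OF linear_phi]

lemma counit_phi [simp]: "tensor_counit (\<Phi> u) = tensor_counit u"
  by (induction u rule: tensor_algebra_induct)
    (simp_all add: phi_mult_in linear_add[OF linear_phi] linear_scale[OF linear_phi]
      linear_add[OF linear_tensor_counit] linear_scale[OF linear_tensor_counit])

text \<open>Left multiplication by a letter and \<open>D x\<close> both pass through the coproduct
  as X 1 + 1 X. So does their sum, the operator by which \<open>\<Phi>\<close> recurses.\<close>

lemma sweedler_phi:
  assumes "bilinear b"
  shows "sweedler b (\<Phi> u) = sweedler (\<lambda>v w. b (\<Phi> v) (\<Phi> w)) u"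
  using assms
proof (induction u arbitrary: b rule: tensor_algebra_induct)
  case one
  then show ?case by (simp add: bilinear_comp[OF one linear_phi linear_phi])
next
  case (mult x u)
  have 1: "bilinear (\<lambda>u v. b (tensor_in x * u) v)" "bilinear (\<lambda>u v. b u (tensor_in x * v))"
    by (rule bilinear_comp_left bilinear_comp_right, rule mult.prems, intro linear_intros)+
  have 2: "bilinear (\<lambda>v w. b (D x v) w)" "bilinear (\<lambda>v w. b v (D x w))"
    by (rule bilinear_comp_left bilinear_comp_right, rule mult.prems, rule linear_der)+
  show ?case
    using mult.IH[OF 1(1)] mult.IH[OF 1(2)] mult.IH[OF 2(1)] mult.IH[OF 2(2)] mult.prems
      bilinear_comp[OF mult.prems linear_phi linear_phi]
    by (simp add: phi_mult_in linear_add[OF linear_sweedler] sweedler_mult_in sweedler_der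
        bilinear_ladd[OF mult.prems] bilinear_radd[OF mult.prems] sweedler_fun_add)
next
  case (add u v)
  then show ?case
    by (simp add: linear_add[OF linear_phi] linear_add[OF linear_sweedler] bilinear_comp[OF add.prems linear_phi linear_phi])
next
  case (scale r u)
  then show ?case
    by (simp add: linear_scale[OF linear_phi] linear_scale[OF linear_sweedler] bilinear_comp[OF scale.prems linear_phi linear_phi])
qed

section \<open>The action \<open>\<rho>\<close> of T on itself by composed derivations\<close>

lemma rec_step_act: "rec_step (\<lambda>x u v. D x v)"
  by (simp add: rec_step_def linear_der_left der_add der_scale)

lemma linear_act_left: "linear (\<lambda>a. \<rho> a w)"
  and act_1 [simp]: "\<rho> 1 w = w"
  and act_mult_in: "\<rho> (tensor_in x * a) w = D x (\<rho> a w)"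
  unfolding tensor_act_def
  by (simp_all add: linear_tensor_rec[OF rec_step_act] tensor_rec_1[OF rec_step_act]
      tensor_rec_mult[OF rec_step_act])

lemma act_in [simp]: "\<rho> (tensor_in x) w = D x w"
  using act_mult_in[of x 1] by simp

lemmas act_add = linear_add[OF linear_act_left] and act_scale = linear_scale[OF linear_act_left]

lemma linear_act_right: "linear (\<rho> a)"
proof (rule linearI)
  show "\<rho> a (v + w) = \<rho> a v + \<rho> a w" for v w
    by (induction a rule: tensor_algebra_induct)
      (simp_all add: act_mult_in act_add act_scale der_add scaleR_add_right)
  show "\<rho> a (c *\<^sub>R v) = c *\<^sub>R \<rho> a v" for c v
    by (induction a rule: tensor_algebra_induct)
      (simp_all add: act_mult_in act_add act_scale der_scale scaleR_add_right)
qed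

lemma bilinear_act: "bilinear \<rho>"
  by (intro bilinearI linear_act_left linear_act_right)

lemma act_act: "\<rho> (a * b) w = \<rho> a (\<rho> b w)"
  by (induction a rule: tensor_algebra_induct)
    (simp_all add: act_mult_in act_add act_scale mult.assoc distrib_right)

lemma act_unit: "\<rho> a 1 = tensor_counit a *\<^sub>R 1"
  by (induction a rule: tensor_algebra_induct)
    (simp_all add: act_mult_in act_add act_scale der_scale linear_add[OF linear_tensor_counit]
      linear_scale[OF linear_tensor_counit] scaleR_left_distrib)

lemma bilinear_act_mult:
  assumes "linear f" "linear g"
  shows "bilinear (\<lambda>a b. \<rho> (f a) v * \<rho> (g b) w)"
  by (intro bilinearI linear_intros linear_bilinear_left[OF bilinear_act] assms)

text \<open>Letters are primitive and act by derivations, which makes T a module algebra over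
  itself.\<close>

lemma act_mult: "\<rho> a (v * w) = sweedler (\<lambda>a1 a2. \<rho> a1 v * \<rho> a2 w) a"
proof (rule linear_tensor_eqI[OF linear_act_left linear_sweedler])
  show b: "bilinear (\<lambda>a1 a2. \<rho> a1 v * \<rho> a2 w)"
    by (intro bilinear_act_mult linear_ident)
  show "\<rho> 1 (v * w) = sweedler (\<lambda>a1 a2. \<rho> a1 v * \<rho> a2 w) 1" using b by simp
  fix x u
  assume "\<rho> u (v * w) = sweedler (\<lambda>a1 a2. \<rho> a1 v * \<rho> a2 w) u"
  then have "\<rho> (tensor_in x * u) (v * w) = sweedler (\<lambda>a1 a2. D x (\<rho> a1 v * \<rho> a2 w)) u"
    by (simp add: act_mult_in sweedler_comp[OF linear_der])
  then show "\<rho> (tensor_in x * u) (v * w) = sweedler (\<lambda>a1 a2. \<rho> a1 v * \<rho> a2 w) (tensor_in x * u)"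
    by (simp add: sweedler_mult_in[OF b] der_mult sweedler_fun_add act_mult_in)
qed

text \<open>Source of the Sweedler form of the star product. Applied to a product, the operator
  \<open>w \<mapsto> tensor_in x * w + D x w\<close> splits by the Leibniz rule: the part on the
  first factor is the recursion of \<open>\<Phi>\<close>, the part on the second that of
  \<open>\<rho>\<close>.\<close>

lemma phi_mult: "\<Phi> (a * b) = sweedler (\<lambda>a1 a2. \<Phi> a1 * \<rho> a2 (\<Phi> b)) a"
proof (rule linear_tensor_eqI[OF linear_phi_comp linear_sweedler])
  show "linear (\<lambda>a. a * b)" by (intro linear_intros)
  show c: "bilinear (\<lambda>a1 a2. \<Phi> a1 * \<rho> a2 (\<Phi> b))"
    by (intro bilinearI linear_intros linear_bilinear_left[OF bilinear_act] linear_phi)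
  show "\<Phi> (1 * b) = sweedler (\<lambda>a1 a2. \<Phi> a1 * \<rho> a2 (\<Phi> b)) 1" using c by simp
  fix x u
  have l: "linear (\<lambda>w. tensor_in x * w + D x w)" by (intro linear_intros linear_der)
  assume "\<Phi> (u * b) = sweedler (\<lambda>a1 a2. \<Phi> a1 * \<rho> a2 (\<Phi> b)) u"
  then have "\<Phi> (tensor_in x * u * b) =
      sweedler (\<lambda>a1 a2. tensor_in x * (\<Phi> a1 * \<rho> a2 (\<Phi> b)) + D x (\<Phi> a1 * \<rho> a2 (\<Phi> b))) u"
    by (simp add: mult.assoc phi_mult_in sweedler_comp[OF l])
  also have "\<dots> = sweedler (\<lambda>a1 a2. \<Phi> (tensor_in x * a1) * \<rho> a2 (\<Phi> b) + \<Phi> a1 * \<rho> (tensor_in x * a2) (\<Phi> b)) u"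
    by (simp add: phi_mult_in act_mult_in der_mult algebra_simps)
  finally show "\<Phi> (tensor_in x * u * b) = sweedler (\<lambda>a1 a2. \<Phi> a1 * \<rho> a2 (\<Phi> b)) (tensor_in x * u)"
    by (simp add: sweedler_mult_in[OF c] sweedler_fun_add)
qed

section \<open>The inverse map \<open>\<Psi>\<close>\<close>

lemma multilinear_word_psi: "multilinear_word (word_psi tr)"
proof -
  have "word_psi tr (xs[i := a + b]) = word_psi tr (xs[i := a]) + word_psi tr (xs[i := b]) \<and>
      word_psi tr (xs[i := c *\<^sub>R a]) = c *\<^sub>R word_psi tr (xs[i := a])"
    if "i < length xs" for xs i a b c
    using that
  \<comment> \<open>The correction words in \<open>word_psi\<close> are not tails of
    \<open>xs\<close>, only as long as its tail; hence induction on the length.\<close>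
  proof (induction "length xs" arbitrary: xs i a b c rule: less_induct)
    case less
    then obtain x ys where xs: "xs = x # ys" by (cases xs) auto
    have IH: "word_psi tr (zs[j := a + b]) = word_psi tr (zs[j := a]) + word_psi tr (zs[j := b])"
      "word_psi tr (zs[j := c *\<^sub>R a]) = c *\<^sub>R word_psi tr (zs[j := a])"
      if "length zs = length ys" "j < length ys" for zs j a b c
      using less.hyps[of zs j a b c] that xs by auto
    show ?case
    proof (cases i)
      case 0
      then show ?thesis
        by (simp add: xs IH tensor_in_add tensor_in_scale bilinear_ladd[OF bilinear_tr]
            bilinear_lmul[OF bilinear_tr] distrib_right sum.distrib scaleR_sum_right scaleR_diff_right)
    next
      case (Suc j)
      then have j: "j < length ys" using less.prems xs by simp
      \<comment> \<open>At \<open>k = j\<close> the varied letter is the one hit by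
        \<open>tr x\<close>, and linearity of \<open>tr x\<close> applies. At other positions the
        two updates commute.\<close>
      let ?s = "\<lambda>a k. word_psi tr (ys[j := a, k := tr x (ys[j := a] ! k)])"
      have "?s (a + b) k = ?s a k + ?s b k \<and> ?s (c *\<^sub>R a) k = c *\<^sub>R ?s a k" if "k < length ys" for k
      proof (cases "k = j")
        case True
        then show ?thesis using j
          by (simp add: IH bilinear_radd[OF bilinear_tr] bilinear_rmul[OF bilinear_tr])
      next
        case False
        then show ?thesis using j that
          by (simp add: IH list_update_swap[of j k])
      qed
      then show ?thesis
        by (simp add: xs Suc j IH distrib_left sum.distrib scaleR_sum_right scaleR_diff_right)
    qed
  qed
  then show ?thesis unfolding multilinear_word_def by blast
qed

lemma linear_psi: "linear \<Psi>"
  unfolding tensor_psi_def by (rule linear_tensor_lift[OF multilinear_word_psi])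

lemma psi_word: "\<Psi> (word_prod xs) = word_psi tr xs"
  unfolding tensor_psi_def by (rule tensor_lift_word[OF multilinear_word_psi])

lemma psi_1 [simp]: "\<Psi> 1 = 1"
  using psi_word[of "[]"] by simp

lemma psi_mult_in: "\<Psi> (tensor_in x * u) = tensor_in x * \<Psi> u - \<Psi> (D x u)"
proof (induction u rule: tensor_word_induct)
  case (word xs)
  have "\<Psi> (word_prod (x # xs)) = tensor_in x * \<Psi> (word_prod xs) - (\<Sum>i<length xs. \<Psi> (word_prod (xs[i := tr x (xs ! i)])))"
    by (simp only: psi_word word_psi.simps)
  then show ?case by (simp add: der_word linear_sum[OF linear_psi])
next
  case (add u v)
  then show ?case by (simp add: linear_add[OF linear_psi] der_add distrib_left)
next
  case (scale c u)
  then show ?case by (simp add: linear_scale[OF linear_psi] der_scale scaleR_diff_right)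
qed

lemma psi_in [simp]: "\<Psi> (tensor_in x) = tensor_in x"
  using psi_mult_in[of x 1] by (simp add: linear_0[OF linear_psi])

text \<open>The two terms \<open>\<Psi> (D x (\<Phi> a))\<close> cancel, so a structural induction
  suffices.\<close>

lemma psi_phi [simp]: "\<Psi> (\<Phi> a) = a"
  by (induction a rule: tensor_algebra_induct)
    (simp_all add: phi_mult_in psi_mult_in linear_add[OF linear_phi] linear_scale[OF linear_phi]
      linear_add[OF linear_psi] linear_scale[OF linear_psi])

text \<open>Here the hypothesis is needed at \<open>D x\<close> of the tail, which is a sum of words
  as long as the tail; hence induction on the length of words.\<close>

lemma phi_psi [simp]: "\<Phi> (\<Psi> u) = u"
proof -
  have "\<Phi> (\<Psi> (word_prod xs)) = word_prod xs" for xs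
  proof (induction "length xs" arbitrary: xs rule: less_induct)
    case less
    show ?case
    proof (cases xs)
      case (Cons x ys)
      have IH: "\<Phi> (\<Psi> (word_prod zs)) = word_prod zs" if "length zs = length ys" for zs
        using less that Cons by simp
      then have "\<Phi> (\<Psi> (D x (word_prod ys))) = D x (word_prod ys)"
        by (simp add: der_word linear_sum[OF linear_psi] linear_sum[OF linear_phi])
      then show ?thesis
        by (simp add: Cons psi_mult_in phi_mult_in linear_diff[OF linear_phi] IH)
    qed simp
  qed
  then show ?thesis
    by (induction u rule: tensor_word_induct)
      (simp_all add: linear_add[OF linear_phi] linear_scale[OF linear_phi]
        linear_add[OF linear_psi] linear_scale[OF linear_psi])
qed

text \<open>The inverse of a coalgebra map is one: \<open>sweedler_phi\<close> at
  \<open>\<Psi> u\<close>, for \<open>b\<close> precomposed with \<open>\<Psi>\<close> in both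
  arguments.\<close>

lemma sweedler_psi:
  assumes "bilinear b"
  shows "sweedler b (\<Psi> u) = sweedler (\<lambda>v w. b (\<Psi> v) (\<Psi> w)) u"
  using sweedler_phi[OF bilinear_comp[OF assms linear_psi linear_psi], of "\<Psi> u"] by simp

lemma counit_psi [simp]: "tensor_counit (\<Psi> u) = tensor_counit u"
  using counit_phi[of "\<Psi> u"] by simp

section \<open>Extended action and star product on T\<close>

lemma bilinear_ext: "bilinear (tensor_ext tr)"
  unfolding tensor_ext_def by (rule bilinear_comp_left[OF bilinear_act linear_psi])

lemma ext_in: "tensor_ext tr (tensor_in x) w = D x w"
  and ext_1: "tensor_ext tr 1 w = w"
  and ext_unit: "tensor_ext tr u 1 = tensor_counit u *\<^sub>R 1"
  by (simp_all add: tensor_ext_def act_unit)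

text \<open>The correction term in the recursion of \<open>\<Psi>\<close> becomes the subtracted
  term in the defining recursion of the extension.\<close>

lemma ext_mult_in:
  "tensor_ext tr (tensor_in x * v) w = D x (tensor_ext tr v w) - tensor_ext tr (D x v) w"
  by (simp add: tensor_ext_def psi_mult_in linear_diff[OF linear_act_left] act_mult_in)

lemma ext_mult: "tensor_ext tr u (v * w) = sweedler (\<lambda>u1 u2. tensor_ext tr u1 v * tensor_ext tr u2 w) u"
  unfolding tensor_ext_def act_mult
  by (rule sweedler_psi) (intro bilinear_act_mult linear_ident)

text \<open>\<open>phi_mult\<close> at \<open>a = \<Psi> u\<close> and \<open>b = \<Psi> v\<close>,
  with \<open>\<Psi>\<close> pulled out of the coproduct.\<close>

lemma star_sweedler: "tensor_star tr u v = sweedler (\<lambda>u1 u2. u1 * tensor_ext tr u2 v) u"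
proof -
  have "bilinear (\<lambda>a1 a2. \<Phi> a1 * \<rho> a2 v)"
    by (intro bilinearI linear_intros linear_bilinear_left[OF bilinear_act] linear_phi)
  from sweedler_psi[OF this, of u] show ?thesis
    by (simp add: tensor_star_def phi_mult tensor_ext_def)
qed

lemma bilinear_star: "bilinear (tensor_star tr)"
  unfolding tensor_star_def by (intro bilinearI linear_phi_comp linear_intros linear_psi)

lemma star_assoc: "tensor_star tr (tensor_star tr u v) w = tensor_star tr u (tensor_star tr v w)"
  and star_1: "tensor_star tr 1 u = u" "tensor_star tr u 1 = u"
  and phi_star: "\<Phi> (a * b) = tensor_star tr (\<Phi> a) (\<Phi> b)"
  and counit_star: "tensor_counit (tensor_star tr u v) = tensor_counit u * tensor_counit v"
  by (simp_all add: tensor_star_def mult.assoc tensor_counit_mult)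

text \<open>Transported from concatenation, since \<open>\<Phi>\<close> and \<open>\<Psi>\<close>
  are coalgebra maps.\<close>

lemma sweedler_star:
  assumes "bilinear b"
  shows "sweedler b (tensor_star tr u v) =
    sweedler (\<lambda>u1 u2. sweedler (\<lambda>v1 v2. b (tensor_star tr u1 v1) (tensor_star tr u2 v2)) v) u"
proof -
  note c = bilinear_comp[OF assms linear_phi linear_phi]
  have "sweedler b (tensor_star tr u v) =
      sweedler (\<lambda>u1 u2. sweedler (\<lambda>v1 v2. b (\<Phi> (u1 * v1)) (\<Phi> (u2 * v2))) (\<Psi> v)) (\<Psi> u)"
    by (simp add: tensor_star_def sweedler_phi[OF assms] sweedler_mult[OF c])
  also have "\<dots> = sweedler (\<lambda>u1 u2. sweedler (\<lambda>v1 v2. b (\<Phi> (\<Psi> u1 * v1)) (\<Phi> (\<Psi> u2 * v2))) (\<Psi> v)) u"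
    by (rule sweedler_psi[OF bilinear_sweedler_mult(1)[OF c]])
  finally show ?thesis
    by (simp add: tensor_star_def sweedler_psi[OF bilinear_sweedler_mult(2)[OF c]])
qed

definition star_antipode :: "'a tensor_algebra \<Rightarrow> 'a tensor_algebra" where
  "star_antipode u = \<Phi> (tensor_antipode (\<Psi> u))"

lemma linear_star_antipode: "linear star_antipode"
  unfolding star_antipode_def by (intro linear_phi_comp linear_antipode_comp linear_psi)

lemma sweedler_star_antipode:
  "sweedler (\<lambda>v w. tensor_star tr (star_antipode v) w) u = tensor_counit u *\<^sub>R 1"
  "sweedler (\<lambda>v w. tensor_star tr v (star_antipode w)) u = tensor_counit u *\<^sub>R 1"
  using sweedler_antipode[of "\<Psi> u"] sweedler_psi[OF bilinear_antipode(1), of u]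
    sweedler_psi[OF bilinear_antipode(2), of u]
  by (simp_all add: tensor_star_def star_antipode_def linear_scale[OF linear_phi]
      flip: sweedler_comp[OF linear_phi])

end

section \<open>The defining ideal of the enveloping algebra\<close>

lemma type_algebra_simps [simp]:
  "carrier type_algebra = UNIV" "mult type_algebra = (*)" "one type_algebra = 1"
  "zero type_algebra = 0" "add type_algebra = (+)" "smult type_algebra = scaleR"
  by (simp_all add: type_algebra_def)

lemma ring_type_algebra: "ring (type_algebra :: (real, 'a::real_algebra_1) module)"
proof (intro ringI abelian_groupI monoidI)
  fix x :: 'a
  show "\<exists>y\<in>carrier type_algebra. y \<oplus>\<^bsub>type_algebra\<^esub> x = \<zero>\<^bsub>type_algebra\<^esub>"
    by (rule bexI[of _ "- x"]) simp_all
qed (simp_all add: algebra_simps)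

lemma cring_type_algebra: "cring (type_algebra :: (real, real) module)"
  by (intro cring.intro ring_type_algebra comm_monoid.intro comm_monoid_axioms.intro)
    (use ring_type_algebra in \<open>auto simp: ring_def\<close>)

lemma a_inv_type_algebra: "a_inv (type_algebra :: (real, 'a::real_algebra_1) module) x = - x"
proof -
  interpret ring "type_algebra :: (real, 'a) module" by (rule ring_type_algebra)
  show ?thesis by (rule minus_equality) simp_all
qed

definition lie_relator :: "('a::real_vector \<Rightarrow> 'a \<Rightarrow> 'a) \<Rightarrow> 'a \<Rightarrow> 'a \<Rightarrow> 'a tensor_algebra" where
  "lie_relator br x y = tensor_in x * tensor_in y - tensor_in y * tensor_in x - tensor_in (br x y)"

lemma ideal_uea_ideal: "ideal (uea_ideal br) type_algebra"
  unfolding uea_ideal_def by (rule ring.genideal_ideal[OF ring_type_algebra]) simp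

lemma uea_ideal_mult_left: "t \<in> uea_ideal br \<Longrightarrow> s * t \<in> uea_ideal br"
  using ideal.I_l_closed[OF ideal_uea_ideal, of t br s] by simp

lemma uea_ideal_mult_right: "t \<in> uea_ideal br \<Longrightarrow> t * s \<in> uea_ideal br"
  using ideal.I_r_closed[OF ideal_uea_ideal, of t br s] by simp

text \<open>A ring ideal becomes closed under scalars because scaling is multiplication by a
  multiple of the unit.\<close>

lemma subspace_uea_ideal: "subspace (uea_ideal br)"
proof (rule subspaceI)
  interpret I: ideal "uea_ideal br" type_algebra by (rule ideal_uea_ideal)
  show "0 \<in> uea_ideal br" using additive_subgroup.zero_closed[OF I.additive_subgroup_axioms] by simp
  show "s + t \<in> uea_ideal br" if "s \<in> uea_ideal br" "t \<in> uea_ideal br" for s t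
    using additive_subgroup.a_closed[OF I.additive_subgroup_axioms that] by simp
  show "c *\<^sub>R t \<in> uea_ideal br" if "t \<in> uea_ideal br" for c t
    using uea_ideal_mult_left[OF that, of "c *\<^sub>R 1"] by simp
qed

lemma lie_relator_in_uea_ideal: "lie_relator br x y \<in> uea_ideal br"
  unfolding uea_ideal_def lie_relator_def
  by (rule subsetD[OF ring.genideal_self[OF ring_type_algebra]]) auto

text \<open>A generated ideal is turned into a span, so that linear maps that are not multiplicative
  can be tested on it. The span absorbs words on either side by lengthening the prefix or the
  suffix.\<close>

lemma uea_ideal_eq_span:
  "uea_ideal br = span {word_prod a * lie_relator br x y * word_prod c | a c x y. True}"
proof
  let ?G = "{word_prod a * lie_relator br x y * word_prod c | a c x y. True}"
  have L: "s * t \<in> span ?G" if "t \<in> span ?G" for s t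
  proof (induction s rule: tensor_word_induct)
    case (word xs)
    show ?case using that
    proof (induction rule: span_induct_alt)
      case (step c r t)
      then obtain a b x y where r: "r = word_prod a * lie_relator br x y * word_prod b" by auto
      have "word_prod xs * r = word_prod (xs @ a) * lie_relator br x y * word_prod b"
        by (simp add: r word_prod_append mult.assoc)
      then have "word_prod xs * r \<in> ?G" by blast
      with step show ?case by (simp add: distrib_left span_add span_scale span_base)
    qed (simp add: span_zero)
  qed (simp_all add: distrib_right span_add span_scale)
  have R: "t * s \<in> span ?G" if "t \<in> span ?G" for s t
  proof (induction s rule: tensor_word_induct)
    case (word xs)
    show ?case using that
    proof (induction rule: span_induct_alt)
      case (step c r t)
      then obtain a b x y where r: "r = word_prod a * lie_relator br x y * word_prod b" by auto
      have "r * word_prod xs = word_prod a * lie_relator br x y * word_prod (b @ xs)"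
        by (simp add: r word_prod_append mult.assoc)
      then have "r * word_prod xs \<in> ?G" by blast
      with step show ?case by (simp add: distrib_right span_add span_scale span_base)
    qed (simp add: span_zero)
  qed (simp_all add: distrib_left span_add span_scale)
  have "subgroup (span ?G) (add_monoid type_algebra)"
  proof (rule subgroup.intro)
    show "inv\<^bsub>add_monoid type_algebra\<^esub> t \<in> span ?G" if "t \<in> span ?G" for t
      using span_neg[OF that] a_inv_type_algebra[of t] by (simp only: a_inv_def)
  qed (simp_all add: span_add span_zero)
  then have "ideal (span ?G) type_algebra"
    using L R by (intro idealI ring_type_algebra) (simp_all only: type_algebra_simps)
  moreover have "lie_relator br x y \<in> span ?G" for x y
  proof -
    have "word_prod [] * lie_relator br x y * word_prod [] \<in> span ?G" by (rule span_base) blast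
    then show ?thesis by simp
  qed
  ultimately show "uea_ideal br \<subseteq> span ?G"
    unfolding uea_ideal_def lie_relator_def
    by (intro ring.genideal_minimal[OF ring_type_algebra]) auto
  show "span ?G \<subseteq> uea_ideal br"
    by (rule span_minimal[OF _ subspace_uea_ideal])
      (auto simp: uea_ideal_mult_left uea_ideal_mult_right lie_relator_in_uea_ideal)
qed

text \<open>Applied with \<open>V\<close> an ideal, or with \<open>V = {0}\<close> for maps that
  annihilate the ideal.\<close>

lemma linear_image_uea_ideal:
  assumes "linear f" "subspace V" "t \<in> uea_ideal br"
    "\<And>a c x y. f (word_prod a * lie_relator br x y * word_prod c) \<in> V"
  shows "f t \<in> V"
proof -
  have "t \<in> span {word_prod a * lie_relator br x y * word_prod c | a c x y. True}"
    using assms(3) unfolding uea_ideal_eq_span .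
  then show ?thesis
  proof (induction rule: span_induct_alt)
    case (step c r t)
    then show ?case
      using assms by (auto simp: linear_add linear_scale intro!: subspace_add subspace_scale)
  qed (use assms in \<open>simp add: linear_0 subspace_0\<close>)
qed

text \<open>The ideal is a coideal: relators are primitive, so in the coproduct of word * relator *
  word each term has one factor in the ideal.\<close>

lemma sweedler_uea_ideal:
  assumes "bilinear b" "t \<in> uea_ideal br"
    "\<And>u v. u \<in> uea_ideal br \<Longrightarrow> b u v = 0" "\<And>u v. v \<in> uea_ideal br \<Longrightarrow> b u v = 0"
  shows "sweedler b t = 0"
proof -
  have z: "sweedler (\<lambda>v w. 0) u = 0" for u :: "'a tensor_algebra"
    using sweedler_fun_scale[of 0 "\<lambda>v w. 0" u] by simp
  \<comment> \<open>The mixed terms in the coproduct of a product of two letters are symmetric in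
    the letters and cancel in the commutator.\<close>
  have prim: "sweedler b' (lie_relator br x y) = b' (lie_relator br x y) 1 + b' 1 (lie_relator br x y)"
    if "bilinear b'" for b' :: "'a tensor_algebra \<Rightarrow> 'a tensor_algebra \<Rightarrow> 'b" and x y
  proof -
    have "sweedler b' (tensor_in x * tensor_in y) = b' (tensor_in x * tensor_in y) 1 +
        b' (tensor_in x) (tensor_in y) + b' (tensor_in y) (tensor_in x) + b' 1 (tensor_in x * tensor_in y)" for x y
    proof -
      have "bilinear (\<lambda>u v. b' (tensor_in x * u) v)" "bilinear (\<lambda>u v. b' u (tensor_in x * v))"
        by (rule bilinear_comp_left bilinear_comp_right, rule that, intro linear_intros)+
      then show ?thesis using that by (simp add: sweedler_mult_in sweedler_in)
    qed
    then show ?thesis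
      by (simp add: lie_relator_def linear_diff[OF linear_sweedler[OF that]] sweedler_in[OF that]
          bilinear_lsub[OF that] bilinear_rsub[OF that])
  qed
  have "sweedler b t \<in> {0}"
  proof (rule linear_image_uea_ideal[OF linear_sweedler[OF assms(1)] subspace_single_0 assms(2)])
    fix a c x y
    have "sweedler b (word_prod a * (lie_relator br x y * word_prod c)) =
        sweedler (\<lambda>s1 s2. sweedler (\<lambda>r1 r2. sweedler (\<lambda>t1 t2. b (s1 * (r1 * t1)) (s2 * (r2 * t2))) (word_prod c))
          (lie_relator br x y)) (word_prod a)"
      unfolding sweedler_mult[OF assms(1), of "word_prod a"]
      by (simp only: sweedler_mult[OF bilinear_sweedler_mult(2)[OF assms(1)]])
    also have "\<dots> = sweedler (\<lambda>s1 s2. 0) (word_prod a)"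
    proof -
      have "sweedler (\<lambda>r1 r2. sweedler (\<lambda>t1 t2. b (s1 * (r1 * t1)) (s2 * (r2 * t2))) (word_prod c)) (lie_relator br x y) = 0"
        for s1 s2
      proof -
        have "bilinear (\<lambda>r1 r2. sweedler (\<lambda>t1 t2. b (s1 * (r1 * t1)) (s2 * (r2 * t2))) (word_prod c))"
          by (rule bilinear_sweedler_mult(1)[OF bilinear_sweedler_mult(2)[OF assms(1)]])
        then show ?thesis
          by (simp add: prim assms(3,4) uea_ideal_mult_left uea_ideal_mult_right lie_relator_in_uea_ideal z)
      qed
      then show ?thesis by simp
    qed
    finally show "sweedler b (word_prod a * lie_relator br x y * word_prod c) \<in> {0}"
      by (simp add: mult.assoc z)
  qed
  then show ?thesis by simp
qed

lemma counit_uea_ideal: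
  assumes "t \<in> uea_ideal br"
  shows "tensor_counit t = 0"
proof -
  have "tensor_counit t \<in> {0}"
    by (rule linear_image_uea_ideal[OF linear_tensor_counit subspace_single_0 assms])
      (simp add: tensor_counit_mult lie_relator_def linear_diff[OF linear_tensor_counit])
  then show ?thesis by simp
qed

text \<open>Reversing the order and negating the letters turns a relator into its negative.\<close>

lemma antipode_uea_ideal:
  assumes "t \<in> uea_ideal br"
  shows "tensor_antipode t \<in> uea_ideal br"
proof (rule linear_image_uea_ideal[OF linear_tensor_antipode subspace_uea_ideal assms])
  fix a c x y
  have "tensor_antipode (tensor_in z) = - tensor_in z" for z :: 'a
    using tensor_antipode_mult_in[of z 1] by simp
  then have "tensor_antipode (lie_relator br x y) = - lie_relator br x y"
    by (simp add: lie_relator_def linear_diff[OF linear_tensor_antipode])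
  then show "tensor_antipode (word_prod a * lie_relator br x y * word_prod c) \<in> uea_ideal br"
    by (simp add: tensor_antipode_mult uea_ideal_mult_left uea_ideal_mult_right
        subspace_neg[OF subspace_uea_ideal] lie_relator_in_uea_ideal)
qed

text \<open>\<open>dbl\<close> is a parameter so that a post-Lie structure and its deformation can
  share literally the same bracket. \<open>action\<close> says that \<open>tr\<close> is a
  representation of \<open>dbl\<close>.\<close>

locale post_lie = bilinear_operation tr for tr :: "'a::real_vector \<Rightarrow> 'a \<Rightarrow> 'a" +
  fixes br dbl :: "'a \<Rightarrow> 'a \<Rightarrow> 'a"
  assumes derivation: "tr x (br y z) = br (tr x y) z + br y (tr x z)"
    and action: "tr (dbl x y) z = tr x (tr y z) - tr y (tr x z)"
    and dbl_eq: "dbl x y = tr x y - tr y x + br x y"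
begin

lemma der_relator: "D x (lie_relator br y z) = lie_relator br (tr x y) z + lie_relator br y (tr x z)"
  by (simp add: lie_relator_def der_diff der_mult derivation tensor_in_add distrib_left distrib_right
      left_diff_distrib right_diff_distrib)

text \<open>Both sides are derivations of T, and they agree on letters by
  \<open>action\<close>.\<close>

lemma der_dbl: "D (dbl x y) u = D x (D y u) - D y (D x u)"
proof (induction u rule: tensor_algebra_induct)
  case (mult z u)
  then show ?case by (simp add: der_mult_in der_add action tensor_in_diff) (simp add: algebra_simps)
qed (simp_all add: der_add der_scale scaleR_diff_right linear_0[OF linear_der])

lemma der_uea_ideal:
  assumes "t \<in> uea_ideal br"
  shows "D x t \<in> uea_ideal br"
proof (rule linear_image_uea_ideal[OF linear_der subspace_uea_ideal assms])
  fix a c y z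
  show "D x (word_prod a * lie_relator br y z * word_prod c) \<in> uea_ideal br"
    by (simp add: der_mult der_relator subspace_add[OF subspace_uea_ideal]
        uea_ideal_mult_left uea_ideal_mult_right lie_relator_in_uea_ideal)
qed

text \<open>Expanding two letters by the recursion of \<open>\<Phi>\<close>, the cross terms are
  symmetric and drop out of the commutator. The commutator of \<open>D x\<close> and
  \<open>D y\<close> is consumed by \<open>D (dbl x y)\<close>, and \<open>tr x y - tr y x\<close>
  changes \<open>dbl\<close> into \<open>br\<close>.\<close>

lemma phi_relator: "\<Phi> (lie_relator dbl x y * a) = lie_relator br x y * \<Phi> a"
proof -
  have dbl: "tensor_in (dbl x y) = tensor_in (tr x y) - tensor_in (tr y x) + tensor_in (br x y)"
    by (simp add: dbl_eq tensor_in_add tensor_in_diff)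
  have "\<Phi> (lie_relator dbl x y * a) = tensor_in x * (tensor_in y * \<Phi> a) - tensor_in y * (tensor_in x * \<Phi> a) +
      tensor_in (tr x y) * \<Phi> a - tensor_in (tr y x) * \<Phi> a - tensor_in (dbl x y) * \<Phi> a"
    by (simp add: lie_relator_def left_diff_distrib linear_diff[OF linear_phi] mult.assoc phi_mult_in
        der_add der_mult_in der_dbl) (simp add: algebra_simps)
  also have "\<dots> = lie_relator br x y * \<Phi> a"
    unfolding dbl by (simp add: lie_relator_def algebra_simps)
  finally show ?thesis .
qed

lemma psi_relator: "\<Psi> (lie_relator br x y * u) = lie_relator dbl x y * \<Psi> u"
  using arg_cong[OF phi_relator[of x y "\<Psi> u"], of \<Psi>] by simp

text \<open>Each prefix letter comes off by the recursion of \<open>\<Phi>\<close>, as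
  multiplication by it plus a derivation; both preserve the target ideal.\<close>

lemma phi_uea_ideal:
  assumes "t \<in> uea_ideal dbl"
  shows "\<Phi> t \<in> uea_ideal br"
proof (rule linear_image_uea_ideal[OF linear_phi subspace_uea_ideal assms])
  fix a c x y
  show "\<Phi> (word_prod a * lie_relator dbl x y * word_prod c) \<in> uea_ideal br"
    by (induction a)
      (simp_all add: mult.assoc phi_mult_in phi_relator subspace_add[OF subspace_uea_ideal]
        uea_ideal_mult_left uea_ideal_mult_right lie_relator_in_uea_ideal der_uea_ideal)
qed

text \<open>Removing a prefix letter \<open>z\<close> leaves a term with \<open>D z\<close>, which
  may hit the rest of the prefix, the relator or the suffix. This yields other prefixes of the same
  length, other relators and an arbitrary suffix, so the induction is on the prefix length with all
  else general.\<close>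

lemma psi_uea_ideal:
  assumes "t \<in> uea_ideal br"
  shows "\<Psi> t \<in> uea_ideal dbl"
proof (rule linear_image_uea_ideal[OF linear_psi subspace_uea_ideal assms])
  fix a c x y
  have "\<Psi> (word_prod a * lie_relator br x y * t) \<in> uea_ideal dbl" for t
  proof (induction "length a" arbitrary: a x y t)
    case 0
    then show ?case
      by (simp add: psi_relator uea_ideal_mult_right lie_relator_in_uea_ideal)
  next
    case (Suc n)
    then obtain z b where a: "a = z # b" "length b = n" by (cases a) auto
    have IH: "\<Psi> (word_prod b' * (lie_relator br x y * t)) \<in> uea_ideal dbl"
      if "length b' = n" for b' x y t
      using Suc.hyps(1)[of b' x y t] that by (simp add: mult.assoc)
    note sub = subspace_add[OF subspace_uea_ideal] subspace_diff[OF subspace_uea_ideal]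
      subspace_sum[OF subspace_uea_ideal]
    have "\<Psi> (D z (word_prod b) * (lie_relator br x y * t)) \<in> uea_ideal dbl"
      unfolding der_word sum_distrib_right linear_sum[OF linear_psi]
      by (intro sub IH) (simp add: a)
    then show ?case
      using a(2)
      by (simp add: a(1) mult.assoc psi_mult_in der_mult der_relator distrib_left distrib_right
          linear_add[OF linear_psi] sub IH uea_ideal_mult_left)
  qed
  then show "\<Psi> (word_prod a * lie_relator br x y * word_prod c) \<in> uea_ideal dbl" .
qed

text \<open>A relator of \<open>dbl\<close> acts as the commutator of \<open>D x\<close> and
  \<open>D y\<close> minus \<open>D (dbl x y)\<close>, which is zero. With
  \<open>psi_uea_ideal\<close> this makes the extended action well defined in its first
  argument.\<close>

lemma act_dbl:
  assumes "t \<in> uea_ideal dbl"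
  shows "\<rho> t w = 0"
proof -
  have "\<rho> t w \<in> {0}"
    by (rule linear_image_uea_ideal[OF linear_act_left subspace_single_0 assms])
      (simp add: act_act lie_relator_def linear_diff[OF linear_act_left] act_mult_in der_dbl
        linear_0[OF linear_act_right])
  then show ?thesis by simp
qed

lemma act_uea_ideal: "w \<in> uea_ideal br \<Longrightarrow> \<rho> a w \<in> uea_ideal br"
  by (induction a rule: tensor_algebra_induct)
    (simp_all add: act_mult_in act_add act_scale der_uea_ideal
      subspace_add[OF subspace_uea_ideal] subspace_scale[OF subspace_uea_ideal])

lemma ext_uea_ideal_left: "u \<in> uea_ideal br \<Longrightarrow> tensor_ext tr u w = 0"
  and ext_uea_ideal_right: "w \<in> uea_ideal br \<Longrightarrow> tensor_ext tr u w \<in> uea_ideal br"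
  by (simp_all add: tensor_ext_def act_dbl psi_uea_ideal act_uea_ideal)

lemma star_antipode_uea_ideal: "u \<in> uea_ideal br \<Longrightarrow> star_antipode u \<in> uea_ideal br"
  unfolding star_antipode_def by (intro phi_uea_ideal antipode_uea_ideal psi_uea_ideal)

end

section \<open>Modules with an injective linear map into a vector space type\<close>

text \<open>Through \<open>e\<close>, equations on a carrier become equations of vectors and
  \<open>finsum\<close> becomes an ordinary sum, so that \<open>free_lift\<close> and
  \<open>sweedler\<close> can be used to compute in \<open>A\<close>.\<close>

locale embedded_module =
  fixes A :: "(real, 'u, 'm) module_scheme" and e :: "'u \<Rightarrow> 'v::real_vector"
  assumes inj_e: "inj_on e (carrier A)"
    and zero_closed: "\<zero>\<^bsub>A\<^esub> \<in> carrier A" and e_zero: "e \<zero>\<^bsub>A\<^esub> = 0"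
    and add_closed: "u \<in> carrier A \<Longrightarrow> v \<in> carrier A \<Longrightarrow> u \<oplus>\<^bsub>A\<^esub> v \<in> carrier A"
    and e_add: "u \<in> carrier A \<Longrightarrow> v \<in> carrier A \<Longrightarrow> e (u \<oplus>\<^bsub>A\<^esub> v) = e u + e v"
    and smult_closed: "u \<in> carrier A \<Longrightarrow> c \<odot>\<^bsub>A\<^esub> u \<in> carrier A"
    and e_smult: "u \<in> carrier A \<Longrightarrow> e (c \<odot>\<^bsub>A\<^esub> u) = c *\<^sub>R e u"
begin

lemma eqI: "u \<in> carrier A \<Longrightarrow> v \<in> carrier A \<Longrightarrow> e u = e v \<Longrightarrow> u = v"
  using inj_e by (auto dest: inj_onD)

lemmas closed = zero_closed add_closed smult_closed
lemmas e_simps = e_zero e_add e_smult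

lemma abelian_group: "abelian_group A"
proof (rule abelian_groupI)
  fix u v w assume uvw: "u \<in> carrier A" "v \<in> carrier A" "w \<in> carrier A"
  show "u \<oplus>\<^bsub>A\<^esub> v \<oplus>\<^bsub>A\<^esub> w = u \<oplus>\<^bsub>A\<^esub> (v \<oplus>\<^bsub>A\<^esub> w)" "u \<oplus>\<^bsub>A\<^esub> v = v \<oplus>\<^bsub>A\<^esub> u"
    using uvw by (auto intro!: eqI simp: closed e_simps)
next
  fix u assume u: "u \<in> carrier A"
  show "\<zero>\<^bsub>A\<^esub> \<oplus>\<^bsub>A\<^esub> u = u" using u by (auto intro!: eqI simp: closed e_simps)
  show "\<exists>v\<in>carrier A. v \<oplus>\<^bsub>A\<^esub> u = \<zero>\<^bsub>A\<^esub>"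
    using u by (intro bexI[of _ "(-1) \<odot>\<^bsub>A\<^esub> u"]) (auto intro!: eqI simp: closed e_simps)
qed (auto simp: closed)

lemma module: "Module.module (type_algebra :: (real, real) module) A"
proof (rule moduleI[OF cring_type_algebra abelian_group])
qed (auto intro!: eqI simp: closed e_simps algebra_simps)

lemma e_finsum:
  assumes "finite S" "\<And>i. i \<in> S \<Longrightarrow> f i \<in> carrier A"
  shows "finsum A f S \<in> carrier A \<and> e (finsum A f S) = (\<Sum>i\<in>S. e (f i))"
proof -
  interpret abelian_group A by (rule abelian_group)
  show ?thesis using assms
  proof (induction S rule: finite_induct)
    case (insert i S)
    then show ?case by (simp add: finsum_insert Pi_iff e_add)
  qed (simp add: zero_closed e_zero)
qed

end


section \<open>Tensor products\<close>

lemma subspace_tens_relations: "subspace (tens_relations A B)"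
  unfolding tens_relations_def by (rule subspace_span)

lemma tens_class_eq_iff: "tens_class A B f = tens_class A B g \<longleftrightarrow> f - g \<in> tens_relations A B"
proof
  assume "tens_class A B f = tens_class A B g"
  moreover have "f \<in> tens_class A B f"
    by (simp add: tens_class_def subspace_0[OF subspace_tens_relations])
  ultimately show "f - g \<in> tens_relations A B" by (simp add: tens_class_def)
next
  assume fg: "f - g \<in> tens_relations A B"
  have "h - f \<in> tens_relations A B \<longleftrightarrow> h - g \<in> tens_relations A B" for h
    using subspace_add[OF subspace_tens_relations _ fg, of "h - f"]
      subspace_diff[OF subspace_tens_relations _ fg, of "h - g"] by auto
  then show "tens_class A B f = tens_class A B g" by (simp add: tens_class_def)
qed

lemma in_tens_class_iff: "g \<in> tens_class A B f \<longleftrightarrow> tens_class A B g = tens_class A B f"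
  by (simp add: tens_class_eq_iff) (simp add: tens_class_def)

text \<open>Representatives of a class differ by relations, which the projection kills. The choice
  is thus immaterial, and the value serves as a linear coordinate of the class.\<close>

definition tens_proj :: "(real, 'u, 'm) module_scheme \<Rightarrow> (real, 'v, 'n) module_scheme \<Rightarrow>
    ('u, 'v) tens \<Rightarrow> ('u \<times> 'v \<Rightarrow>\<^sub>0 real)" where
  "tens_proj A B t = proj_along (tens_relations A B) (SOME f. f \<in> t)"

lemma some_in_tens_class: "(SOME g. g \<in> tens_class A B f) \<in> tens_class A B f"
  by (rule someI[of _ f]) (simp add: in_tens_class_iff)

lemma tens_proj_class: "tens_proj A B (tens_class A B f) = proj_along (tens_relations A B) f"
  unfolding tens_proj_def proj_along_eq_iff[OF subspace_tens_relations]
  using some_in_tens_class[of A B f] by (simp add: tens_class_def)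

lemma tens_class_eq_proj:
  "tens_class A B f = tens_class A B g \<longleftrightarrow> proj_along (tens_relations A B) f = proj_along (tens_relations A B) g"
  by (simp add: tens_class_eq_iff proj_along_eq_iff[OF subspace_tens_relations])

lemmas proj_tens_add = linear_add[OF linear_proj_along[OF subspace_tens_relations]]
  and proj_tens_scale = linear_scale[OF linear_proj_along[OF subspace_tens_relations]]
  and proj_tens_0 = linear_0[OF linear_proj_along[OF subspace_tens_relations]]

text \<open>Operations on classes are unions over all representatives; such a union collapses once
  every representative gives the same set.\<close>

lemma UN_tens_class:
  assumes "\<And>g. tens_class A B g = tens_class A B f \<Longrightarrow> h g = h f"
  shows "(\<Union>g\<in>tens_class A B f. h g) = h f"
proof -
  have "(\<Union>g\<in>tens_class A B f. h g) = (\<Union>g\<in>tens_class A B f. h f)"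
    by (intro SUP_cong refl assms) (simp only: in_tens_class_iff)
  moreover have "f \<in> tens_class A B f" by (simp only: in_tens_class_iff)
  ultimately show ?thesis by blast
qed

lemma tensor_product_add: "tens_class A B f \<oplus>\<^bsub>tensor_product A B\<^esub> tens_class A B g = tens_class A B (f + g)"
proof -
  have "(\<Union>g'\<in>tens_class A B g. tens_class A B (f' + g')) = tens_class A B (f' + g)" for f'
    by (rule UN_tens_class) (simp add: tens_class_eq_proj proj_tens_add)
  moreover have "(\<Union>f'\<in>tens_class A B f. tens_class A B (f' + g)) = tens_class A B (f + g)"
    by (rule UN_tens_class[of A B f "\<lambda>f'. tens_class A B (f' + g)"]) (simp add: tens_class_eq_proj proj_tens_add)
  moreover have "s \<oplus>\<^bsub>tensor_product A B\<^esub> t = (\<Union>f\<in>s. \<Union>g\<in>t. tens_class A B (f + g))" for s t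
    by (simp only: tensor_product_def ring.select_convs)
  ultimately show ?thesis by simp
qed

lemma tensor_product_smult: "c \<odot>\<^bsub>tensor_product A B\<^esub> tens_class A B f = tens_class A B (c *\<^sub>R f)"
proof -
  have "(\<Union>f'\<in>tens_class A B f. tens_class A B (c *\<^sub>R f')) = tens_class A B (c *\<^sub>R f)"
    by (rule UN_tens_class) (simp add: tens_class_eq_proj proj_tens_scale)
  moreover have "c \<odot>\<^bsub>tensor_product A B\<^esub> t = (\<Union>f\<in>t. tens_class A B (c *\<^sub>R f))" for t
    by (simp only: tensor_product_def module.select_convs)
  ultimately show ?thesis by simp
qed

lemma tensor_product_zero: "\<zero>\<^bsub>tensor_product A B\<^esub> = tens_class A B 0"
  and tensor_product_one: "\<one>\<^bsub>tensor_product A B\<^esub> = pure_tens A B \<one>\<^bsub>A\<^esub> \<one>\<^bsub>B\<^esub>"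
  and tensor_product_carrier: "carrier (tensor_product A B) =
    tens_class A B ` {f. Poly_Mapping.keys f \<subseteq> carrier A \<times> carrier B}"
  by (simp_all add: tensor_product_def)

lemma tens_class_in_carrier:
  "Poly_Mapping.keys f \<subseteq> carrier A \<times> carrier B \<Longrightarrow> tens_class A B f \<in> carrier (tensor_product A B)"
  by (simp add: tensor_product_carrier)

lemma pure_tens_in_carrier:
  "u \<in> carrier A \<Longrightarrow> v \<in> carrier B \<Longrightarrow> pure_tens A B u v \<in> carrier (tensor_product A B)"
  unfolding pure_tens_def by (rule tens_class_in_carrier) simp

lemma embedded_tensor_product: "embedded_module (tensor_product A B) (tens_proj A B)"
proof
  show "inj_on (tens_proj A B) (carrier (tensor_product A B))"
  proof (rule inj_onI)
    fix s t assume "s \<in> carrier (tensor_product A B)" "t \<in> carrier (tensor_product A B)"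
      "tens_proj A B s = tens_proj A B t"
    moreover from this obtain f g where "s = tens_class A B f" "t = tens_class A B g"
      unfolding tensor_product_carrier by blast
    ultimately show "s = t" by (simp add: tens_class_eq_proj tens_proj_class)
  qed
  show "\<zero>\<^bsub>tensor_product A B\<^esub> \<in> carrier (tensor_product A B)"
    by (simp add: tensor_product_zero tens_class_in_carrier)
  show "tens_proj A B \<zero>\<^bsub>tensor_product A B\<^esub> = 0"
    by (simp add: tensor_product_zero tens_proj_class proj_tens_0)
  fix s t c assume "s \<in> carrier (tensor_product A B)"
  then obtain f where f: "s = tens_class A B f" "Poly_Mapping.keys f \<subseteq> carrier A \<times> carrier B"
    by (auto simp: tensor_product_carrier)
  have "Poly_Mapping.keys (c *\<^sub>R f) \<subseteq> carrier A \<times> carrier B"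
    using f(2) by (auto simp: in_keys_iff subset_iff)
  then show "c \<odot>\<^bsub>tensor_product A B\<^esub> s \<in> carrier (tensor_product A B)"
    by (simp add: f tensor_product_smult tens_class_in_carrier)
  show "tens_proj A B (c \<odot>\<^bsub>tensor_product A B\<^esub> s) = c *\<^sub>R tens_proj A B s"
    by (simp add: f tensor_product_smult tens_proj_class proj_tens_scale)
  assume "t \<in> carrier (tensor_product A B)"
  then obtain g where g: "t = tens_class A B g" "Poly_Mapping.keys g \<subseteq> carrier A \<times> carrier B"
    by (auto simp: tensor_product_carrier)
  have "Poly_Mapping.keys (f + g) \<subseteq> carrier A \<times> carrier B"
    using f(2) g(2) keys_add[of f g] by blast
  then show "s \<oplus>\<^bsub>tensor_product A B\<^esub> t \<in> carrier (tensor_product A B)"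
    by (simp add: f g tensor_product_add tens_class_in_carrier)
  show "tens_proj A B (s \<oplus>\<^bsub>tensor_product A B\<^esub> t) = tens_proj A B s + tens_proj A B t"
    by (simp add: f g tensor_product_add tens_proj_class proj_tens_add)
qed

section \<open>Bilinear maps and the maps they induce on tensor products\<close>

definition tens_bilinear :: "(real, 'u, 'm) module_scheme \<Rightarrow> (real, 'v, 'n) module_scheme \<Rightarrow>
    ('u \<Rightarrow> 'v \<Rightarrow> 'w::real_vector) \<Rightarrow> bool" where
  "tens_bilinear A B \<beta> \<longleftrightarrow>
     (\<forall>u\<in>carrier A. \<forall>u'\<in>carrier A. \<forall>v\<in>carrier B. \<beta> (u \<oplus>\<^bsub>A\<^esub> u') v = \<beta> u v + \<beta> u' v) \<and>
     (\<forall>u\<in>carrier A. \<forall>v\<in>carrier B. \<forall>v'\<in>carrier B. \<beta> u (v \<oplus>\<^bsub>B\<^esub> v') = \<beta> u v + \<beta> u v') \<and>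
     (\<forall>c. \<forall>u\<in>carrier A. \<forall>v\<in>carrier B. \<beta> (c \<odot>\<^bsub>A\<^esub> u) v = c *\<^sub>R \<beta> u v) \<and>
     (\<forall>c. \<forall>u\<in>carrier A. \<forall>v\<in>carrier B. \<beta> u (c \<odot>\<^bsub>B\<^esub> v) = c *\<^sub>R \<beta> u v)"

lemma free_lift_tens_relations:
  assumes "tens_bilinear A B \<beta>" "r \<in> tens_relations A B"
  shows "free_lift (\<lambda>(u, v). \<beta> u v) r = 0"
  using assms(2) unfolding tens_relations_def
  by (rule free_lift_vanishes)
    (use assms(1) in \<open>auto simp: tens_bilinear_def free_lift_diff free_lift_scale simp del: scaleR_single\<close>)

lemma free_lift_tens_class_eq:
  assumes "tens_bilinear A B \<beta>" "tens_class A B f = tens_class A B g"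
  shows "free_lift (\<lambda>(u, v). \<beta> u v) f = free_lift (\<lambda>(u, v). \<beta> u v) g"
proof -
  have "f - g \<in> tens_relations A B" using assms(2) by (simp add: tens_class_eq_iff)
  from free_lift_tens_relations[OF assms(1) this] show ?thesis by (simp add: free_lift_diff)
qed

text \<open>The projection may move the support outside the carriers, but it changes
  \<open>f\<close> only by a relation, which a bilinear \<open>\<beta>\<close> kills.\<close>

lemma free_lift_tens_proj:
  assumes "tens_bilinear A B \<beta>"
  shows "free_lift (\<lambda>(u, v). \<beta> u v) (tens_proj A B (tens_class A B f)) = free_lift (\<lambda>(u, v). \<beta> u v) f"
  by (rule free_lift_tens_class_eq[OF assms])
    (simp add: tens_class_eq_proj tens_proj_class proj_along_idem[OF subspace_tens_relations])

lemma free_lift_tens_proj_pure: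
  "tens_bilinear A B \<beta> \<Longrightarrow> free_lift (\<lambda>(u, v). \<beta> u v) (tens_proj A B (pure_tens A B u v)) = \<beta> u v"
  by (simp add: pure_tens_def free_lift_tens_proj)

lemma pure_tens_bilinear:
  "u \<in> carrier A \<Longrightarrow> u' \<in> carrier A \<Longrightarrow> v \<in> carrier B \<Longrightarrow>
    pure_tens A B (u \<oplus>\<^bsub>A\<^esub> u') v = pure_tens A B u v \<oplus>\<^bsub>tensor_product A B\<^esub> pure_tens A B u' v"
  "u \<in> carrier A \<Longrightarrow> v \<in> carrier B \<Longrightarrow> v' \<in> carrier B \<Longrightarrow>
    pure_tens A B u (v \<oplus>\<^bsub>B\<^esub> v') = pure_tens A B u v \<oplus>\<^bsub>tensor_product A B\<^esub> pure_tens A B u v'"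
  "u \<in> carrier A \<Longrightarrow> v \<in> carrier B \<Longrightarrow>
    pure_tens A B (c \<odot>\<^bsub>A\<^esub> u) v = c \<odot>\<^bsub>tensor_product A B\<^esub> pure_tens A B u v"
  "u \<in> carrier A \<Longrightarrow> v \<in> carrier B \<Longrightarrow>
    pure_tens A B u (c \<odot>\<^bsub>B\<^esub> v) = c \<odot>\<^bsub>tensor_product A B\<^esub> pure_tens A B u v"
proof -
  assume u: "u \<in> carrier A" and v: "v \<in> carrier B"
  have "basis (c \<odot>\<^bsub>A\<^esub> u, v) - c *\<^sub>R basis (u, v) \<in> tens_relations A B"
    unfolding tens_relations_def by (rule span_base) (use u v in blast)
  then show "pure_tens A B (c \<odot>\<^bsub>A\<^esub> u) v = c \<odot>\<^bsub>tensor_product A B\<^esub> pure_tens A B u v"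
    by (simp add: pure_tens_def tensor_product_smult tens_class_eq_iff)
  have "basis (u, c \<odot>\<^bsub>B\<^esub> v) - c *\<^sub>R basis (u, v) \<in> tens_relations A B"
    unfolding tens_relations_def by (rule span_base) (use u v in blast)
  then show "pure_tens A B u (c \<odot>\<^bsub>B\<^esub> v) = c \<odot>\<^bsub>tensor_product A B\<^esub> pure_tens A B u v"
    by (simp add: pure_tens_def tensor_product_smult tens_class_eq_iff)
  {
    assume "u' \<in> carrier A"
    then have "basis (u \<oplus>\<^bsub>A\<^esub> u', v) - basis (u, v) - basis (u', v) \<in> tens_relations A B"
      unfolding tens_relations_def by (intro span_base) (use u v in blast)
    then show "pure_tens A B (u \<oplus>\<^bsub>A\<^esub> u') v = pure_tens A B u v \<oplus>\<^bsub>tensor_product A B\<^esub> pure_tens A B u' v"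
      by (simp add: pure_tens_def tensor_product_add tens_class_eq_iff diff_diff_eq)
  }
  {
    assume "v' \<in> carrier B"
    then have "basis (u, v \<oplus>\<^bsub>B\<^esub> v') - basis (u, v) - basis (u, v') \<in> tens_relations A B"
      unfolding tens_relations_def by (intro span_base) (use u v in blast)
    then show "pure_tens A B u (v \<oplus>\<^bsub>B\<^esub> v') = pure_tens A B u v \<oplus>\<^bsub>tensor_product A B\<^esub> pure_tens A B u v'"
      by (simp add: pure_tens_def tensor_product_add tens_class_eq_iff diff_diff_eq)
  }
qed

text \<open>Relations involve only pairs from the carriers, which are closed under the operations.
  Hence every representative of a class in the tensor product, including the one chosen by
  \<open>tens_lift\<close>, is supported there.\<close>

lemma keys_tens_relations:
  fixes A :: "(real, 'u, 'm) module_scheme" and B :: "(real, 'w, 'n) module_scheme"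
  assumes "embedded_module A eA" "embedded_module B eB" "r \<in> tens_relations A B"
  shows "Poly_Mapping.keys r \<subseteq> carrier A \<times> carrier B"
proof -
  interpret A: embedded_module A eA by fact
  interpret B: embedded_module B eB by fact
  define C where "C = {r :: ('u \<times> 'w \<Rightarrow>\<^sub>0 real). Poly_Mapping.keys r \<subseteq> carrier A \<times> carrier B}"
  have sub: "subspace C" unfolding C_def by (rule subspace_keys)
  have basis: "basis (u, v) \<in> C" if "u \<in> carrier A" "v \<in> carrier B" for u v
    using that by (simp add: C_def)
  have "tens_relations A B \<subseteq> C"
    unfolding tens_relations_def
    by (rule span_minimal[OF _ sub])
      (auto intro!: subspace_diff[OF sub] subspace_scale[OF sub] basis simp: A.closed B.closed
        simp del: scaleR_single)
  then show ?thesis using assms(3) by (auto simp: C_def)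
qed

text \<open>The chosen representative is supported in the carriers. Under \<open>e\<close> its
  \<open>finsum\<close> becomes a \<open>free_lift\<close>, whose value does not depend on the
  representative by bilinearity.\<close>

lemma
  assumes "embedded_module A eA" "embedded_module B eB" "embedded_module P e"
    and "\<And>u v. u \<in> carrier A \<Longrightarrow> v \<in> carrier B \<Longrightarrow> b u v \<in> carrier P"
    and "tens_bilinear A B (\<lambda>u v. e (b u v))" "t \<in> carrier (tensor_product A B)"
  shows tens_lift_closed: "tens_lift P b t \<in> carrier P"
    and e_tens_lift: "e (tens_lift P b t) = free_lift (\<lambda>(u, v). e (b u v)) (tens_proj A B t)"
proof -
  interpret P: embedded_module P e by fact
  obtain f0 where f0: "t = tens_class A B f0" "Poly_Mapping.keys f0 \<subseteq> carrier A \<times> carrier B"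
    using assms(6) by (auto simp: tensor_product_carrier)
  define f where "f = (SOME f. f \<in> t)"
  have f: "tens_class A B f = t"
    using some_in_tens_class[of A B f0] unfolding f0(1) f_def in_tens_class_iff .
  have "f - f0 \<in> tens_relations A B" using f by (simp add: f0 tens_class_eq_iff)
  from keys_tens_relations[OF assms(1,2) this] have "Poly_Mapping.keys ((f - f0) + f0) \<subseteq> carrier A \<times> carrier B"
    using keys_add[of "f - f0" f0] f0(2) by blast
  then have keys: "Poly_Mapping.keys f \<subseteq> carrier A \<times> carrier B" by simp
  have "(\<lambda>(u, v). Poly_Mapping.lookup f (u, v) \<odot>\<^bsub>P\<^esub> b u v) k \<in> carrier P" if "k \<in> Poly_Mapping.keys f" for k
    using that keys assms(4) by (auto simp: P.closed split: prod.split)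
  from P.e_finsum[OF finite_keys this]
  have "tens_lift P b t \<in> carrier P \<and> e (tens_lift P b t) =
      (\<Sum>k\<in>Poly_Mapping.keys f. e ((\<lambda>(u, v). Poly_Mapping.lookup f (u, v) \<odot>\<^bsub>P\<^esub> b u v) k))"
    by (simp add: tens_lift_def f_def[symmetric] Let_def)
  moreover have "(\<Sum>k\<in>Poly_Mapping.keys f. e ((\<lambda>(u, v). Poly_Mapping.lookup f (u, v) \<odot>\<^bsub>P\<^esub> b u v) k)) =
      free_lift (\<lambda>(u, v). e (b u v)) f"
    unfolding free_lift_def using keys assms(4)
    by (intro sum.cong refl) (auto simp: P.e_simps split: prod.split)
  ultimately show "tens_lift P b t \<in> carrier P"
    "e (tens_lift P b t) = free_lift (\<lambda>(u, v). e (b u v)) (tens_proj A B t)"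
    using free_lift_tens_proj[OF assms(5), of f] by (simp_all add: f)
qed

text \<open>A linear function on the tensor product is determined by pure tensors. The element is
  assembled from them by adding one pair of the support at a time.\<close>

lemma tens_linear_eq_free_lift:
  assumes "\<And>s t. s \<in> carrier (tensor_product A B) \<Longrightarrow> t \<in> carrier (tensor_product A B) \<Longrightarrow>
      \<gamma> (s \<oplus>\<^bsub>tensor_product A B\<^esub> t) = \<gamma> s + \<gamma> t"
    and "\<And>c t. t \<in> carrier (tensor_product A B) \<Longrightarrow> \<gamma> (c \<odot>\<^bsub>tensor_product A B\<^esub> t) = c *\<^sub>R \<gamma> t"
    and "t \<in> carrier (tensor_product A B)"
  shows "\<gamma> t = free_lift (\<lambda>(u, v). \<gamma> (pure_tens A B u v)) (tens_proj A B t)"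
proof -
  obtain f where f: "t = tens_class A B f" "Poly_Mapping.keys f \<subseteq> carrier A \<times> carrier B"
    using assms(3) by (auto simp: tensor_product_carrier)
  have bil: "tens_bilinear A B (\<lambda>u v. \<gamma> (pure_tens A B u v))"
    unfolding tens_bilinear_def
    by (simp add: pure_tens_bilinear assms(1,2) pure_tens_in_carrier)
  let ?g = "\<lambda>S. \<Sum>k\<in>S. Poly_Mapping.lookup f k *\<^sub>R basis k"
  have g: "Poly_Mapping.keys (c *\<^sub>R basis k) \<subseteq> carrier A \<times> carrier B"
    if "k \<in> carrier A \<times> carrier B" for c k using that by auto
  interpret T: embedded_module "tensor_product A B" "tens_proj A B" by (rule embedded_tensor_product)
  have "tens_class A B (?g S) \<in> carrier (tensor_product A B) \<and>
      \<gamma> (tens_class A B (?g S)) = (\<Sum>k\<in>S. Poly_Mapping.lookup f k *\<^sub>R (case k of (u, v) \<Rightarrow> \<gamma> (pure_tens A B u v)))"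
    if "finite S" "S \<subseteq> carrier A \<times> carrier B" for S
    using that
  proof (induction S rule: finite_induct)
    case empty
    have "\<gamma> (0 \<odot>\<^bsub>tensor_product A B\<^esub> \<zero>\<^bsub>tensor_product A B\<^esub>) = 0"
      by (simp add: assms(2) T.closed)
    then show ?case
      using T.zero_closed by (simp add: tensor_product_smult tensor_product_zero)
  next
    case (insert k S)
    obtain u v where k: "k = (u, v)" by (cases k)
    have "tens_class A B (?g (insert k S)) = (Poly_Mapping.lookup f k \<odot>\<^bsub>tensor_product A B\<^esub> pure_tens A B u v)
        \<oplus>\<^bsub>tensor_product A B\<^esub> tens_class A B (?g S)"
      using insert.hyps by (simp add: k pure_tens_def tensor_product_add tensor_product_smult del: scaleR_single)
    then show ?case using insert
      by (simp add: k assms(1,2) T.closed pure_tens_in_carrier)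
  qed
  from this[OF finite_keys f(2)] have "\<gamma> t = free_lift (\<lambda>(u, v). \<gamma> (pure_tens A B u v)) f"
    by (simp add: f(1) free_lift_def flip: basis_sum_keys del: scaleR_single)
  then show ?thesis by (simp add: f(1) free_lift_tens_proj[OF bil])
qed

section \<open>Quotients of the tensor algebra\<close>

text \<open>The coproduct of the class of \<open>u\<close>, as yet a function of the representative
  \<open>u\<close> and not of \<open>q u\<close>.\<close>

definition tens_cop :: "(real, 'u, 'm) module_scheme \<Rightarrow> ('a::real_vector tensor_algebra \<Rightarrow> 'u) \<Rightarrow>
    'a tensor_algebra \<Rightarrow> ('u, 'u) tens" where
  "tens_cop A q u = tens_class A A (free_lift (\<lambda>(a, b). basis (q a, q b)) (tensor_cop u))"

text \<open>\<open>q\<close> is the quotient map and \<open>N\<close> its kernel. The abstraction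
  treats at once the enveloping algebra, its concatenation structure and its star structure, which
  share the carrier but not the record or the product.\<close>

locale tensor_quotient =
  fixes A :: "(real, 'u, 'm) module_scheme" and q :: "'a::real_vector tensor_algebra \<Rightarrow> 'u"
    and N :: "'a tensor_algebra set"
  assumes subspace_N: "subspace N"
    and q_eq_iff: "q s = q t \<longleftrightarrow> s - t \<in> N"
    and carrier_eq: "carrier A = range q"
    and zero_eq: "\<zero>\<^bsub>A\<^esub> = q 0"
    and q_add: "q s \<oplus>\<^bsub>A\<^esub> q t = q (s + t)"
    and q_smult: "c \<odot>\<^bsub>A\<^esub> q s = q (c *\<^sub>R s)"
begin

lemma q_closed [simp]: "q s \<in> carrier A"
  by (simp add: carrier_eq)

lemma carrierE:
  assumes "u \<in> carrier A"
  obtains s where "u = q s"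
  using assms by (auto simp: carrier_eq)

definition q_lift :: "('a tensor_algebra \<Rightarrow> 'w) \<Rightarrow> 'u \<Rightarrow> 'w" where
  "q_lift f u = f (SOME s. q s = u)"

lemma q_lift_q:
  assumes "\<And>s t. s - t \<in> N \<Longrightarrow> f s = f t"
  shows "q_lift f (q s) = f s"
proof -
  have "q (SOME t. q t = q s) = q s" by (rule someI) (rule refl)
  then show ?thesis unfolding q_lift_def by (intro assms) (simp add: q_eq_iff)
qed

definition q_proj :: "'u \<Rightarrow> 'a tensor_algebra" where
  "q_proj = q_lift (proj_along N)"

lemma q_proj_q: "q_proj (q s) = proj_along N s"
  unfolding q_proj_def by (rule q_lift_q) (simp add: proj_along_eq_iff[OF subspace_N])

lemma embedded: "embedded_module A q_proj"
proof
  show "inj_on q_proj (carrier A)"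
    by (rule inj_onI) (auto simp: carrier_eq q_proj_q q_eq_iff proj_along_eq_iff[OF subspace_N])
qed (auto simp: carrier_eq zero_eq q_add q_smult q_proj_q linear_0[OF linear_proj_along[OF subspace_N]]
    linear_add[OF linear_proj_along[OF subspace_N]] linear_scale[OF linear_proj_along[OF subspace_N]])

lemma tens_bilinear_iff: "tens_bilinear A A \<beta> \<longleftrightarrow> bilinear (\<lambda>x y. \<beta> (q x) (q y))"
proof
  assume "tens_bilinear A A \<beta>"
  then show "bilinear (\<lambda>x y. \<beta> (q x) (q y))"
    by (intro bilinearI linearI) (auto simp: tens_bilinear_def carrier_eq simp flip: q_add q_smult)
next
  assume b: "bilinear (\<lambda>x y. \<beta> (q x) (q y))"
  then have "\<beta> (q (x + x')) (q y) = \<beta> (q x) (q y) + \<beta> (q x') (q y)"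
    "\<beta> (q x) (q (y + y')) = \<beta> (q x) (q y) + \<beta> (q x) (q y')"
    "\<beta> (q (c *\<^sub>R x)) (q y) = c *\<^sub>R \<beta> (q x) (q y)" "\<beta> (q x) (q (c *\<^sub>R y)) = c *\<^sub>R \<beta> (q x) (q y)"
    for x x' y y' c
    using bilinear_ladd[OF b] bilinear_radd[OF b] bilinear_lmul[OF b] bilinear_rmul[OF b] by auto
  then show "tens_bilinear A A \<beta>"
    by (auto simp: tens_bilinear_def carrier_eq q_add q_smult)
qed

lemma tens_cop_closed: "tens_cop A q u \<in> carrier (tensor_product A A)"
  unfolding tens_cop_def by (intro tens_class_in_carrier keys_free_lift) (auto split: prod.splits)

lemma free_lift_tens_cop:
  assumes "bilinear (\<lambda>x y. \<beta> (q x) (q y))"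
  shows "free_lift (\<lambda>(u, v). \<beta> u v) (tens_proj A A (tens_cop A q u)) = sweedler (\<lambda>x y. \<beta> (q x) (q y)) u"
proof -
  have "tens_bilinear A A \<beta>" using assms by (simp only: tens_bilinear_iff)
  from free_lift_tens_proj[OF this] show ?thesis
    by (simp add: tens_cop_def sweedler_def linear_free_lift_comp[OF linear_free_lift])
      (simp add: case_prod_unfold)
qed

lemma tens_proj_tens_cop:
  "tens_proj A A (tens_cop A q u) = sweedler (\<lambda>x y. tens_proj A A (pure_tens A A (q x) (q y))) u"
  by (simp add: tens_cop_def tens_proj_class pure_tens_def sweedler_def case_prod_unfold
      linear_free_lift_comp[OF linear_proj_along[OF subspace_tens_relations]])

lemma bilinear_pure_tens: "bilinear (\<lambda>x y. tens_proj A A (pure_tens A A (q x) (q y)))"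
proof -
  interpret T: embedded_module "tensor_product A A" "tens_proj A A" by (rule embedded_tensor_product)
  have "tens_bilinear A A (\<lambda>u v. tens_proj A A (pure_tens A A u v))"
    by (simp add: tens_bilinear_def pure_tens_bilinear pure_tens_in_carrier T.e_simps)
  then show ?thesis by (simp only: tens_bilinear_iff)
qed

lemma tens_proj_eqI:
  "s \<in> carrier (tensor_product A A) \<Longrightarrow> t \<in> carrier (tensor_product A A) \<Longrightarrow>
    tens_proj A A s = tens_proj A A t \<Longrightarrow> s = t"
  using embedded_module.eqI[OF embedded_tensor_product] .

lemma tens_cop_eqI:
  assumes "t \<in> carrier (tensor_product A A)"
    "tens_proj A A t = sweedler (\<lambda>x y. tens_proj A A (pure_tens A A (q x) (q y))) u"
  shows "t = tens_cop A q u"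
  using assms tens_cop_closed by (intro tens_proj_eqI) (simp_all add: tens_proj_tens_cop)

text \<open>The bridge from Sweedler sums of the definitions, \<open>tens_lift\<close> of a
  coproduct, to \<open>sweedler\<close> on T.\<close>

lemma
  assumes "embedded_module P e" "\<And>x y. b (q x) (q y) \<in> carrier P" "bilinear (\<lambda>x y. e (b (q x) (q y)))"
  shows tens_lift_tens_cop_closed: "tens_lift P b (tens_cop A q u) \<in> carrier P"
    and e_tens_lift_tens_cop: "e (tens_lift P b (tens_cop A q u)) = sweedler (\<lambda>x y. e (b (q x) (q y))) u"
proof -
  have b: "tens_bilinear A A (\<lambda>u v. e (b u v))" using assms(3) by (simp only: tens_bilinear_iff)
  have c: "b u v \<in> carrier P" if "u \<in> carrier A" "v \<in> carrier A" for u v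
    using that assms(2) by (auto simp: carrier_eq)
  show "tens_lift P b (tens_cop A q u) \<in> carrier P"
    by (rule tens_lift_closed[OF embedded embedded assms(1) c b tens_cop_closed])
  show "e (tens_lift P b (tens_cop A q u)) = sweedler (\<lambda>x y. e (b (q x) (q y))) u"
    using e_tens_lift[OF embedded embedded assms(1) c b tens_cop_closed, of u] free_lift_tens_cop[OF assms(3)]
    by simp
qed

lemma tens_lift_tens_cop_q:
  assumes "\<And>x y. b (q x) (q y) = q (B x y)" "bilinear B"
  shows "tens_lift A b (tens_cop A q u) = q (sweedler B u)"
proof -
  have l: "linear (proj_along N)" by (rule linear_proj_along[OF subspace_N])
  have bil: "bilinear (\<lambda>x y. q_proj (b (q x) (q y)))"
    unfolding assms(1) q_proj_q
    by (intro bilinearI linear_comp[OF l] linear_bilinear_left[OF assms(2)] linear_bilinear_right[OF assms(2)] linear_ident)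
  have "b (q x) (q y) \<in> carrier A" for x y by (simp add: assms(1))
  note * = tens_lift_tens_cop_closed[OF embedded this bil] e_tens_lift_tens_cop[OF embedded this bil]
  show ?thesis
    by (rule embedded_module.eqI[OF embedded])
      (simp_all add: * assms(1) q_proj_q sweedler_comp[OF l])
qed

lemma linear_map_iff:
  "linear_map A P f \<longleftrightarrow> (\<forall>x. f (q x) \<in> carrier P) \<and>
     (\<forall>x y. f (q (x + y)) = f (q x) \<oplus>\<^bsub>P\<^esub> f (q y)) \<and> (\<forall>c x. f (q (c *\<^sub>R x)) = c \<odot>\<^bsub>P\<^esub> f (q x))"
  by (auto simp: linear_map_def carrier_eq q_add q_smult Pi_iff)

lemma tens_cop_add: "tens_cop A q (u + v) = tens_cop A q u \<oplus>\<^bsub>tensor_product A A\<^esub> tens_cop A q v"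
  and tens_cop_scale: "tens_cop A q (c *\<^sub>R u) = c \<odot>\<^bsub>tensor_product A A\<^esub> tens_cop A q u"
proof -
  interpret T: embedded_module "tensor_product A A" "tens_proj A A" by (rule embedded_tensor_product)
  note lin = linear_sweedler[OF bilinear_pure_tens]
  show "tens_cop A q (u + v) = tens_cop A q u \<oplus>\<^bsub>tensor_product A A\<^esub> tens_cop A q v"
    by (rule tens_cop_eqI[symmetric])
      (simp_all add: T.closed T.e_simps tens_cop_closed tens_proj_tens_cop linear_add[OF lin])
  show "tens_cop A q (c *\<^sub>R u) = c \<odot>\<^bsub>tensor_product A A\<^esub> tens_cop A q u"
    by (rule tens_cop_eqI[symmetric])
      (simp_all add: T.closed T.e_simps tens_cop_closed tens_proj_tens_cop linear_scale[OF lin])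
qed

lemma tens_cop_1: "tens_cop A q 1 = pure_tens A A (q 1) (q 1)"
  by (rule tens_cop_eqI[symmetric]) (simp_all add: pure_tens_in_carrier bilinear_pure_tens)

lemma tens_cop_in:
  "tens_cop A q (tensor_in x) =
    pure_tens A A (q (tensor_in x)) (q 1) \<oplus>\<^bsub>tensor_product A A\<^esub> pure_tens A A (q 1) (q (tensor_in x))"
proof -
  interpret T: embedded_module "tensor_product A A" "tens_proj A A" by (rule embedded_tensor_product)
  show ?thesis
    by (rule tens_cop_eqI[symmetric])
      (simp_all add: pure_tens_in_carrier T.closed T.e_simps bilinear_pure_tens sweedler_in)
qed

end

text \<open>\<open>m\<close> is the product on representatives; concatenation and the star product
  are the two instances. \<open>sweedler_m\<close> has the value type of \<open>tens_proj\<close>,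
  in which multiplicativity of the coproduct is tested.\<close>

locale tensor_quotient_algebra = tensor_quotient A q N
  for A :: "(real, 'u, 'm) module_scheme" and q :: "'a::real_vector tensor_algebra \<Rightarrow> 'u" and N +
  fixes m :: "'a tensor_algebra \<Rightarrow> 'a tensor_algebra \<Rightarrow> 'a tensor_algebra"
  assumes one_eq: "\<one>\<^bsub>A\<^esub> = q 1"
    and q_mult: "q s \<otimes>\<^bsub>A\<^esub> q t = q (m s t)"
    and bilinear_m: "bilinear m"
    and m_assoc: "m (m s t) u = m s (m t u)"
    and m_1: "m 1 s = s" "m s 1 = s"
    and sweedler_m: "\<And>b :: 'a tensor_algebra \<Rightarrow> 'a tensor_algebra \<Rightarrow> ('u \<times> 'u \<Rightarrow>\<^sub>0 real).
      bilinear b \<Longrightarrow> sweedler b (m s t) = sweedler (\<lambda>u1 u2. sweedler (\<lambda>v1 v2. b (m u1 v1) (m u2 v2)) t) s"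
    and counit_m: "tensor_counit (m s t) = tensor_counit s * tensor_counit t"
begin

lemma unital_algebra: "unital_algebra A"
proof -
  interpret embedded_module A q_proj by (rule embedded)
  have "Group.monoid A"
    by (rule monoidI) (auto simp: carrier_eq one_eq q_mult m_assoc m_1)
  then have "ring A"
    by (intro ringI abelian_group)
      (auto simp: carrier_eq q_mult q_add bilinear_ladd[OF bilinear_m] bilinear_radd[OF bilinear_m])
  then show ?thesis
    using module
    by (auto simp: unital_algebra_def carrier_eq q_mult q_smult bilinear_lmul[OF bilinear_m]
        bilinear_rmul[OF bilinear_m])
qed

text \<open>All representatives of both factors must give the same class. Bilinearity in one pair is
  available only while the other pair lies in the carriers, hence the control of supports.\<close>

lemma tensor_mult:
  assumes "Poly_Mapping.keys F \<subseteq> carrier A \<times> carrier A" "Poly_Mapping.keys G \<subseteq> carrier A \<times> carrier A"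
  shows "tens_class A A F \<otimes>\<^bsub>tensor_product A A\<^esub> tens_class A A G = tens_class A A
    (free_lift (\<lambda>(u, v). free_lift (\<lambda>(u', v'). basis (u \<otimes>\<^bsub>A\<^esub> u', v \<otimes>\<^bsub>A\<^esub> v')) G) F)"
proof -
  let ?M = "\<lambda>f g. free_lift (\<lambda>(u, v). free_lift (\<lambda>(u', v'). basis (u \<otimes>\<^bsub>A\<^esub> u', v \<otimes>\<^bsub>A\<^esub> v')) g) f"
  let ?p = "proj_along (tens_relations A A)"
  let ?\<beta> = "\<lambda>u v u' v'. ?p (basis (u \<otimes>\<^bsub>A\<^esub> u', v \<otimes>\<^bsub>A\<^esub> v'))"
  have p: "linear ?p" by (rule linear_proj_along[OF subspace_tens_relations])
  have pM: "?p (?M f g) = free_lift (\<lambda>(u, v). free_lift (\<lambda>(u', v'). ?\<beta> u v u' v') g) f" for f g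
    by (simp add: linear_free_lift_comp[OF p] case_prod_unfold)
  have basis: "?p (basis (u, v)) = tens_proj A A (pure_tens A A u v)" for u v
    by (simp add: pure_tens_def tens_proj_class)
  have \<beta>2: "tens_bilinear A A (\<lambda>u' v'. ?\<beta> u v u' v')" if "u \<in> carrier A" "v \<in> carrier A" for u v
  proof -
    from that obtain x y where "u = q x" "v = q y" by (auto simp: carrier_eq)
    moreover have "bilinear (\<lambda>x' y'. tens_proj A A (pure_tens A A (q (m x x')) (q (m y y'))))"
      by (rule bilinear_comp[OF bilinear_pure_tens]; intro linear_bilinear_right[OF bilinear_m] linear_ident)
    ultimately show ?thesis by (simp add: basis tens_bilinear_iff q_mult)
  qed
  have \<beta>1: "tens_bilinear A A (\<lambda>u v. ?\<beta> u v u' v')" if "u' \<in> carrier A" "v' \<in> carrier A" for u' v'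
  proof -
    from that obtain x y where "u' = q x" "v' = q y" by (auto simp: carrier_eq)
    moreover have "bilinear (\<lambda>x' y'. tens_proj A A (pure_tens A A (q (m x' x)) (q (m y' y))))"
      by (rule bilinear_comp[OF bilinear_pure_tens]; intro linear_bilinear_left[OF bilinear_m] linear_ident)
    ultimately show ?thesis by (simp add: basis tens_bilinear_iff q_mult)
  qed
  \<comment> \<open>Exchanging the sums moves the left representative inside, so that it can be
    varied in the same way as the right one.\<close>
  have swap: "free_lift (\<lambda>(u, v). free_lift (\<lambda>(u', v'). ?\<beta> u v u' v') g) f =
      free_lift (\<lambda>(u', v'). free_lift (\<lambda>(u, v). ?\<beta> u v u' v') f) g" for f g
    unfolding free_lift_def case_prod_unfold scaleR_sum_right
    by (subst sum.swap) (simp add: mult.commute)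
  have keys: "Poly_Mapping.keys f \<subseteq> carrier A \<times> carrier A"
    if "tens_class A A f = tens_class A A f0" "Poly_Mapping.keys f0 \<subseteq> carrier A \<times> carrier A" for f f0
  proof -
    have "f - f0 \<in> tens_relations A A" using that(1) by (simp add: tens_class_eq_iff)
    from keys_tens_relations[OF embedded embedded this] show ?thesis
      using keys_add[of "f - f0" f0] that(2) by auto
  qed
  \<comment> \<open>The right representative is replaced first; the left one follows in
    \<open>2\<close>, with the right one already fixed at \<open>G\<close>.\<close>
  have 1: "?p (?M f g) = ?p (?M f G)"
    if "tens_class A A g = tens_class A A G" "Poly_Mapping.keys f \<subseteq> carrier A \<times> carrier A" for f g
    unfolding pM
    by (rule free_lift_cong) (use that(2) in \<open>auto intro!: free_lift_tens_class_eq[OF \<beta>2 that(1)]\<close>)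
  have 2: "?p (?M f G) = ?p (?M F G)" if "tens_class A A f = tens_class A A F" for f
    unfolding pM swap
    by (rule free_lift_cong) (use assms(2) in \<open>auto intro!: free_lift_tens_class_eq[OF \<beta>1 that]\<close>)
  have 3: "tens_class A A (?M f g) = tens_class A A (?M F G)"
    if "f \<in> tens_class A A F" "g \<in> tens_class A A G" for f g
    using that 1[of g f] 2[of f] keys[OF _ assms(1), of f]
    by (simp add: in_tens_class_iff tens_class_eq_proj[of A A "?M f g"])
  have "tens_class A A F \<otimes>\<^bsub>tensor_product A A\<^esub> tens_class A A G =
      (\<Union>f\<in>tens_class A A F. \<Union>g\<in>tens_class A A G. tens_class A A (?M f g))"
    unfolding free_lift_def
    by (simp add: tensor_product_def case_prod_unfold scaleR_sum_right)
  also have "\<dots> = (\<Union>f\<in>tens_class A A F. \<Union>g\<in>tens_class A A G. tens_class A A (?M F G))"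
    by (intro SUP_cong refl 3)
  also have "\<dots> = tens_class A A (?M F G)"
    using in_tens_class_iff[of F A A F] in_tens_class_iff[of G A A G] by blast
  finally show ?thesis .
qed

lemma tens_cop_mult: "tens_cop A q u \<otimes>\<^bsub>tensor_product A A\<^esub> tens_cop A q v = tens_cop A q (m u v)"
proof (rule tens_cop_eqI)
  let ?F = "\<lambda>u. free_lift (\<lambda>(a, b). basis (q a, q b)) (tensor_cop u)"
  have keys: "Poly_Mapping.keys (?F u) \<subseteq> carrier A \<times> carrier A" for u
    by (intro keys_free_lift) (auto split: prod.splits)
  let ?M = "free_lift (\<lambda>(a, b). free_lift (\<lambda>(a', b'). basis (a \<otimes>\<^bsub>A\<^esub> a', b \<otimes>\<^bsub>A\<^esub> b')) (?F v)) (?F u)"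
  have eq: "tens_cop A q u \<otimes>\<^bsub>tensor_product A A\<^esub> tens_cop A q v = tens_class A A ?M"
    unfolding tens_cop_def by (rule tensor_mult[OF keys keys])
  have "Poly_Mapping.keys ?M \<subseteq> carrier A \<times> carrier A"
  proof (intro keys_free_lift)
    fix k assume "k \<in> Poly_Mapping.keys (?F u)"
    then obtain x y where k: "k = (q x, q y)" using keys[of u] by (auto simp: carrier_eq)
    have "Poly_Mapping.keys (free_lift (\<lambda>(u', v'). basis (q x \<otimes>\<^bsub>A\<^esub> u', q y \<otimes>\<^bsub>A\<^esub> v')) (?F v)) \<subseteq> carrier A \<times> carrier A"
    proof (intro keys_free_lift)
      fix k' assume "k' \<in> Poly_Mapping.keys (?F v)"
      then obtain x' y' where "k' = (q x', q y')" using keys[of v] by (auto simp: carrier_eq)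
      then show "Poly_Mapping.keys (case k' of (u', v') \<Rightarrow> basis (q x \<otimes>\<^bsub>A\<^esub> u', q y \<otimes>\<^bsub>A\<^esub> v')) \<subseteq> carrier A \<times> carrier A"
        by (simp add: q_mult)
    qed
    then show "Poly_Mapping.keys (case k of (a, b) \<Rightarrow> free_lift (\<lambda>(a', b'). basis (a \<otimes>\<^bsub>A\<^esub> a', b \<otimes>\<^bsub>A\<^esub> b')) (?F v))
        \<subseteq> carrier A \<times> carrier A"
      by (simp add: k)
  qed
  then show "tens_cop A q u \<otimes>\<^bsub>tensor_product A A\<^esub> tens_cop A q v \<in> carrier (tensor_product A A)"
    unfolding eq by (rule tens_class_in_carrier)
  have p: "linear (proj_along (tens_relations A A))" by (rule linear_proj_along[OF subspace_tens_relations])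
  have "tens_proj A A (tens_class A A ?M) = sweedler (\<lambda>u1 u2. sweedler (\<lambda>v1 v2.
      tens_proj A A (pure_tens A A (q (m u1 v1)) (q (m u2 v2)))) v) u"
    by (simp add: tens_proj_class pure_tens_def sweedler_def case_prod_unfold
        linear_free_lift_comp[OF linear_free_lift] linear_free_lift_comp[OF p] q_mult)
  then show "tens_proj A A (tens_cop A q u \<otimes>\<^bsub>tensor_product A A\<^esub> tens_cop A q v) =
      sweedler (\<lambda>x y. tens_proj A A (pure_tens A A (q x) (q y))) (m u v)"
    unfolding eq by (simp add: sweedler_m[OF bilinear_pure_tens])
qed

lemma algebra_hom_iff:
  "algebra_hom A P f \<longleftrightarrow> (\<forall>x. f (q x) \<in> carrier P) \<and>
     (\<forall>x y. f (q (x + y)) = f (q x) \<oplus>\<^bsub>P\<^esub> f (q y)) \<and> (\<forall>c x. f (q (c *\<^sub>R x)) = c \<odot>\<^bsub>P\<^esub> f (q x)) \<and>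
     (\<forall>x y. f (q (m x y)) = f (q x) \<otimes>\<^bsub>P\<^esub> f (q y)) \<and> f (q 1) = \<one>\<^bsub>P\<^esub>"
proof -
  have "(\<forall>x y. x \<in> range q \<and> y \<in> range q \<longrightarrow> R x y) \<longleftrightarrow> (\<forall>x y. R (q x) (q y))" for R
    by blast
  then show ?thesis
    by (auto simp: algebra_hom_def linear_map_iff ring_hom_def carrier_eq q_mult q_add one_eq Pi_iff)
qed

lemma algebra_hom_tens_cop:
  assumes "\<And>u. d (q u) = tens_cop A q u"
  shows "algebra_hom A (tensor_product A A) d"
  by (simp add: algebra_hom_iff assms tens_cop_closed tens_cop_add tens_cop_scale tens_cop_mult
      tens_cop_1 tensor_product_one one_eq)

end

section \<open>Hopf algebras as quotients of T\<close>

locale tensor_quotient_hopf = tensor_quotient_algebra H q N m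
  for H :: "'u hopf" and q :: "'a::real_vector tensor_algebra \<Rightarrow> 'u" and N m +
  fixes S :: "'a tensor_algebra \<Rightarrow> 'a tensor_algebra"
  assumes counit_eq: "counit H (q u) = tensor_counit u"
    and comult_eq: "comult H (q u) = tens_cop H q u"
    and linear_S: "linear S"
    and S_closed: "u \<in> N \<Longrightarrow> S u \<in> N"
    and S_antipode: "sweedler (\<lambda>v w. m (S v) w) u = tensor_counit u *\<^sub>R 1"
      "sweedler (\<lambda>v w. m v (S w)) u = tensor_counit u *\<^sub>R 1"
begin

lemma linear_map_comult: "linear_map H (tensor_product H H) (comult H)"
  by (simp add: linear_map_iff comult_eq tens_cop_closed tens_cop_add tens_cop_scale)

lemma linear_map_counit: "linear_map H (type_algebra :: (real, real) module) (counit H)"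
  by (simp add: linear_map_iff counit_eq linear_add[OF linear_tensor_counit]
      linear_scale[OF linear_tensor_counit])

text \<open>The two iterated tensor products have different types, hence the explicit
  \<open>assoc\<close>. Under \<open>tens_proj H HH\<close> both sides become nested Sweedler sums
  of one trilinear map, and \<open>sweedler_coassoc\<close> applies.\<close>

lemma coassociative:
  fixes u :: 'u
  defines "HH \<equiv> tensor_product H H"
  defines "H_HH \<equiv> tensor_product H HH" and "HH_H \<equiv> tensor_product HH H"
  defines "assoc \<equiv> tens_lift H_HH (\<lambda>s w. tens_lift H_HH (\<lambda>u v. pure_tens H HH u (pure_tens H H v w)) s)"
  assumes "u \<in> carrier H"
  shows "assoc (tens_lift HH_H (\<lambda>v w. pure_tens HH H (comult H v) w) (comult H u)) =
    tens_lift H_HH (\<lambda>v w. pure_tens H HH v (comult H w)) (comult H u)"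
proof -
  obtain x where u: "u = q x" using assms(5) by (rule carrierE)
  interpret HH: embedded_module HH "tens_proj H H" unfolding HH_def by (rule embedded_tensor_product)
  interpret P: embedded_module H_HH "tens_proj H HH" unfolding H_HH_def by (rule embedded_tensor_product)
  interpret Q: embedded_module HH_H "tens_proj HH H" unfolding HH_H_def by (rule embedded_tensor_product)
  let ?e = "tens_proj H HH"
  note HH_pure = pure_tens_in_carrier[of _ H _ H, folded HH_def]
  note HH_bil = pure_tens_bilinear[where A = H and B = H, folded HH_def]
  note P_pure = pure_tens_in_carrier[of _ H _ HH, folded H_HH_def]
  note P_bil = pure_tens_bilinear[where A = H and B = HH, folded H_HH_def]
  note Q_pure = pure_tens_in_carrier[of _ HH _ H, folded HH_H_def]
  note Q_bil = pure_tens_bilinear[where A = HH and B = H, folded HH_H_def]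
  note cop_closed = tens_cop_closed[folded HH_def]
  define b where "b = (\<lambda>u v w. pure_tens H HH u (pure_tens H H v w))"
  have b_closed: "b u v w \<in> carrier H_HH" if "u \<in> carrier H" "v \<in> carrier H" "w \<in> carrier H" for u v w
    unfolding b_def using that by (simp add: P_pure HH_pure)
  have b_bil: "tens_bilinear H H (\<lambda>u v. ?e (b u v w))" if "w \<in> carrier H" for w
    using that unfolding tens_bilinear_def b_def
    by (simp add: P_bil HH_bil HH_pure P_pure P.e_simps HH.closed)
  have c: "trilinear (\<lambda>x y z. ?e (b (q x) (q y) (q z)))"
    unfolding trilinear_def b_def
    by (intro conjI allI linearI)
      (simp_all add: P_bil HH_bil HH_pure P_pure P.e_simps flip: q_add q_smult)
  define a where "a = (\<lambda>s w. tens_lift H_HH (\<lambda>u v. b u v w) s)"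
  have a: "a s w \<in> carrier H_HH" "?e (a s w) = free_lift (\<lambda>(u, v). ?e (b u v w)) (tens_proj H H s)"
    if "s \<in> carrier HH" "w \<in> carrier H" for s w
    using tens_lift_closed[OF embedded embedded P.embedded_module_axioms b_closed[OF _ _ that(2)] b_bil[OF that(2)]]
      e_tens_lift[OF embedded embedded P.embedded_module_axioms b_closed[OF _ _ that(2)] b_bil[OF that(2)]]
      that(1) unfolding a_def HH_def by auto
  \<comment> \<open>Linearity in \<open>w\<close> is checked pair by pair, which needs a
    representative of \<open>s\<close> supported in the carriers. The projected one,
    \<open>tens_proj H H s\<close>, may not be.\<close>
  have a_rep: "\<exists>f. Poly_Mapping.keys f \<subseteq> carrier H \<times> carrier H \<and>
      (\<forall>w\<in>carrier H. ?e (a s w) = free_lift (\<lambda>(u, v). ?e (b u v w)) f)" if "s \<in> carrier HH" for s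
  proof -
    obtain f where f: "s = tens_class H H f" "Poly_Mapping.keys f \<subseteq> carrier H \<times> carrier H"
      using \<open>s \<in> carrier HH\<close> unfolding HH_def tensor_product_carrier by blast
    then show ?thesis using a(2)[OF that] free_lift_tens_proj[OF b_bil] by auto
  qed
  have a_bil: "tens_bilinear HH H (\<lambda>s w. ?e (a s w))"
    unfolding tens_bilinear_def
  proof (intro conjI ballI allI)
    fix s s' w w' r assume s: "s \<in> carrier HH" and w: "w \<in> carrier H"
    show "?e (a (r \<odot>\<^bsub>HH\<^esub> s) w) = r *\<^sub>R ?e (a s w)"
      using s w by (simp add: a HH.closed HH.e_simps free_lift_scale)
    obtain f where f: "Poly_Mapping.keys f \<subseteq> carrier H \<times> carrier H"
        "\<And>w. w \<in> carrier H \<Longrightarrow> ?e (a s w) = free_lift (\<lambda>(u, v). ?e (b u v w)) f"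
      using a_rep[OF s] by blast
    interpret H: embedded_module H q_proj by (rule embedded)
    have "free_lift (\<lambda>(u, v). ?e (b u v (r \<odot>\<^bsub>H\<^esub> w))) f = free_lift (\<lambda>(u, v). r *\<^sub>R ?e (b u v w)) f"
      using f(1) w
      by (intro free_lift_cong) (auto simp: b_def P_bil HH_bil HH_pure P_pure P.e_simps)
    then show "?e (a s (r \<odot>\<^bsub>H\<^esub> w)) = r *\<^sub>R ?e (a s w)"
      using w by (simp add: f(2) H.closed free_lift_prod_scale)
    { assume "s' \<in> carrier HH"
      then show "?e (a (s \<oplus>\<^bsub>HH\<^esub> s') w) = ?e (a s w) + ?e (a s' w)"
        using s w by (simp add: a HH.closed HH.e_simps free_lift_add) }
    { assume w': "w' \<in> carrier H"
      have "free_lift (\<lambda>(u, v). ?e (b u v (w \<oplus>\<^bsub>H\<^esub> w'))) f =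
          free_lift (\<lambda>(u, v). ?e (b u v w) + ?e (b u v w')) f"
        using f(1) w w'
        by (intro free_lift_cong) (auto simp: b_def P_bil HH_bil HH_pure P_pure P.e_simps)
      then show "?e (a s (w \<oplus>\<^bsub>H\<^esub> w')) = ?e (a s w) + ?e (a s w')"
        using w w' by (simp add: f(2) H.closed free_lift_prod_add) }
  qed
  have e_a_cop: "?e (a (tens_cop H q x) (q y)) = sweedler (\<lambda>x1 x2. ?e (b (q x1) (q x2) (q y))) x" for x y
  proof -
    have "bilinear (\<lambda>x1 x2. ?e (b (q x1) (q x2) (q y)))"
      using b_bil[of "q y"] by (simp add: tens_bilinear_iff)
    then show ?thesis
      by (simp add: a cop_closed free_lift_tens_cop[where \<beta> = "\<lambda>u v. ?e (b u v (q y))"])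
  qed
  have comult_lin: "comult H (q x \<oplus>\<^bsub>H\<^esub> q y) = tens_cop H q x \<oplus>\<^bsub>HH\<^esub> tens_cop H q y"
    "comult H (c \<odot>\<^bsub>H\<^esub> q x) = c \<odot>\<^bsub>HH\<^esub> tens_cop H q x" for x y c
    by (simp_all add: q_add q_smult comult_eq tens_cop_add tens_cop_scale HH_def)
  let ?X = "tens_lift HH_H (\<lambda>v w. pure_tens HH H (comult H v) w) (comult H u)"
  have "bilinear (\<lambda>x y. tens_proj HH H (pure_tens HH H (comult H (q x)) (q y)))"
    by (intro bilinearI linearI)
      (simp_all add: comult_eq comult_lin Q_bil Q_pure Q.e_simps
        cop_closed flip: q_add q_smult)
  note X = tens_lift_tens_cop_closed[OF Q.embedded_module_axioms _ this, of x]
    e_tens_lift_tens_cop[OF Q.embedded_module_axioms _ this, of x]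
  have X: "?X \<in> carrier HH_H"
      "tens_proj HH H ?X = sweedler (\<lambda>x y. tens_proj HH H (pure_tens HH H (tens_cop H q x) (q y))) x"
    using X by (simp_all add: u comult_eq Q_pure cop_closed)
  have X1: "?X \<in> carrier (tensor_product HH H)" using X(1) unfolding HH_H_def .
  have assoc: "assoc = tens_lift H_HH a" by (simp add: assoc_def a_def b_def)
  have "assoc ?X \<in> carrier H_HH"
    unfolding assoc
    by (rule tens_lift_closed[OF HH.embedded_module_axioms embedded P.embedded_module_axioms a(1) a_bil X1])
  moreover have "?e (assoc ?X) = free_lift (\<lambda>(s, w). ?e (a s w)) (tens_proj HH H ?X)"
    unfolding assoc
    by (rule e_tens_lift[OF HH.embedded_module_axioms embedded P.embedded_module_axioms a(1) a_bil X1])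
  then have "?e (assoc ?X) = sweedler (\<lambda>x y. ?e (a (tens_cop H q x) (q y))) x"
    by (simp add: X(2) sweedler_comp[OF linear_free_lift] free_lift_tens_proj_pure[OF a_bil])
  then have "?e (assoc ?X) = sweedler (\<lambda>x z. sweedler (\<lambda>x1 x2. ?e (b (q x1) (q x2) (q z))) x) x"
    by (simp add: e_a_cop)
  \<comment> \<open>For fixed \<open>x\<close> the left side is linear in the inner tensor, so it is
    determined by its values on pure tensors, where it is \<open>b\<close>.\<close>
  moreover have pure_cop: "?e (pure_tens H HH (q x) (tens_cop H q y)) = sweedler (\<lambda>y1 y2. ?e (b (q x) (q y1) (q y2))) y" for x y
  proof -
    have "?e (pure_tens H HH (q x) t) = free_lift (\<lambda>(v, w). ?e (b (q x) v w)) (tens_proj H H t)"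
      if "t \<in> carrier HH" for t
      unfolding b_def
      by (rule tens_linear_eq_free_lift[of H H "\<lambda>t. ?e (pure_tens H HH (q x) t)"])
        (use that in \<open>simp_all add: P_bil P_pure P.e_simps flip: HH_def\<close>)
    moreover have "bilinear (\<lambda>y1 y2. ?e (b (q x) (q y1) (q y2)))"
      using c by (simp add: trilinear_def bilinear_def)
    ultimately show ?thesis
      by (simp add: cop_closed free_lift_tens_cop[where \<beta> = "\<lambda>v w. ?e (b (q x) v w)"])
  qed
  let ?Y = "tens_lift H_HH (\<lambda>v w. pure_tens H HH v (comult H w)) (comult H u)"
  have "bilinear (\<lambda>x y. ?e (pure_tens H HH (q x) (comult H (q y))))"
    by (intro bilinearI linearI)
      (simp_all add: comult_eq comult_lin P_bil P_pure P.e_simps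
        cop_closed flip: q_add q_smult)
  note Y = tens_lift_tens_cop_closed[OF P.embedded_module_axioms _ this, of x]
    e_tens_lift_tens_cop[OF P.embedded_module_axioms _ this, of x]
  have "?Y \<in> carrier H_HH" "?e ?Y = sweedler (\<lambda>x y. sweedler (\<lambda>y1 y2. ?e (b (q x) (q y1) (q y2))) y) x"
    using Y by (simp_all add: u comult_eq P_pure cop_closed pure_cop)
  ultimately show ?thesis
    by (intro P.eqI) (simp_all add: sweedler_coassoc[OF c])
qed

lemma coalgebra: "coalgebra H"
proof -
  have "tens_lift H (\<lambda>v w. counit H v \<odot>\<^bsub>H\<^esub> w) (comult H (q x)) = q x"
    "tens_lift H (\<lambda>v w. counit H w \<odot>\<^bsub>H\<^esub> v) (comult H (q x)) = q x" for x
    unfolding comult_eq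
    by (subst tens_lift_tens_cop_q, simp add: counit_eq q_smult, rule bilinear_counit, simp add: sweedler_counit)+
  then show ?thesis
    unfolding coalgebra_def Let_def
    by (intro conjI ballI linear_map_comult linear_map_counit coassociative) (auto simp: carrier_eq)
qed

lemma algebra_hom_comult: "algebra_hom H (tensor_product H H) (comult H)"
  by (rule algebra_hom_tens_cop) (rule comult_eq)

lemma algebra_hom_counit: "algebra_hom H (type_algebra :: (real, real) module) (counit H)"
  by (simp add: algebra_hom_iff counit_eq counit_m linear_add[OF linear_tensor_counit]
      linear_scale[OF linear_tensor_counit])

lemma antipode_exists: "\<exists>S'. antipode H S'"
proof -
  define S' where "S' = q_lift (\<lambda>s. q (S s))"
  have S': "S' (q s) = q (S s)" for s
    unfolding S'_def
    by (rule q_lift_q) (simp add: q_eq_iff S_closed flip: linear_diff[OF linear_S])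
  have "linear_map H H S'"
    by (simp add: linear_map_iff S' q_add q_smult linear_add[OF linear_S] linear_scale[OF linear_S])
  moreover have "tens_lift H (\<lambda>v w. S' v \<otimes>\<^bsub>H\<^esub> w) (tens_cop H q x) = q (sweedler (\<lambda>v w. m (S v) w) x)"
    "tens_lift H (\<lambda>v w. v \<otimes>\<^bsub>H\<^esub> S' w) (tens_cop H q x) = q (sweedler (\<lambda>v w. m v (S w)) x)" for x
    by (rule tens_lift_tens_cop_q;
        simp add: S' q_mult bilinear_comp_left[OF bilinear_m linear_S] bilinear_comp_right[OF bilinear_m linear_S])+
  ultimately have "antipode H S'"
    by (auto simp: antipode_def carrier_eq comult_eq counit_eq S_antipode one_eq q_smult)
  then show ?thesis by blast
qed

lemma hopf_algebra: "hopf_algebra H"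
  unfolding hopf_algebra_def
  by (intro conjI unital_algebra coalgebra algebra_hom_comult algebra_hom_counit antipode_exists)

end

text \<open>All compatibilities are stated on T, so the lemma also serves for maps between two star
  structures. \<open>G\<close> carrying \<open>N'\<close> into \<open>N\<close> yields injectivity
  on classes, and \<open>F (G u) = u\<close> yields surjectivity.\<close>

lemma tensor_quotient_hopf_iso:
  assumes "tensor_quotient_hopf H q N m S" "tensor_quotient_hopf K q' N' m' S'"
    and F: "linear F" "F 1 = 1" "\<And>u v. F (m u v) = m' (F u) (F v)"
      "\<And>u. tensor_counit (F u) = tensor_counit u"
      "\<And>(b :: _ \<Rightarrow> _ \<Rightarrow> ('w \<times> 'w \<Rightarrow>\<^sub>0 real)) u. bilinear b \<Longrightarrow> sweedler b (F u) = sweedler (\<lambda>v w. b (F v) (F w)) u"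
      "\<And>u. u \<in> N \<Longrightarrow> F u \<in> N'"
    and G: "linear G" "\<And>u. F (G u) = u" "\<And>u. G (F u) = u" "\<And>u. u \<in> N' \<Longrightarrow> G u \<in> N"
    and \<phi>: "\<And>u. \<phi> (q u) = q' (F u)"
  shows "hopf_iso H (K :: 'w hopf) \<phi>"
proof -
  interpret H: tensor_quotient_hopf H q N m S by fact
  interpret K: tensor_quotient_hopf K q' N' m' S' by fact
  have hom: "algebra_hom H K \<phi>"
    by (simp add: H.algebra_hom_iff \<phi> K.one_eq K.q_mult K.q_add K.q_smult F linear_add[OF F(1)]
        linear_scale[OF F(1)])
  have comult: "comult K (\<phi> (q x)) = tens_lift (tensor_product K K) (\<lambda>v w. pure_tens K K (\<phi> v) (\<phi> w)) (comult H (q x))" for x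
  proof -
    interpret T: embedded_module "tensor_product K K" "tens_proj K K" by (rule embedded_tensor_product)
    have b: "bilinear (\<lambda>x y. tens_proj K K (pure_tens K K (\<phi> (q x)) (\<phi> (q y))))"
      using bilinear_comp[OF K.bilinear_pure_tens F(1,1)] by (simp add: \<phi>)
    have "pure_tens K K (\<phi> (q x)) (\<phi> (q y)) \<in> carrier (tensor_product K K)" for x y
      by (simp add: \<phi> pure_tens_in_carrier)
    note l = H.tens_lift_tens_cop_closed[OF T.embedded_module_axioms this b]
      H.e_tens_lift_tens_cop[OF T.embedded_module_axioms this b]
    show ?thesis
      unfolding H.comult_eq
      by (rule T.eqI)
        (simp_all add: l \<phi> K.comult_eq K.tens_cop_closed K.tens_proj_tens_cop F(5)[OF K.bilinear_pure_tens])
  qed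
  have "inj_on \<phi> (carrier H)"
  proof (rule inj_onI)
    fix u v assume "u \<in> carrier H" "v \<in> carrier H" "\<phi> u = \<phi> v"
    then obtain x y where xy: "u = q x" "v = q y" "q' (F x) = q' (F y)" by (auto simp: H.carrier_eq \<phi>)
    then have "F (x - y) \<in> N'" by (simp add: K.q_eq_iff linear_diff[OF F(1)])
    from G(4)[OF this] show "u = v" by (simp add: G xy H.q_eq_iff)
  qed
  moreover have "\<phi> ` carrier H = carrier K"
  proof -
    have "q' y = \<phi> (q (G y))" for y by (simp add: \<phi> G)
    then have "q' y \<in> \<phi> ` carrier H" for y by (metis H.q_closed imageI)
    then show ?thesis by (auto simp: H.carrier_eq K.carrier_eq \<phi>)
  qed
  ultimately have "bij_betw \<phi> (carrier H) (carrier K)" by (simp add: bij_betw_def)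
  with hom comult show ?thesis
    using H.hopf_algebra K.hopf_algebra
    by (auto simp: hopf_iso_def hopf_hom_def H.carrier_eq \<phi> K.counit_eq H.counit_eq F)
qed

section \<open>The enveloping algebra\<close>

definition uea_class :: "('a::real_vector \<Rightarrow> 'a \<Rightarrow> 'a) \<Rightarrow> 'a tensor_algebra \<Rightarrow> 'a tensor_algebra set" where
  "uea_class br t = uea_ideal br +>\<^bsub>type_algebra\<^esub> t"

lemma uea_in_eq: "uea_in br x = uea_class br (tensor_in x)"
  by (simp add: uea_in_def uea_class_def)

lemma in_uea_class_iff: "s \<in> uea_class br t \<longleftrightarrow> s - t \<in> uea_ideal br"
proof -
  have "s = h + t \<longleftrightarrow> h = s - t" for h by auto
  then show ?thesis by (simp add: uea_class_def a_r_coset_def')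
qed

lemma uea_class_eq_iff: "uea_class br s = uea_class br t \<longleftrightarrow> s - t \<in> uea_ideal br"
proof
  assume "uea_class br s = uea_class br t"
  moreover have "s \<in> uea_class br s"
    by (simp add: in_uea_class_iff subspace_0[OF subspace_uea_ideal])
  ultimately show "s - t \<in> uea_ideal br" by (simp add: in_uea_class_iff)
next
  assume st: "s - t \<in> uea_ideal br"
  have "u - s \<in> uea_ideal br \<longleftrightarrow> u - t \<in> uea_ideal br" for u
    using subspace_add[OF subspace_uea_ideal _ st, of "u - s"]
      subspace_diff[OF subspace_uea_ideal _ st, of "u - t"] by auto
  then show "uea_class br s = uea_class br t" by (auto simp: in_uea_class_iff)
qed

lemma
  shows uea_carrier: "carrier (uea_algebra br) = range (uea_class br)"
    and uea_mult: "uea_class br s \<otimes>\<^bsub>uea_algebra br\<^esub> uea_class br t = uea_class br (s * t)"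
    and uea_one: "\<one>\<^bsub>uea_algebra br\<^esub> = uea_class br 1"
    and uea_zero: "\<zero>\<^bsub>uea_algebra br\<^esub> = uea_class br 0"
    and uea_add: "uea_class br s \<oplus>\<^bsub>uea_algebra br\<^esub> uea_class br t = uea_class br (s + t)"
    and uea_smult: "c \<odot>\<^bsub>uea_algebra br\<^esub> uea_class br t = uea_class br (c *\<^sub>R t)"
proof -
  interpret I: ideal "uea_ideal br" type_algebra by (rule ideal_uea_ideal)
  show "carrier (uea_algebra br) = range (uea_class br)"
    by (auto simp: uea_algebra_def quotient_algebra_def FactRing_def A_RCOSETS_def' uea_class_def)
  show "uea_class br s \<otimes>\<^bsub>uea_algebra br\<^esub> uea_class br t = uea_class br (s * t)"
    using I.rcoset_mult_add[of s t]
    by (simp add: uea_algebra_def quotient_algebra_def FactRing_def uea_class_def)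
  show "\<one>\<^bsub>uea_algebra br\<^esub> = uea_class br 1"
    by (simp add: uea_algebra_def quotient_algebra_def FactRing_def uea_class_def)
  have "uea_class br 0 = uea_ideal br" by (auto simp: in_uea_class_iff)
  then show "\<zero>\<^bsub>uea_algebra br\<^esub> = uea_class br 0"
    by (simp add: uea_algebra_def quotient_algebra_def FactRing_def)
  show "uea_class br s \<oplus>\<^bsub>uea_algebra br\<^esub> uea_class br t = uea_class br (s + t)"
    using I.a_rcos_sum[of s t]
    by (simp add: uea_algebra_def quotient_algebra_def FactRing_def uea_class_def)
  have "uea_class br (c *\<^sub>R u) = uea_class br (c *\<^sub>R t)" if "u \<in> uea_class br t" for u
    using subspace_scale[OF subspace_uea_ideal, of "u - t" br c] that
    by (simp add: uea_class_eq_iff in_uea_class_iff scaleR_diff_right)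
  moreover have "t \<in> uea_class br t"
    by (simp add: in_uea_class_iff subspace_0[OF subspace_uea_ideal])
  moreover have "c \<odot>\<^bsub>uea_algebra br\<^esub> C = (\<Union>u\<in>C. uea_class br (c *\<^sub>R u))" for C
    by (simp add: uea_algebra_def quotient_algebra_def uea_class_def)
  ultimately show "c \<odot>\<^bsub>uea_algebra br\<^esub> uea_class br t = uea_class br (c *\<^sub>R t)"
    by blast
qed

lemma uea_class_closed [simp]: "uea_class br t \<in> carrier (uea_algebra br)"
  by (simp add: uea_carrier)

text \<open>Only the algebra structure is available here. Counit and coproduct are described as
  unique algebra maps and can be identified only with the help of this interpretation.\<close>

lemma tensor_quotient_algebra_uea:
  "tensor_quotient_algebra (uea_algebra br) (uea_class br) (uea_ideal br) (*)"
  by unfold_locales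
    (simp_all add: subspace_uea_ideal uea_class_eq_iff uea_carrier uea_zero uea_add uea_smult uea_one
      uea_mult bilinear_times mult.assoc sweedler_mult tensor_counit_mult)

text \<open>Letters generate the algebra. This is the uniqueness half for counit and
  coproduct.\<close>

lemma algebra_hom_uea_unique:
  assumes "algebra_hom (uea_algebra br) P f" "algebra_hom (uea_algebra br) P g"
    "\<And>x. f (uea_in br x) = g (uea_in br x)"
  shows "f (uea_class br t) = g (uea_class br t)"
proof -
  interpret U: tensor_quotient_algebra "uea_algebra br" "uea_class br" "uea_ideal br" "(*)"
    by (rule tensor_quotient_algebra_uea)
  show ?thesis
    using assms unfolding U.algebra_hom_iff uea_in_eq
    by (induction t rule: tensor_algebra_induct) auto
qed

text \<open>Existence: \<open>tensor_counit\<close> kills the ideal and passes to classes;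
  \<open>restrict\<close> supplies the extensionality clause of the description.\<close>

lemma uea_counit_class: "uea_counit br (uea_class br t) = tensor_counit t"
proof -
  interpret U: tensor_quotient_algebra "uea_algebra br" "uea_class br" "uea_ideal br" "(*)"
    by (rule tensor_quotient_algebra_uea)
  define e where "e = restrict (U.q_lift tensor_counit) (carrier (uea_algebra br))"
  have "tensor_counit s = tensor_counit t" if "s - t \<in> uea_ideal br" for s t
    using counit_uea_ideal[OF that] by (simp add: linear_diff[OF linear_tensor_counit])
  then have e: "e (uea_class br t) = tensor_counit t" for t
    by (simp add: e_def U.q_lift_q)
  have hom: "algebra_hom (uea_algebra br) (type_algebra :: (real, real) module) e"
    by (simp add: U.algebra_hom_iff e tensor_counit_mult linear_add[OF linear_tensor_counit]
        linear_scale[OF linear_tensor_counit])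
  have "uea_counit br = e"
    unfolding uea_counit_def
  proof (rule the_equality)
    show "e \<in> extensional (carrier (uea_algebra br)) \<and> algebra_hom (uea_algebra br) (type_algebra :: (real, real) module) e \<and>
        (\<forall>x. e (uea_in br x) = 0)"
      using hom by (simp add: uea_in_eq e) (simp add: e_def)
  next
    fix f assume f: "f \<in> extensional (carrier (uea_algebra br)) \<and> algebra_hom (uea_algebra br) (type_algebra :: (real, real) module) f \<and>
        (\<forall>x. f (uea_in br x) = 0)"
    show "f = e"
    proof (rule extensionalityI[of _ "carrier (uea_algebra br)"])
      show "f \<in> extensional (carrier (uea_algebra br))" using f by simp
      show "e \<in> extensional (carrier (uea_algebra br))" by (simp add: e_def)
      fix u assume "u \<in> carrier (uea_algebra br)"
      then obtain t where u: "u = uea_class br t" by (rule U.carrierE)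
      show "f u = e u" unfolding u
        by (rule algebra_hom_uea_unique[of br "type_algebra :: (real, real) module"]) (use f hom in \<open>simp_all add: uea_in_eq e\<close>)
    qed
  qed
  then show ?thesis by (simp add: e)
qed

text \<open>Independence of the representative is the coideal property
  \<open>sweedler_uea_ideal\<close>, applied to the projected pure tensors.\<close>

lemma uea_coshuffle_class:
  "uea_coshuffle br (uea_class br t) = tens_cop (uea_algebra br) (uea_class br) t"
proof -
  interpret U: tensor_quotient_algebra "uea_algebra br" "uea_class br" "uea_ideal br" "(*)"
    by (rule tensor_quotient_algebra_uea)
  let ?U = "uea_algebra br"
  let ?c = "tens_cop ?U (uea_class br)"
  define d where "d = restrict (U.q_lift ?c) (carrier ?U)"
  have "?c s = ?c t" if "s - t \<in> uea_ideal br" for s t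
  proof (rule U.tens_proj_eqI[OF U.tens_cop_closed U.tens_cop_closed])
    let ?\<beta> = "\<lambda>x y. tens_proj ?U ?U (pure_tens ?U ?U (uea_class br x) (uea_class br y))"
    have 0: "uea_class br x = uea_class br 0" if "x \<in> uea_ideal br" for x
      using that by (simp add: uea_class_eq_iff)
    have "sweedler ?\<beta> (s - t) = 0"
      using bilinear_lzero[OF U.bilinear_pure_tens] bilinear_rzero[OF U.bilinear_pure_tens]
      by (intro sweedler_uea_ideal[OF U.bilinear_pure_tens that]) (simp_all add: 0)
    then show "tens_proj ?U ?U (?c s) = tens_proj ?U ?U (?c t)"
      by (simp add: U.tens_proj_tens_cop linear_diff[OF linear_sweedler[OF U.bilinear_pure_tens]])
  qed
  then have d: "d (uea_class br t) = ?c t" for t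
    by (simp add: d_def U.q_lift_q)
  have hom: "algebra_hom ?U (tensor_product ?U ?U) d"
    by (rule U.algebra_hom_tens_cop) (rule d)
  have "uea_coshuffle br = d"
    unfolding uea_coshuffle_def Let_def
  proof (rule the_equality)
    show "d \<in> extensional (carrier ?U) \<and> algebra_hom ?U (tensor_product ?U ?U) d \<and>
        (\<forall>x. d (uea_in br x) = pure_tens ?U ?U (uea_in br x) \<one>\<^bsub>?U\<^esub> \<oplus>\<^bsub>tensor_product ?U ?U\<^esub> pure_tens ?U ?U \<one>\<^bsub>?U\<^esub> (uea_in br x))"
      using hom by (simp add: uea_in_eq d uea_one U.tens_cop_in) (simp add: d_def)
  next
    fix f assume f: "f \<in> extensional (carrier ?U) \<and> algebra_hom ?U (tensor_product ?U ?U) f \<and>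
        (\<forall>x. f (uea_in br x) = pure_tens ?U ?U (uea_in br x) \<one>\<^bsub>?U\<^esub> \<oplus>\<^bsub>tensor_product ?U ?U\<^esub> pure_tens ?U ?U \<one>\<^bsub>?U\<^esub> (uea_in br x))"
    show "f = d"
    proof (rule extensionalityI[of _ "carrier ?U"])
      show "f \<in> extensional (carrier ?U)" using f by simp
      show "d \<in> extensional (carrier ?U)" by (simp add: d_def)
      fix u assume "u \<in> carrier ?U"
      then obtain t where u: "u = uea_class br t" by (rule U.carrierE)
      show "f u = d u" unfolding u
        by (rule algebra_hom_uea_unique[of br "tensor_product ?U ?U"])
          (use f hom in \<open>simp_all add: uea_in_eq d uea_one U.tens_cop_in\<close>)
    qed
  qed
  then show ?thesis by (simp add: d)
qed

text \<open>Tensor relations see only carrier, addition and scalars. Hence a single coproduct serves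
  the enveloping algebra and both Hopf structures on it.\<close>

lemma tens_cop_cong:
  assumes "carrier A = carrier B" "add A = add B" "smult A = smult B"
  shows "tens_cop A q u = tens_cop B q u"
proof -
  have "tens_relations A A = tens_relations B B" by (simp add: tens_relations_def assms)
  then show ?thesis by (simp add: tens_cop_def tens_class_def)
qed

lemma uea_conc_simps [simp]:
  "carrier (uea_conc br) = carrier (uea_algebra br)" "mult (uea_conc br) = mult (uea_algebra br)"
  "one (uea_conc br) = one (uea_algebra br)" "zero (uea_conc br) = zero (uea_algebra br)"
  "add (uea_conc br) = add (uea_algebra br)" "smult (uea_conc br) = smult (uea_algebra br)"
  "counit (uea_conc br) = uea_counit br" "comult (uea_conc br) = uea_coshuffle br"
  by (simp_all add: uea_conc_def Let_def)

lemma uea_star_simps [simp]: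
  "carrier (uea_star tr br) = carrier (uea_algebra br)"
  "one (uea_star tr br) = one (uea_algebra br)" "zero (uea_star tr br) = zero (uea_algebra br)"
  "add (uea_star tr br) = add (uea_algebra br)" "smult (uea_star tr br) = smult (uea_algebra br)"
  "counit (uea_star tr br) = uea_counit br" "comult (uea_star tr br) = uea_coshuffle br"
  by (simp_all add: uea_star_def Let_def)

lemma tensor_quotient_hopf_uea_conc:
  "tensor_quotient_hopf (uea_conc br) (uea_class br) (uea_ideal br) (*) tensor_antipode"
proof -
  have "tens_cop (uea_algebra br) (uea_class br) u = tens_cop (uea_conc br) (uea_class br) u" for u
    by (rule tens_cop_cong) simp_all
  then show ?thesis
    by unfold_locales
      (simp_all add: subspace_uea_ideal uea_class_eq_iff uea_carrier uea_zero uea_add uea_smult uea_one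
        uea_mult bilinear_times mult.assoc sweedler_mult tensor_counit_mult uea_counit_class
        uea_coshuffle_class linear_add[OF linear_tensor_antipode] linear_scale[OF linear_tensor_antipode]
        antipode_uea_ideal sweedler_antipode)
qed

section \<open>The post-Lie action and the star product\<close>

context post_lie
begin

abbreviation "q \<equiv> uea_class br"
abbreviation "U \<equiv> uea_conc br"

lemma uea_minus: "q s \<ominus>\<^bsub>U\<^esub> q t = q (s - t)"
proof -
  interpret C: tensor_quotient_hopf U q "uea_ideal br" "(*)" tensor_antipode
    by (rule tensor_quotient_hopf_uea_conc)
  interpret E: embedded_module U C.q_proj by (rule C.embedded)
  interpret abelian_group U by (rule E.abelian_group)
  have "\<ominus>\<^bsub>U\<^esub> q t = q (- t)"
    by (rule minus_equality) (simp_all add: uea_carrier uea_add uea_zero)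
  then show ?thesis by (simp add: a_minus_def uea_add)
qed

text \<open>\<open>undefined\<close> off the carrier matches the first clause of
  \<open>post_lie_extension\<close>, by which the extension is unique as a total function.\<close>

definition class_ext :: "'a tensor_algebra set \<Rightarrow> 'a tensor_algebra set \<Rightarrow> 'a tensor_algebra set" where
  "class_ext u v = (if u \<in> carrier U \<and> v \<in> carrier U
     then q (tensor_ext tr (SOME s. q s = u) (SOME t. q t = v)) else undefined)"

lemma class_ext_class: "class_ext (q s) (q t) = q (tensor_ext tr s t)"
proof -
  define s' where "s' = (SOME s'. q s' = q s)"
  define t' where "t' = (SOME t'. q t' = q t)"
  have "q s' = q s" "q t' = q t"
    unfolding s'_def t'_def by (rule someI, rule refl)+
  then have "s' - s \<in> uea_ideal br" "t' - t \<in> uea_ideal br" by (simp_all add: uea_class_eq_iff)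
  \<comment> \<open>The representatives are changed one at a time: the first summand vanishes, the
    second lies in the ideal.\<close>
  then have "tensor_ext tr (s' - s) t' + tensor_ext tr s (t' - t) \<in> uea_ideal br"
    by (simp add: ext_uea_ideal_left ext_uea_ideal_right)
  then have "q (tensor_ext tr s' t') = q (tensor_ext tr s t)"
    by (simp add: uea_class_eq_iff bilinear_lsub[OF bilinear_ext] bilinear_rsub[OF bilinear_ext])
  then show ?thesis by (simp add: class_ext_def uea_carrier s'_def t'_def)
qed

lemma post_lie_extension_class_ext: "post_lie_extension tr br class_ext"
proof -
  interpret C: tensor_quotient_hopf U q "uea_ideal br" "(*)" tensor_antipode
    by (rule tensor_quotient_hopf_uea_conc)
  have "class_ext (q u) (q v \<otimes>\<^bsub>U\<^esub> q w) =
      tens_lift U (\<lambda>u1 u2. class_ext u1 (q v) \<otimes>\<^bsub>U\<^esub> class_ext u2 (q w)) (comult U (q u))" for u v w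
  proof -
    have "bilinear (\<lambda>u1 u2. tensor_ext tr u1 v * tensor_ext tr u2 w)"
      by (intro bilinearI linear_intros linear_bilinear_left[OF bilinear_ext])
    from C.tens_lift_tens_cop_q[OF _ this] show ?thesis
      unfolding C.comult_eq by (simp add: class_ext_class uea_mult ext_mult)
  qed
  moreover have "linear_map U U (\<lambda>v. class_ext (q u) v)" "linear_map U U (\<lambda>v. class_ext v (q u))" for u
    by (simp_all add: C.linear_map_iff class_ext_class uea_carrier uea_add uea_smult
        bilinear_ladd[OF bilinear_ext] bilinear_radd[OF bilinear_ext]
        bilinear_lmul[OF bilinear_ext] bilinear_rmul[OF bilinear_ext])
  moreover have "class_ext (q (tensor_in x) \<otimes>\<^bsub>U\<^esub> q v) (q w) =
      class_ext (q (tensor_in x)) (class_ext (q v) (q w)) \<ominus>\<^bsub>U\<^esub> class_ext (class_ext (q (tensor_in x)) (q v)) (q w)"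
    for x v w
    by (simp only: uea_minus class_ext_class uea_mult uea_conc_simps ext_mult_in ext_in)
  moreover have "class_ext u v = undefined" if "u \<notin> carrier U \<or> v \<notin> carrier U" for u v
    using that by (auto simp: class_ext_def)
  moreover have "class_ext \<one>\<^bsub>U\<^esub> (q u) = q u" "class_ext (q u) \<one>\<^bsub>U\<^esub> = counit U (q u) \<odot>\<^bsub>U\<^esub> \<one>\<^bsub>U\<^esub>"
    "class_ext (q (tensor_in x)) (q (tensor_in y)) = q (tensor_in (tr x y))" for u x y
    by (simp_all add: uea_one class_ext_class ext_1 ext_unit ext_in uea_counit_class uea_smult)
  moreover have ball: "(\<forall>u\<in>carrier U. R u) \<longleftrightarrow> (\<forall>u. R (q u))" for R
    by (simp add: C.carrier_eq del: uea_conc_simps(1))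
  ultimately show ?thesis
    unfolding post_lie_extension_def Let_def uea_in_eq ball by blast
qed

text \<open>Uniqueness of the extension. At a primitive letter the product rule makes
  \<open>E\<close> a derivation on classes, so it agrees with \<open>D x\<close> there; the
  recursion in the first argument then forces all other values.\<close>

lemma post_lie_extension_class:
  assumes "post_lie_extension tr br E"
  shows "E (q s) (q t) = q (tensor_ext tr s t)"
proof -
  interpret C: tensor_quotient_hopf U q "uea_ideal br" "(*)" tensor_antipode
    by (rule tensor_quotient_hopf_uea_conc)
  interpret M: embedded_module U C.q_proj by (rule C.embedded)
  note lin = C.linear_map_iff
  note E = assms[unfolded post_lie_extension_def Let_def uea_in_eq]
  have E_right: "linear_map U U (\<lambda>v. E (q u) v)" and E_left: "linear_map U U (\<lambda>v. E v (q u))" for u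
    using E by simp_all
  have E_closed: "\<exists>w. E (q u) (q v) = q w" for u v
  proof -
    have "E (q u) (q v) \<in> range q" using E_right[of u] by (simp add: lin uea_carrier)
    then show ?thesis by blast
  qed
  have E_in: "E (q (tensor_in x)) (q w) = q (D x w)" for x w
  proof (induction w rule: tensor_algebra_induct)
    case one
    have "E (q (tensor_in x)) \<one>\<^bsub>U\<^esub> = counit U (q (tensor_in x)) \<odot>\<^bsub>U\<^esub> \<one>\<^bsub>U\<^esub>"
      using E by simp
    then show ?case by (simp add: uea_one uea_counit_class uea_smult)
  next
    case (mult y w)
    let ?b = "\<lambda>u1 u2. E u1 (q (tensor_in y)) \<otimes>\<^bsub>U\<^esub> E u2 (q w)"
    have 1: "E (q 1) (q v) = q v" for v
      using E by (simp add: uea_one)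
    have bc: "?b (q u) (q v) \<in> carrier U" for u v
      using E_closed[of u "tensor_in y"] E_closed[of v w] by (auto simp: uea_mult uea_carrier)
    \<comment> \<open>\<open>E\<close> is an arbitrary solution with values not yet known. Naming
      representatives of these values reduces bilinearity to the linearity clauses for
      \<open>E\<close> and distributivity.\<close>
    have bil: "bilinear (\<lambda>u v. C.q_proj (?b (q u) (q v)))"
    proof (intro bilinearI linearI)
      fix u u' v c
      obtain a a' b where ab: "E (q u) (q (tensor_in y)) = q a" "E (q u') (q (tensor_in y)) = q a'" "E (q v) (q w) = q b"
        using E_closed[of u "tensor_in y"] E_closed[of u' "tensor_in y"] E_closed[of v w] by (elim exE)
      show "C.q_proj (?b (q (u + u')) (q v)) = C.q_proj (?b (q u) (q v)) + C.q_proj (?b (q u') (q v))"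
        using E_left[of "tensor_in y"] M.e_add[of "q (a * b)" "q (a' * b)"]
        by (simp add: lin ab uea_add uea_mult distrib_right C.q_add uea_carrier)
      show "C.q_proj (?b (q (c *\<^sub>R u)) (q v)) = c *\<^sub>R C.q_proj (?b (q u) (q v))"
        using E_left[of "tensor_in y"] M.e_smult[of "q (a * b)" c]
        by (simp add: lin ab uea_smult uea_mult uea_carrier)
      fix v'
      obtain b' where b': "E (q v') (q w) = q b'" using E_closed[of v' w] by (elim exE)
      show "C.q_proj (?b (q u) (q (v + v'))) = C.q_proj (?b (q u) (q v)) + C.q_proj (?b (q u) (q v'))"
        using E_left[of w] M.e_add[of "q (a * b)" "q (a * b')"]
        by (simp add: lin ab b' uea_add uea_mult distrib_left C.q_add uea_carrier)
      show "C.q_proj (?b (q u) (q (c *\<^sub>R v))) = c *\<^sub>R C.q_proj (?b (q u) (q v))"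
        using E_left[of w] M.e_smult[of "q (a * b)" c]
        by (simp add: lin ab uea_smult uea_mult uea_carrier)
    qed
    note l = C.tens_lift_tens_cop_closed[OF C.embedded bc bil] C.e_tens_lift_tens_cop[OF C.embedded bc bil]
    have "E (q (tensor_in x)) (q (tensor_in y) \<otimes>\<^bsub>U\<^esub> q w) = tens_lift U ?b (comult U (q (tensor_in x)))"
      using E by simp
    then have eq: "E (q (tensor_in x)) (q (tensor_in y * w)) = tens_lift U ?b (tens_cop U q (tensor_in x))"
      unfolding C.comult_eq by (simp add: uea_mult)
    have "E (q (tensor_in x)) (q (tensor_in y)) = q (tensor_in (tr x y))" using E by simp
    then have "C.q_proj (tens_lift U ?b (tens_cop U q (tensor_in x))) =
        C.q_proj (q (tensor_in (tr x y) * w)) + C.q_proj (q (tensor_in y * D x w))"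
      unfolding l(2) sweedler_in[OF bil] using mult by (simp add: 1 uea_mult)
    also have "\<dots> = C.q_proj (q (D x (tensor_in y * w)))"
      using M.e_add[of "q (tensor_in (tr x y) * w)" "q (tensor_in y * D x w)"]
      by (simp add: der_mult_in uea_add uea_carrier)
    finally show ?case
      unfolding eq by (intro M.eqI l(1)) (simp_all add: uea_carrier)
  next
    case (add u v)
    then show ?case using E_right[of "tensor_in x"] by (simp add: lin uea_add der_add)
  next
    case (scale c u)
    then show ?case using E_right[of "tensor_in x"] by (simp add: lin uea_smult der_scale)
  qed
  \<comment> \<open>Evaluating at \<open>\<Phi> a\<close> makes this a structural induction: the two terms
    containing \<open>D x (\<Phi> a)\<close> cancel.\<close>
  have "E (q (\<Phi> a)) (q w) = q (\<rho> a w)" for a w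
  proof (induction a rule: tensor_algebra_induct)
    case one
    show ?case using E by (simp add: uea_one)
  next
    case (mult x a)
    obtain z where z: "E (q (D x (\<Phi> a))) (q w) = q z" using E_closed[of "D x (\<Phi> a)" w] by (elim exE)
    have "E (q (tensor_in x) \<otimes>\<^bsub>U\<^esub> q (\<Phi> a)) (q w) =
        E (q (tensor_in x)) (E (q (\<Phi> a)) (q w)) \<ominus>\<^bsub>U\<^esub> E (E (q (tensor_in x)) (q (\<Phi> a))) (q w)"
      using E by simp
    then have "E (q (tensor_in x * \<Phi> a)) (q w) = q (D x (\<rho> a w) - z)"
      by (simp only: mult E_in z uea_minus uea_mult uea_conc_simps)
    then show ?case
      using E_left[of w] z by (simp add: lin phi_mult_in act_mult_in uea_add)
  next
    case (add u v)
    then show ?case using E_left[of w] by (simp add: lin uea_add linear_add[OF linear_phi] act_add)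
  next
    case (scale c u)
    then show ?case using E_left[of w] by (simp add: lin uea_smult linear_scale[OF linear_phi] act_scale)
  qed
  \<comment> \<open>Every \<open>s\<close> has the form \<open>\<Phi> a\<close>, with
    \<open>a = \<Psi> s\<close>.\<close>
  from this[of "\<Psi> s" t] show ?thesis by (simp add: tensor_ext_def)
qed

lemma uea_action_class: "uea_action tr br (q s) (q t) = q (tensor_ext tr s t)"
proof -
  have "uea_action tr br = class_ext"
    unfolding uea_action_def
  proof (rule the_equality, rule post_lie_extension_class_ext, intro ext)
    fix E u v assume E: "post_lie_extension tr br E"
    show "E u v = class_ext u v"
    proof (cases "u \<in> carrier U \<and> v \<in> carrier U")
      case True
      then show ?thesis
        using post_lie_extension_class[OF E] by (auto simp: uea_carrier class_ext_class)
    next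
      case False
      then show ?thesis using E by (auto simp: post_lie_extension_def class_ext_def Let_def)
    qed
  qed
  then show ?thesis by (simp add: class_ext_class)
qed

lemma uea_star_mult: "q u \<otimes>\<^bsub>uea_star tr br\<^esub> q v = q (tensor_star tr u v)"
proof -
  interpret C: tensor_quotient_hopf U q "uea_ideal br" "(*)" tensor_antipode
    by (rule tensor_quotient_hopf_uea_conc)
  have "bilinear (\<lambda>u1 u2. u1 * tensor_ext tr u2 v)"
    by (intro bilinearI linear_intros linear_bilinear_left[OF bilinear_ext])
  from C.tens_lift_tens_cop_q[OF _ this, of "\<lambda>u1 u2. u1 \<otimes>\<^bsub>U\<^esub> uea_action tr br u2 (q v)" u]
  have "tens_lift U (\<lambda>u1 u2. u1 \<otimes>\<^bsub>U\<^esub> uea_action tr br u2 (q v)) (comult U (q u)) = q (tensor_star tr u v)"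
    unfolding C.comult_eq by (simp add: uea_action_class uea_mult star_sweedler)
  then show ?thesis by (simp add: uea_star_def Let_def)
qed

lemma tensor_quotient_hopf_uea_star:
  "tensor_quotient_hopf (uea_star tr br) (uea_class br) (uea_ideal br) (tensor_star tr) star_antipode"
proof -
  have "tens_cop (uea_algebra br) (uea_class br) u = tens_cop (uea_star tr br) (uea_class br) u" for u
    by (rule tens_cop_cong) simp_all
  then show ?thesis
    by unfold_locales
      (simp_all add: subspace_uea_ideal uea_class_eq_iff uea_carrier uea_zero uea_add uea_smult uea_one
        uea_star_mult bilinear_star star_assoc star_1 sweedler_star counit_star uea_counit_class
        uea_coshuffle_class linear_add[OF linear_star_antipode] linear_scale[OF linear_star_antipode]
        star_antipode_uea_ideal sweedler_star_antipode)
qed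

text \<open>\<open>\<Phi>\<close> turns concatenation into the star product and fixes letters, so
  iterated star products of letters are images of words.\<close>

lemma mult_list_star:
  "mult_list (uea_star tr br) (map (uea_in br) xs) = q (\<Phi> (word_prod xs))"
proof (induction xs)
  case (Cons x xs)
  then show ?case
    by (simp add: mult_list_def uea_in_eq uea_star_mult phi_star)
qed (simp add: mult_list_def uea_one)

lemma hopf_iso_phi:
  assumes "\<And>u. \<phi> (uea_class dbl u) = q (\<Phi> u)"
  shows "hopf_iso (uea_conc dbl) (uea_star tr br) \<phi>"
  by (rule tensor_quotient_hopf_iso[OF tensor_quotient_hopf_uea_conc tensor_quotient_hopf_uea_star,
        where F = \<Phi> and G = \<Psi>])
    (simp_all add: linear_phi linear_psi phi_star sweedler_phi phi_uea_ideal psi_uea_ideal assms)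

end

section \<open>From the post-Lie axioms to the theorem\<close>

lemma mult_list_conc: "mult_list (uea_conc br) (map (uea_in br) xs) = uea_class br (word_prod xs)"
  by (induction xs) (simp_all add: mult_list_def uea_one uea_in_eq uea_mult)

text \<open>The terms \<open>tr (tr x y) z\<close> and \<open>tr (tr y x) z\<close> of the
  associators, moved to the left side, complete \<open>br x y\<close> to the double bracket.\<close>

lemma post_lie_of_post_lie_algebra:
  assumes "post_lie_algebra tr br"
  shows "post_lie tr br (\<lambda>x y. commutator tr x y + br x y)"
proof
  have tr: "bilinear tr" using assms by (simp add: post_lie_algebra_def)
  show "bilinear tr" by fact
  fix x y z
  show "tr x (br y z) = br (tr x y) z + br y (tr x z)"
    using assms by (simp add: post_lie_algebra_def)
  have "tr (br x y) z = associator tr x y z - associator tr y x z"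
    using assms by (simp add: post_lie_algebra_def)
  then show "tr (commutator tr x y + br x y) z = tr x (tr y z) - tr y (tr x z)"
    by (simp add: commutator_def associator_def bilinear_ladd[OF tr] bilinear_lsub[OF tr])
  show "commutator tr x y + br x y = tr x y - tr y x + br x y"
    by (simp add: commutator_def)
qed

text \<open>The deformed bracket is the negative of the torsion: \<open>dia x\<close> is a
  derivation of it by constant torsion, \<open>tr x\<close> by the post-Lie axiom and condition
  (iii). In the action identity, null curvature handles \<open>dia\<close> on \<open>br x y\<close>,
  and (iii) matches the mixed terms with \<open>dia (tr x y) z\<close> and
  \<open>dia (tr y x) z\<close>. The commutators of \<open>dia\<close> cancel in the double
  bracket.\<close>

lemma post_lie_geometric_deformation:
  assumes pl: "post_lie_algebra tr br" and gd: "geometric_deformation tr br dia"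
  shows "post_lie (\<lambda>x y. tr x y + dia x y) (\<lambda>x y. br x y - commutator dia x y)
    (\<lambda>x y. commutator tr x y + br x y)"
proof
  interpret post_lie tr br "\<lambda>x y. commutator tr x y + br x y"
    by (rule post_lie_of_post_lie_algebra[OF pl])
  have dia: "bilinear dia" using gd by (simp add: geometric_deformation_def)
  have curv: "dia (br x y) z = dia x (dia y z) - dia y (dia x z)" for x y z
    using gd by (simp add: geometric_deformation_def)
  have tors: "dia x (torsion dia br y z) = torsion dia br (dia x y) z + torsion dia br y (dia x z)" for x y z
    using gd by (simp add: geometric_deformation_def)
  have comp: "tr x (dia y z) = dia (tr x y) z + dia y (tr x z)" for x y z
    using gd by (simp add: geometric_deformation_def)
  have br: "bilinear br" using pl by (simp add: post_lie_algebra_def lie_bracket_def)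
  note bil = bilinear_ladd[OF dia] bilinear_radd[OF dia] bilinear_lsub[OF dia] bilinear_rsub[OF dia]
    bilinear_ladd[OF bilinear_tr] bilinear_radd[OF bilinear_tr] bilinear_lsub[OF bilinear_tr]
    bilinear_rsub[OF bilinear_tr] bilinear_ladd[OF br] bilinear_radd[OF br] bilinear_lsub[OF br] bilinear_rsub[OF br]
  show "bilinear (\<lambda>x y. tr x y + dia x y)"
    using dia bilinear_tr by (auto simp: bilinear_def intro!: linear_compose_add)
  fix x y z
  show "tr x (br y z - commutator dia y z) + dia x (br y z - commutator dia y z) =
      br (tr x y + dia x y) z - commutator dia (tr x y + dia x y) z +
      (br y (tr x z + dia x z) - commutator dia y (tr x z + dia x z))"
    using tors[of x y z] derivation[of x y z] comp[of x y z] comp[of x z y]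
    by (simp add: torsion_def commutator_def bil algebra_simps)
  have "dia (commutator tr x y + br x y) z =
      dia (tr x y) z - dia (tr y x) z + (dia x (dia y z) - dia y (dia x z))"
    by (simp add: commutator_def bil curv)
  then show "tr (commutator tr x y + br x y) z + dia (commutator tr x y + br x y) z =
      tr x (tr y z + dia y z) + dia x (tr y z + dia y z) - (tr y (tr x z + dia x z) + dia y (tr x z + dia x z))"
    using comp[of x y z] comp[of y x z] action[of x y z] by (simp add: bil)
  show "commutator tr x y + br x y = tr x y + dia x y - (tr y x + dia y x) + (br x y - commutator dia x y)"
    by (simp add: commutator_def)
qed

theorem proposition2p22:
  fixes tr br dia tr_d br_d dbl :: "'a::real_vector \<Rightarrow> 'a \<Rightarrow> 'a"
  assumes "post_lie_algebra tr br"
    and "geometric_deformation tr br dia"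
    and "tr_d = (\<lambda>x y. tr x y + dia x y)"
    and "br_d = (\<lambda>x y. br x y - commutator dia x y)"
    and "dbl = (\<lambda>x y. commutator tr x y + br x y)"
  shows "\<exists>\<Phi>_d \<Phi>.
    hopf_iso (uea_conc dbl) (uea_star tr_d br_d) \<Phi>_d \<and>
    (\<forall>xs. \<Phi>_d (mult_list (uea_conc dbl) (map (uea_in dbl) xs)) =
       mult_list (uea_star tr_d br_d) (map (uea_in br_d) xs)) \<and>
    hopf_iso (uea_conc dbl) (uea_star tr br) \<Phi> \<and>
    (\<forall>xs. \<Phi> (mult_list (uea_conc dbl) (map (uea_in dbl) xs)) =
       mult_list (uea_star tr br) (map (uea_in br) xs)) \<and>
    hopf_iso (uea_star tr br) (uea_star tr_d br_d)
      (\<Phi>_d \<circ> inv_into (carrier (uea_conc dbl)) \<Phi>) \<and>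
    (\<forall>xs. (\<Phi>_d \<circ> inv_into (carrier (uea_conc dbl)) \<Phi>)
         (mult_list (uea_star tr br) (map (uea_in br) xs)) =
       mult_list (uea_star tr_d br_d) (map (uea_in br_d) xs))"
proof -
  interpret P: post_lie tr br dbl
    unfolding assms(5) by (rule post_lie_of_post_lie_algebra[OF assms(1)])
  \<comment> \<open>The same \<open>dbl\<close> as for \<open>P\<close>: both maps start from one
    enveloping algebra.\<close>
  interpret Q: post_lie tr_d br_d dbl
    unfolding assms(3,4,5) by (rule post_lie_geometric_deformation[OF assms(1,2)])
  interpret C: tensor_quotient_hopf "uea_conc dbl" "uea_class dbl" "uea_ideal dbl" "(*)" tensor_antipode
    by (rule tensor_quotient_hopf_uea_conc)
  define \<Phi>_d where "\<Phi>_d = C.q_lift (\<lambda>u. uea_class br_d (tensor_phi tr_d u))"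
  define \<Phi> where "\<Phi> = C.q_lift (\<lambda>u. uea_class br (tensor_phi tr u))"
  have \<Phi>_d: "\<Phi>_d (uea_class dbl u) = uea_class br_d (tensor_phi tr_d u)" for u
    unfolding \<Phi>_d_def
    by (rule C.q_lift_q) (simp add: uea_class_eq_iff Q.phi_uea_ideal flip: linear_diff[OF Q.linear_phi])
  have \<Phi>: "\<Phi> (uea_class dbl u) = uea_class br (tensor_phi tr u)" for u
    unfolding \<Phi>_def
    by (rule C.q_lift_q) (simp add: uea_class_eq_iff P.phi_uea_ideal flip: linear_diff[OF P.linear_phi])
  have iso: "hopf_iso (uea_conc dbl) (uea_star tr br) \<Phi>" by (rule P.hopf_iso_phi) (rule \<Phi>)
  then have inj: "inj_on \<Phi> (carrier (uea_conc dbl))"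
    by (simp only: hopf_iso_def bij_betw_def)
  let ?F = "\<Phi>_d \<circ> inv_into (carrier (uea_conc dbl)) \<Phi>"
  \<comment> \<open>On classes the inverse is induced by \<open>tensor_psi tr\<close>, so the
    composite is explicit on representatives.\<close>
  have "inv_into (carrier (uea_conc dbl)) \<Phi> (uea_class br u) = uea_class dbl (tensor_psi tr u)" for u
    using \<Phi>[of "tensor_psi tr u"] by (intro inv_into_f_eq[OF inj C.q_closed]) simp
  then have F: "?F (uea_class br u) = uea_class br_d (tensor_phi tr_d (tensor_psi tr u))" for u
    by (simp add: \<Phi>_d)
  \<comment> \<open>The composite is verified directly on T, as \<open>tensor_phi tr_d\<close> after
    \<open>tensor_psi tr\<close>, with inverse \<open>tensor_phi tr\<close> after
    \<open>tensor_psi tr_d\<close>. It passes through the ideal of \<open>dbl\<close> in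
    between.\<close>
  have "hopf_iso (uea_star tr br) (uea_star tr_d br_d) ?F"
  proof (rule tensor_quotient_hopf_iso[OF P.tensor_quotient_hopf_uea_star Q.tensor_quotient_hopf_uea_star])
    show "linear (\<lambda>u. tensor_phi tr_d (tensor_psi tr u))" "linear (\<lambda>u. tensor_phi tr (tensor_psi tr_d u))"
      by (intro P.linear_phi_comp Q.linear_phi_comp P.linear_psi Q.linear_psi)+
    show "tensor_phi tr_d (tensor_psi tr (tensor_star tr u v)) =
        tensor_star tr_d (tensor_phi tr_d (tensor_psi tr u)) (tensor_phi tr_d (tensor_psi tr v))" for u v
      by (simp add: tensor_star_def[of tr] Q.phi_star)
    show "sweedler b (tensor_phi tr_d (tensor_psi tr u)) =
        sweedler (\<lambda>v w. b (tensor_phi tr_d (tensor_psi tr v)) (tensor_phi tr_d (tensor_psi tr w))) u"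
      if "bilinear b"
      for b :: "'a tensor_algebra \<Rightarrow> 'a tensor_algebra \<Rightarrow> ('a tensor_algebra set \<times> 'a tensor_algebra set \<Rightarrow>\<^sub>0 real)" and u
      using that by (simp add: Q.sweedler_phi P.sweedler_psi bilinear_comp[OF that Q.linear_phi Q.linear_phi])
  qed (use F in \<open>simp_all add: Q.phi_uea_ideal P.psi_uea_ideal P.phi_uea_ideal Q.psi_uea_ideal\<close>)
  moreover have "?F (mult_list (uea_star tr br) (map (uea_in br) xs)) =
      mult_list (uea_star tr_d br_d) (map (uea_in br_d) xs)" for xs
    by (simp only: P.mult_list_star Q.mult_list_star F P.psi_phi)
  moreover have "hopf_iso (uea_conc dbl) (uea_star tr_d br_d) \<Phi>_d" by (rule Q.hopf_iso_phi) (rule \<Phi>_d)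
  ultimately show ?thesis
    using iso
    by (intro exI[of _ \<Phi>_d] exI[of _ \<Phi>] conjI allI)
      (simp_all only: mult_list_conc P.mult_list_star Q.mult_list_star \<Phi>_d \<Phi>)
qed

end
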